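(* Let $(B^H_t)_{t\ge 0}$ be a standard fractional Brownian motion with Hurst parameter $H\in(1/2,1)$, let $a>0$, and let $M_a^{H,-}$ and $R_a^H$ be its maximum loss and its range up to time $a$. Then $$\frac{\sqrt 2\, a^H}{2\sqrt \pi}\ \le\ E(M_a^{H,-})\ \le\ \frac{2\sqrt 2\, a^H}{\sqrt \pi},$$ and, for every $y>0$, $$P(M_a^{H,-}>y)\ <\ P(R_a^H\ge y)\ \le\ \frac{2\sqrt 2\, a^H}{y\sqrt \pi}.$$
   Context: A standard fractional Brownian motion $(B^H_t)_{t\ge0}$ with Hurst parameter $H\in(0,1)$ is a continuous centered Gaussian process with $B^H_0=0$ and covariance $E[B^H_tB^H_s]=\frac12\left(t^{2H}+s^{2H}-|t-s|^{2H}\right)$. For $t\ge 0$: the supremum is $S_t^H=\sup_{0\le v\le t}B^H_v$, the infimum is $I_t^H=\inf_{0\le v\le t}B^H_v$, the range is $R_t^H=S_t^H-I_t^H$, and the maximum loss is $M_t^{H,-}=\sup_{0\le u\le v\le t}(B^H_u-B^H_v)$. *)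

theory Defs
  imports "HOL-Probability.Probability"
begin

(* Normal distributions are allowed to be degenerate (variance 0): a Gaussian vector may have a
   singular covariance matrix, and a process started at 0 has X 0 = 0. *)
definition gaussian_rv :: "'a measure \<Rightarrow> ('a \<Rightarrow> real) \<Rightarrow> bool" where
  "gaussian_rv M X \<longleftrightarrow> X \<in> borel_measurable M \<and>
     ((\<exists>\<mu>. AE \<omega> in M. X \<omega> = \<mu>) \<or>
      (\<exists>\<mu> \<sigma>. 0 < \<sigma> \<and> distributed M lborel X (normal_density \<mu> \<sigma>)))"

(* A family of variables is jointly Gaussian iff every finite linear combination is Gaussian. *)
definition gaussian_process :: "'a measure \<Rightarrow> real set \<Rightarrow> (real \<Rightarrow> 'a \<Rightarrow> real) \<Rightarrow> bool" where
  "gaussian_process M T X \<longleftrightarrow>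
     (\<forall>J c. finite J \<and> J \<subseteq> T \<longrightarrow> gaussian_rv M (\<lambda>\<omega>. \<Sum>t\<in>J. c t * X t \<omega>))"

definition centered_process :: "'a measure \<Rightarrow> real set \<Rightarrow> (real \<Rightarrow> 'a \<Rightarrow> real) \<Rightarrow> bool" where
  "centered_process M T X \<longleftrightarrow>
     (\<forall>t\<in>T. integrable M (X t) \<and> prob_space.expectation M (X t) = 0)"

definition continuous_process :: "'a measure \<Rightarrow> real set \<Rightarrow> (real \<Rightarrow> 'a \<Rightarrow> real) \<Rightarrow> bool" where
  "continuous_process M T X \<longleftrightarrow> (\<forall>\<omega>\<in>space M. continuous_on T (\<lambda>t. X t \<omega>))"

(* Only the times t in {0..} matter; the values of B at negative times are unconstrained. *)
definition fractional_brownian_motion ::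
    "'a measure \<Rightarrow> real \<Rightarrow> (real \<Rightarrow> 'a \<Rightarrow> real) \<Rightarrow> bool" where
  "fractional_brownian_motion M H B \<longleftrightarrow>
     prob_space M \<and> 0 < H \<and> H < 1 \<and>
     continuous_process M {0..} B \<and>
     centered_process M {0..} B \<and>
     gaussian_process M {0..} B \<and>
     (\<forall>\<omega>\<in>space M. B 0 \<omega> = 0) \<and>
     (\<forall>s\<ge>0. \<forall>t\<ge>0. prob_space.expectation M (\<lambda>\<omega>. B t \<omega> * B s \<omega>) =
        (t powr (2 * H) + s powr (2 * H) - \<bar>t - s\<bar> powr (2 * H)) / 2)"

(* The suprema and infima below are taken in the reals. For t >= 0 and a path that is continuous
   on {0..}, they range over nonempty bounded sets. *)
definition running_sup :: "(real \<Rightarrow> 'a \<Rightarrow> real) \<Rightarrow> real \<Rightarrow> 'a \<Rightarrow> real" where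
  "running_sup X t \<omega> = (SUP v\<in>{0..t}. X v \<omega>)"

definition running_inf :: "(real \<Rightarrow> 'a \<Rightarrow> real) \<Rightarrow> real \<Rightarrow> 'a \<Rightarrow> real" where
  "running_inf X t \<omega> = (INF v\<in>{0..t}. X v \<omega>)"

definition process_range :: "(real \<Rightarrow> 'a \<Rightarrow> real) \<Rightarrow> real \<Rightarrow> 'a \<Rightarrow> real" where
  "process_range X t \<omega> = running_sup X t \<omega> - running_inf X t \<omega>"

definition max_loss :: "(real \<Rightarrow> 'a \<Rightarrow> real) \<Rightarrow> real \<Rightarrow> 'a \<Rightarrow> real" where
  "max_loss X t \<omega> = (SUP (u, v)\<in>{(u, v). 0 \<le> u \<and> u \<le> v \<and> v \<le> t}. X u \<omega> - X v \<omega>)"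

end

(* For H > 1/2 the covariance of fractional Brownian motion on a finite grid dominates that of a Gaussian
   random walk with the same variances, so by Slepian's interpolation argument (applied to the soft
   maximum ln (1 + sum exp)) its expected maximum is at most that of the walk, hence, by a reflection
   argument, at most E |B a| = a^H sqrt (2 / pi). Letting the grid be refined and using the symmetry of B,
   the range has mean at most twice this, and the maximum loss lies between the negative part of B a and
   the range; the tail bound is Markov's inequality.
   For the strict inequality, write B t = r t * B a + R t with R independent of B a. As r is strictly
   increasing, the maximum loss of any fixed path R t + x * r t tends to 0 as x grows, so with positive
   probability B a is large while the loss is at most y. *)

theory Submission
  imports Defs "HOL-Real_Asymp.Real_Asymp"
begin

text \<open>Joint normality is given only through the laws of single linear combinations, so
  everything about vectors is read off characteristic functions: independence comes from their
  factorization, and integration by parts from independence of a regression residual. The maximum is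
  not differentiable along the interpolation, hence the soft maximum; its summand 1 stands for time
  0, where B has variance 0 while the comparison asks for positive variances.
  \<open>1 / 2 < H\<close> enters through superadditivity of \<open>t powr (2 * H)\<close>: it puts
  the covariance at times s <= t above \<open>s powr (2 * H)\<close>, the covariance of the walk,
  and it makes r strictly increasing. Larger covariances with equal variances lower the expected
  maximum, and for the walk the bound 2 E max(0, S n) = E |S n| gives the constant sqrt (2 / pi). In
  the strict inequality the slope K that tames a path depends on the path, and the loss involves
  uncountably many times; countably many integer slopes and finite grids reduce both to independence
  of B a from finitely many residuals.\<close>

section \<open>Characteristic functions and independence\<close>

text \<open>Uniqueness of Fourier transforms for the finite signed measure obtained by pushing
  \<open>h\<close> times \<open>M\<close> forward along \<open>X\<close>. Levy uniqueness speaks of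
  probability measures, so \<open>h\<close> is split into its positive and negative parts, which
  have equal mass \<open>c\<close> (transform at 0), and both are normalized.\<close>

lemma integral_indicator_eq_0_real:
  fixes h X :: "'a \<Rightarrow> real"
  assumes h: "integrable M h" and X[measurable]: "X \<in> borel_measurable M"
    and 0: "\<And>t. (\<integral>\<omega>. complex_of_real (h \<omega>) * iexp (t * X \<omega>) \<partial>M) = 0"
    and A[measurable]: "A \<in> sets borel"
  shows "(\<integral>\<omega>. h \<omega> * indicator A (X \<omega>) \<partial>M) = 0"
proof -
  have [measurable]: "h \<in> borel_measurable M" using h by auto
  define p where "p \<omega> = max 0 (h \<omega>)" for \<omega>
  define q where "q \<omega> = max 0 (- h \<omega>)" for \<omega>
  have p: "integrable M p" and q: "integrable M q"
    unfolding p_def q_def using h by auto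
  have [measurable]: "p \<in> borel_measurable M" "q \<in> borel_measurable M" using p q by auto
  have p0: "0 \<le> p \<omega>" and q0: "0 \<le> q \<omega>" and hpq: "h \<omega> = p \<omega> - q \<omega>" for \<omega>
    by (auto simp: p_def q_def)
  have int: "integrable M (\<lambda>\<omega>. complex_of_real (g \<omega>) * iexp (t * X \<omega>))"
    if "integrable M g" for g t
  proof (rule Bochner_Integration.integrable_bound[OF that])
    have [measurable]: "g \<in> borel_measurable M" using that by auto
    show "(\<lambda>\<omega>. complex_of_real (g \<omega>) * iexp (t * X \<omega>)) \<in> borel_measurable M" by measurable
  qed (auto simp: norm_mult simp del: of_real_mult)
  have eq: "(\<integral>\<omega>. complex_of_real (p \<omega>) * iexp (t * X \<omega>) \<partial>M) = (\<integral>\<omega>. complex_of_real (q \<omega>) * iexp (t * X \<omega>) \<partial>M)" for t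
  proof -
    have "(\<integral>\<omega>. complex_of_real (p \<omega>) * iexp (t * X \<omega>) \<partial>M) - (\<integral>\<omega>. complex_of_real (q \<omega>) * iexp (t * X \<omega>) \<partial>M) = (\<integral>\<omega>. complex_of_real (h \<omega>) * iexp (t * X \<omega>) \<partial>M)"
      using int[OF p, of t] int[OF q, of t]
      by (subst Bochner_Integration.integral_diff[symmetric]) (auto simp: hpq algebra_simps intro!: Bochner_Integration.integral_cong)
    then show ?thesis using 0[of t] by simp
  qed
  define c where "c = (\<integral>\<omega>. p \<omega> \<partial>M)"
  have cq: "c = (\<integral>\<omega>. q \<omega> \<partial>M)"
    using eq[of 0] unfolding c_def by simp
  have c0: "0 \<le> c" unfolding c_def using p0 by (intro Bochner_Integration.integral_nonneg)
  show ?thesis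
  proof (cases "c = 0")
    \<comment> \<open>With mass 0 there is nothing to normalize, but then both parts vanish almost
      everywhere.\<close>
    case True
    then have "AE \<omega> in M. p \<omega> = 0" "AE \<omega> in M. q \<omega> = 0"
      using c_def cq integral_nonneg_eq_0_iff_AE[OF p] integral_nonneg_eq_0_iff_AE[OF q] p0 q0 by simp_all
    then have "AE \<omega> in M. h \<omega> * indicator A (X \<omega>) = 0" by eventually_elim (simp add: hpq)
    then show ?thesis by (subst integral_cong_AE[where g="\<lambda>_. 0"]) auto
  next
    case False
    then have c: "c > 0" using c0 by simp
    define \<mu> where "\<mu> g = distr (density M (\<lambda>\<omega>. ennreal (g \<omega> / c))) borel X" for g
    have \<mu>: "real_distribution (\<mu> g)"
      "char (\<mu> g) t = (\<integral>\<omega>. complex_of_real (g \<omega>) * iexp (t * X \<omega>) \<partial>M) / c"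
      "measure (\<mu> g) A = (\<integral>\<omega>. g \<omega> * indicator A (X \<omega>) \<partial>M) / c"
      if g: "integrable M g" "c = (\<integral>\<omega>. g \<omega> \<partial>M)" "\<And>\<omega>. 0 \<le> g \<omega>" for g t
    proof -
      have [measurable]: "g \<in> borel_measurable M" using g by auto
      have "(\<integral>\<^sup>+ \<omega>. ennreal (g \<omega> / c) \<partial>M) = 1"
        using g c by (subst nn_integral_eq_integral) auto
      then have "prob_space (density M (\<lambda>\<omega>. ennreal (g \<omega> / c)))"
        by (intro prob_spaceI) (auto simp: emeasure_density)
      then interpret D: prob_space "density M (\<lambda>\<omega>. ennreal (g \<omega> / c))" .
      show "real_distribution (\<mu> g)" unfolding \<mu>_def
        by (intro D.real_distribution_distr) auto
      show "char (\<mu> g) t = (\<integral>\<omega>. complex_of_real (g \<omega>) * iexp (t * X \<omega>) \<partial>M) / c"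
        unfolding char_def \<mu>_def using g(3) c
        by (simp add: integral_distr integral_density scaleR_conv_of_real)
      have "measure (\<mu> g) A = (\<integral>x. indicator A x \<partial>\<mu> g)" unfolding \<mu>_def by simp
      also have "\<dots> = (\<integral>\<omega>. indicator A (X \<omega>) \<partial>density M (\<lambda>\<omega>. ennreal (g \<omega> / c)))"
        unfolding \<mu>_def by (rule integral_distr) auto
      also have "\<dots> = (\<integral>\<omega>. (g \<omega> / c) *\<^sub>R indicator A (X \<omega>) \<partial>M)"
        using g(3) c by (intro integral_density) auto
      also have "\<dots> = (\<integral>\<omega>. g \<omega> * indicator A (X \<omega>) \<partial>M) / c" by simp
      finally show "measure (\<mu> g) A = (\<integral>\<omega>. g \<omega> * indicator A (X \<omega>) \<partial>M) / c" .
    qed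
    have "\<mu> p = \<mu> q"
      using Levy_uniqueness[OF \<mu>(1) \<mu>(1), OF p c_def p0 q cq q0] \<mu>(2)[OF p c_def p0] \<mu>(2)[OF q cq q0] eq
      by (auto simp: fun_eq_iff)
    then have "(\<integral>\<omega>. p \<omega> * indicator A (X \<omega>) \<partial>M) = (\<integral>\<omega>. q \<omega> * indicator A (X \<omega>) \<partial>M)"
      using \<mu>(3)[OF p c_def p0] \<mu>(3)[OF q cq q0] c by (simp del: of_real_mult)
    moreover have "(\<integral>\<omega>. h \<omega> * indicator A (X \<omega>) \<partial>M) = (\<integral>\<omega>. p \<omega> * indicator A (X \<omega>) \<partial>M) - (\<integral>\<omega>. q \<omega> * indicator A (X \<omega>) \<partial>M)"
      unfolding hpq left_diff_distrib
      by (intro Bochner_Integration.integral_diff Bochner_Integration.integrable_bound[OF p] Bochner_Integration.integrable_bound[OF q])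
        (auto split: split_indicator)
    ultimately show ?thesis by simp
  qed
qed

text \<open>Real and imaginary parts are treated separately. Their transforms vanish once that of
  \<open>cnj h\<close> does, and this one is the conjugate of the transform of \<open>h\<close> at
  \<open>-t\<close>.\<close>

lemma integral_indicator_eq_0:
  fixes h :: "'a \<Rightarrow> complex" and X :: "'a \<Rightarrow> real"
  assumes h: "integrable M h" and X[measurable]: "X \<in> borel_measurable M"
    and 0: "\<And>t. (\<integral>\<omega>. h \<omega> * iexp (t * X \<omega>) \<partial>M) = 0"
    and A[measurable]: "A \<in> sets borel"
  shows "(\<integral>\<omega>. h \<omega> * indicator A (X \<omega>) \<partial>M) = 0"
proof -
  have [measurable]: "h \<in> borel_measurable M" "(\<lambda>\<omega>. cnj (h \<omega>)) \<in> borel_measurable M"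
    using h by (auto intro!: borel_measurable_integrable simp del: complex_cnj_cnj)
  have int: "integrable M (\<lambda>\<omega>. h \<omega> * iexp (t * X \<omega>))" 
     "integrable M (\<lambda>\<omega>. cnj (h \<omega>) * iexp (t * X \<omega>))" for t
    by (rule Bochner_Integration.integrable_bound[OF h]; simp add: norm_mult del: of_real_mult)+
  have intA: "integrable M (\<lambda>\<omega>. h \<omega> * indicator A (X \<omega>))"
    by (rule Bochner_Integration.integrable_bound[OF h]) (auto simp: norm_mult split: split_indicator)
  have cnj: "(\<integral>\<omega>. cnj (h \<omega>) * iexp (t * X \<omega>) \<partial>M) = 0" for t
  proof -
    have c1: "cnj (iexp x) = iexp (- x)" for x
      by (metis cis_cnj cis_conv_exp)
    have "cnj (\<integral>\<omega>. h \<omega> * iexp (- t * X \<omega>) \<partial>M) = (\<integral>\<omega>. cnj (h \<omega>) * iexp (t * X \<omega>) \<partial>M)"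
      by (simp only: Bochner_Integration.integral_cnj[symmetric] complex_cnj_mult c1 mult_minus_left minus_minus)
    then show ?thesis using 0[of "-t"] by simp
  qed
  have Re: "complex_of_real (Re (h \<omega>)) * iexp s = (h \<omega> * iexp s + cnj (h \<omega>) * iexp s) / 2" 
    and Im: "complex_of_real (Im (h \<omega>)) * iexp s = (h \<omega> * iexp s - cnj (h \<omega>) * iexp s) / (2 * \<i>)" for \<omega> s
  proof -
    have "h \<omega> + cnj (h \<omega>) = 2 * complex_of_real (Re (h \<omega>))" "h \<omega> - cnj (h \<omega>) = 2 * \<i> * complex_of_real (Im (h \<omega>))"
      by (auto simp: complex_eq_iff)
    then show "complex_of_real (Re (h \<omega>)) * iexp s = (h \<omega> * iexp s + cnj (h \<omega>) * iexp s) / 2"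
      "complex_of_real (Im (h \<omega>)) * iexp s = (h \<omega> * iexp s - cnj (h \<omega>) * iexp s) / (2 * \<i>)"
      unfolding distrib_right[symmetric] left_diff_distrib[symmetric] by simp_all
  qed
  have "(\<integral>\<omega>. Re (h \<omega>) * indicator A (X \<omega>) \<partial>M) = 0"
    by (rule integral_indicator_eq_0_real) (use h int in \<open>auto simp: Re 0 cnj simp del: of_real_mult\<close>)
  moreover have "(\<integral>\<omega>. Im (h \<omega>) * indicator A (X \<omega>) \<partial>M) = 0"
    by (rule integral_indicator_eq_0_real) (use h int in \<open>auto simp: Im 0 cnj simp del: of_real_mult\<close>)
  moreover have "Re (indicator A x) = indicator A x" "Im (indicator A x) = 0" for x :: real
    by (auto split: split_indicator)
  ultimately show ?thesis
    by (simp add: complex_eq_iff integral_Re[OF intA, symmetric] integral_Im[OF intA, symmetric])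
qed

text \<open>Exponentials are exchanged for indicators one coordinate at a time. The arbitrary
  \<open>h\<close> first absorbs the remaining exponentials, so that the one-dimensional lemma
  applies to \<open>R j\<close>, and then the indicator just gained, so that the induction
  hypothesis applies.\<close>

lemma integral_prod_indicator_eq_0:
  fixes h :: "'a \<Rightarrow> complex" and R :: "'i \<Rightarrow> 'a \<Rightarrow> real"
  assumes "finite J" and "integrable M h" and "\<And>j. j \<in> J \<Longrightarrow> R j \<in> borel_measurable M"
    and "\<And>c. (\<integral>\<omega>. h \<omega> * iexp (\<Sum>j\<in>J. c j * R j \<omega>) \<partial>M) = 0"
    and "\<And>j. j \<in> J \<Longrightarrow> A j \<in> sets borel"
  shows "(\<integral>\<omega>. h \<omega> * (\<Prod>j\<in>J. indicator (A j) (R j \<omega>)) \<partial>M) = 0"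
  using assms
proof (induction J arbitrary: h rule: finite_induct)
  case empty
  then show ?case by simp
next
  case (insert j J)
  have [measurable]: "R j \<in> borel_measurable M" "A j \<in> sets borel" 
     "\<And>k. k \<in> J \<Longrightarrow> R k \<in> borel_measurable M" 
    "h \<in> borel_measurable M"
    using insert.prems by auto
  have "(\<integral>\<omega>. h \<omega> * iexp (\<Sum>k\<in>J. c k * R k \<omega>) * indicator (A j) (R j \<omega>) \<partial>M) = 0" for c
  proof (rule integral_indicator_eq_0)
    show "integrable M (\<lambda>\<omega>. h \<omega> * iexp (\<Sum>k\<in>J. c k * R k \<omega>))"
      by (rule Bochner_Integration.integrable_bound[OF insert.prems(1)]) (auto simp: norm_mult simp del: of_real_mult of_real_sum)
    show "(\<integral>\<omega>. h \<omega> * iexp (\<Sum>k\<in>J. c k * R k \<omega>) * iexp (t * R j \<omega>) \<partial>M) = 0" for t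
    proof -
      have "(\<Sum>k\<in>insert j J. (c(j := t)) k * R k \<omega>) = t * R j \<omega> + (\<Sum>k\<in>J. c k * R k \<omega>)" for \<omega>
        using insert.hyps by (auto intro!: sum.cong)
      then have "h \<omega> * iexp (\<Sum>k\<in>J. c k * R k \<omega>) * iexp (t * R j \<omega>) = h \<omega> * iexp (\<Sum>k\<in>insert j J. (c(j := t)) k * R k \<omega>)" for \<omega>
        by (simp add: exp_add distrib_left)
      then show ?thesis using insert.prems(3)[of "c(j := t)"] by (simp only:)
    qed
  qed simp_all
  moreover have "integrable M (\<lambda>\<omega>. h \<omega> * indicator (A j) (R j \<omega>))"
    by (rule Bochner_Integration.integrable_bound[OF insert.prems(1)]) (auto simp: norm_mult split: split_indicator)
  ultimately have "(\<integral>\<omega>. (h \<omega> * indicator (A j) (R j \<omega>)) * (\<Prod>j\<in>J. indicator (A j) (R j \<omega>)) \<partial>M) = 0"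
    by (intro insert.IH) (use insert.prems in \<open>auto simp: mult_ac\<close>)
  then show ?case using insert.hyps by (simp add: mult_ac)
qed

text \<open>Kac's theorem. Exponentials are exchanged for indicators first in \<open>U\<close> and
  then in all \<open>R j\<close>, each time against a centered factor; this gives the product rule
  on boxes, and boxes form a pi-system that generates the product sigma-algebra.\<close>

lemma (in prob_space) distr_pair_PiM_if_char_mult:
  fixes U :: "'a \<Rightarrow> real" and R :: "'i \<Rightarrow> 'a \<Rightarrow> real"
  assumes J: "finite J" and U[measurable]: "U \<in> borel_measurable M"
    and R[measurable]: "\<And>j. j \<in> J \<Longrightarrow> R j \<in> borel_measurable M"
    and mult: "\<And>s c. expectation (\<lambda>\<omega>. iexp (s * U \<omega> + (\<Sum>j\<in>J. c j * R j \<omega>))) =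
      expectation (\<lambda>\<omega>. iexp (s * U \<omega>)) * expectation (\<lambda>\<omega>. iexp (\<Sum>j\<in>J. c j * R j \<omega>))"
  shows "distr M (borel \<Otimes>\<^sub>M (\<Pi>\<^sub>M j\<in>J. borel)) (\<lambda>\<omega>. (U \<omega>, \<lambda>j\<in>J. R j \<omega>)) =
    distr M borel U \<Otimes>\<^sub>M distr M (\<Pi>\<^sub>M j\<in>J. borel) (\<lambda>\<omega>. \<lambda>j\<in>J. R j \<omega>)"
proof -
  let ?R = "\<lambda>\<omega>. \<lambda>j\<in>J. R j \<omega>"
  have Rm[measurable]: "?R \<in> measurable M (\<Pi>\<^sub>M j\<in>J. borel)" by measurable
  have int: "integrable M (\<lambda>\<omega>. iexp (f \<omega>))" if [measurable]: "f \<in> borel_measurable M" for f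
    by (rule integrable_const_bound[where B=1]) auto
  have box: "prob {\<omega>\<in>space M. U \<omega> \<in> A \<and> (\<forall>j\<in>J. R j \<omega> \<in> B j)} = 
      prob {\<omega>\<in>space M. U \<omega> \<in> A} * prob {\<omega>\<in>space M. \<forall>j\<in>J. R j \<omega> \<in> B j}"
    if [measurable]: "A \<in> sets borel" and B: "\<And>j. j \<in> J \<Longrightarrow> B j \<in> sets borel" for A B
  proof -
    have S1[measurable]: "{\<omega>\<in>space M. \<forall>j\<in>J. R j \<omega> \<in> B j} \<in> sets M"
      using J B by measurable
    have S2[measurable]: "{\<omega>\<in>space M. U \<omega> \<in> A \<and> (\<forall>j\<in>J. R j \<omega> \<in> B j)} \<in> sets M"
      using J B by measurable
    \<comment> \<open>The factorization \<open>mult\<close> says that the centered exponential has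
      vanishing transform against \<open>U\<close>.\<close>
    have 1: "expectation (\<lambda>\<omega>. (iexp (\<Sum>j\<in>J. c j * R j \<omega>) - expectation (\<lambda>\<omega>. iexp (\<Sum>j\<in>J. c j * R j \<omega>))) * indicator A (U \<omega>)) = 0" for c
    proof (rule integral_indicator_eq_0)
      show "expectation (\<lambda>\<omega>. (iexp (\<Sum>j\<in>J. c j * R j \<omega>) - expectation (\<lambda>\<omega>. iexp (\<Sum>j\<in>J. c j * R j \<omega>))) * iexp (t * U \<omega>)) = 0" for t
      proof -
        let ?k = "expectation (\<lambda>\<omega>. iexp (\<Sum>j\<in>J. c j * R j \<omega>))"
        have "expectation (\<lambda>\<omega>. (iexp (\<Sum>j\<in>J. c j * R j \<omega>) - ?k) * iexp (t * U \<omega>))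
          = expectation (\<lambda>\<omega>. iexp (t * U \<omega> + (\<Sum>j\<in>J. c j * R j \<omega>)) - ?k * iexp (t * U \<omega>))"
          by (intro Bochner_Integration.integral_cong) (simp_all add: exp_add algebra_simps)
        also have "\<dots> = expectation (\<lambda>\<omega>. iexp (t * U \<omega> + (\<Sum>j\<in>J. c j * R j \<omega>))) - ?k * expectation (\<lambda>\<omega>. iexp (t * U \<omega>))"
          by (subst Bochner_Integration.integral_diff) (auto intro!: int integrable_mult_right simp del: of_real_mult of_real_sum of_real_add)
        finally show ?thesis using mult[of t c] by simp
      qed
    qed (auto intro!: int simp del: of_real_mult of_real_sum)
    have "expectation (\<lambda>\<omega>. (indicator A (U \<omega>) - complex_of_real (prob {\<omega>\<in>space M. U \<omega> \<in> A})) * (\<Prod>j\<in>J. indicator (B j) (R j \<omega>))) = 0"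
    proof (rule integral_prod_indicator_eq_0[OF J])
      have i: "integrable M (\<lambda>\<omega>. indicator A (U \<omega>) :: complex)"
        by (rule integrable_const_bound[where B=1]) (auto split: split_indicator)
      then show "integrable M (\<lambda>\<omega>. indicator A (U \<omega>) - complex_of_real (prob {\<omega>\<in>space M. U \<omega> \<in> A}))" by simp
      fix c
      let ?e = "\<lambda>\<omega>. iexp (\<Sum>j\<in>J. c j * R j \<omega>)"
      have pA: "expectation (\<lambda>\<omega>. indicator A (U \<omega>) :: complex) = complex_of_real (prob {\<omega>\<in>space M. U \<omega> \<in> A})"
      proof -
        have "expectation (\<lambda>\<omega>. indicator A (U \<omega>) :: complex) = expectation (\<lambda>\<omega>. complex_of_real (indicator {\<omega>\<in>space M. U \<omega> \<in> A} \<omega>))"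
          by (intro Bochner_Integration.integral_cong) (auto split: split_indicator)
        also have "\<dots> = complex_of_real (prob {\<omega>\<in>space M. U \<omega> \<in> A})" 
          by (subst integral_complex_of_real) simp
        finally show ?thesis .
      qed
      have i2: "integrable M (\<lambda>\<omega>. ?e \<omega> * indicator A (U \<omega>))"
        by (rule integrable_const_bound[where B=1]) (auto split: split_indicator simp: norm_mult simp del: of_real_sum of_real_mult)
      have "0 = expectation (\<lambda>\<omega>. ?e \<omega> * indicator A (U \<omega>)) - expectation ?e * expectation (\<lambda>\<omega>. indicator A (U \<omega>))"
        unfolding 1[of c, symmetric] using i i2 by (simp add: left_diff_distrib)
      also have "\<dots> = expectation (\<lambda>\<omega>. ?e \<omega> * indicator A (U \<omega>) - complex_of_real (prob {\<omega>\<in>space M. U \<omega> \<in> A}) * ?e \<omega>)"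
        unfolding pA by (subst Bochner_Integration.integral_diff) (auto intro!: int i2 integrable_mult_right simp del: of_real_mult of_real_sum)
      finally show "expectation (\<lambda>\<omega>. (indicator A (U \<omega>) - complex_of_real (prob {\<omega>\<in>space M. U \<omega> \<in> A})) * ?e \<omega>) = 0"
        by (simp add: algebra_simps)
    qed (use B in auto)
    moreover have "(\<Prod>j\<in>J. indicator (B j) (R j \<omega>)) = complex_of_real (indicator {\<omega>\<in>space M. \<forall>j\<in>J. R j \<omega> \<in> B j} \<omega>)" if "\<omega> \<in> space M" for \<omega>
      using that J by (auto split: split_indicator simp: indicator_def prod_zero_iff)
    ultimately have "0 = expectation (\<lambda>\<omega>. (indicator A (U \<omega>) - complex_of_real (prob {\<omega>\<in>space M. U \<omega> \<in> A})) * complex_of_real (indicator {\<omega>\<in>space M. \<forall>j\<in>J. R j \<omega> \<in> B j} \<omega>))"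
      by (simp cong: Bochner_Integration.integral_cong)
    also have "\<dots> = expectation (\<lambda>\<omega>. complex_of_real (indicator {\<omega>\<in>space M. U \<omega> \<in> A \<and> (\<forall>j\<in>J. R j \<omega> \<in> B j)} \<omega> - 
        prob {\<omega>\<in>space M. U \<omega> \<in> A} * indicator {\<omega>\<in>space M. \<forall>j\<in>J. R j \<omega> \<in> B j} \<omega>))"
      by (intro Bochner_Integration.integral_cong) (auto split: split_indicator)
    also have "\<dots> = complex_of_real (prob {\<omega>\<in>space M. U \<omega> \<in> A \<and> (\<forall>j\<in>J. R j \<omega> \<in> B j)} - prob {\<omega>\<in>space M. U \<omega> \<in> A} * prob {\<omega>\<in>space M. \<forall>j\<in>J. R j \<omega> \<in> B j})"
      using S1 S2 by (subst integral_complex_of_real, subst Bochner_Integration.integral_diff)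
        (auto intro!: integrable_real_indicator integrable_mult_right simp: emeasure_eq_measure)
    finally show ?thesis by (simp del: of_real_mult of_real_diff)
  qed
  let ?\<G> = "{?R -` A \<inter> space M | A. A \<in> prod_algebra J (\<lambda>_. borel)}"
  have "{?R -` A \<inter> space M | A. A \<in> sets (\<Pi>\<^sub>M j\<in>J. borel)} = sigma_sets (space M) ?\<G>"
    using measurable_space[OF Rm] unfolding sets_PiM
    by (subst sigma_sets_vimage_commute[symmetric]) (auto simp: space_PiM)
  note vim = this
  have gen: "sigma_sets (space M) {?R -` A \<inter> space M | A. A \<in> sets (\<Pi>\<^sub>M j\<in>J. borel)} = sigma_sets (space M) ?\<G>"
    unfolding vim by (rule sigma_sets_sigma_sets_eq) blast
  have "indep_set (sigma_sets (space M) {U -` A \<inter> space M |A. A \<in> sets borel}) (sigma_sets (space M) ?\<G>)"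
  proof (intro indep_set_sigma_sets)
    show "Int_stable {U -` A \<inter> space M |A. A \<in> sets borel}"
    proof (safe intro!: Int_stableI)
      fix A B :: "real set" assume "A \<in> sets borel" "B \<in> sets borel"
      then show "\<exists>C. U -` A \<inter> space M \<inter> (U -` B \<inter> space M) = U -` C \<inter> space M \<and> C \<in> sets borel"
        by (intro exI[of _ "A \<inter> B"]) auto
    qed
    show "Int_stable ?\<G>"
    proof (safe intro!: Int_stableI)
      fix A B :: "('i \<Rightarrow> real) set" 
      assume "A \<in> prod_algebra J (\<lambda>_. borel)" "B \<in> prod_algebra J (\<lambda>_. borel)"
      then show "\<exists>C. ?R -` A \<inter> space M \<inter> (?R -` B \<inter> space M) = ?R -` C \<inter> space M \<and> C \<in> prod_algebra J (\<lambda>_. borel)"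
        using Int_stableD[OF Int_stable_prod_algebra] by (intro exI[of _ "A \<inter> B"]) auto
    qed
    show "indep_set {U -` A \<inter> space M |A. A \<in> sets borel} ?\<G>"
    proof (safe intro!: indep_setI)
      show "U -` A \<inter> space M \<in> sets M" if "A \<in> sets borel" for A
        using that by (rule measurable_sets[OF U])
      show "?R -` A \<inter> space M \<in> sets M" if "A \<in> prod_algebra J (\<lambda>_. borel)" for A
        using that by (intro measurable_sets[OF Rm]) (auto simp: sets_PiM)
    next
      fix A :: "real set" and E :: "('i \<Rightarrow> real) set" 
      assume A: "A \<in> sets borel" and "E \<in> prod_algebra J (\<lambda>_. borel)"
      then obtain B where B: "E = Pi\<^sub>E J B" "\<And>j. j \<in> J \<Longrightarrow> B j \<in> sets borel"
        by (auto simp: prod_algebra_eq_finite[OF J] Pi_iff)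
      have "U -` A \<inter> space M = {\<omega>\<in>space M. U \<omega> \<in> A}"
        "?R -` E \<inter> space M = {\<omega>\<in>space M. \<forall>j\<in>J. R j \<omega> \<in> B j}"
        "U -` A \<inter> space M \<inter> (?R -` E \<inter> space M) = {\<omega>\<in>space M. U \<omega> \<in> A \<and> (\<forall>j\<in>J. R j \<omega> \<in> B j)}"
        unfolding B(1) by (auto simp: PiE_iff)
      then show "prob (U -` A \<inter> space M \<inter> (?R -` E \<inter> space M)) = prob (U -` A \<inter> space M) * prob (?R -` E \<inter> space M)"
        using box[OF A B(2)] by simp
    qed
  qed
  then have ind: "indep_set (sigma_sets (space M) {U -` A \<inter> space M |A. A \<in> sets borel}) 
     (sigma_sets (space M) {?R -` A \<inter> space M | A. A \<in> sets (\<Pi>\<^sub>M j\<in>J. borel)})"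
    unfolding gen .
  interpret X: prob_space "distr M borel U" by (rule prob_space_distr) fact
  interpret Y: prob_space "distr M (\<Pi>\<^sub>M j\<in>J. borel) ?R" by (rule prob_space_distr) fact
  show ?thesis
  proof (rule pair_measure_eqI[symmetric])
    show "sigma_finite_measure (distr M borel U)" by unfold_locales
    show "sigma_finite_measure (distr M (\<Pi>\<^sub>M j\<in>J. borel) ?R)" by unfold_locales
    fix A :: "real set" and B assume "A \<in> sets (distr M borel U)" "B \<in> sets (distr M (\<Pi>\<^sub>M j\<in>J. borel) ?R)"
    then have A[measurable]: "A \<in> sets borel" and B[measurable]: "B \<in> sets (\<Pi>\<^sub>M j\<in>J. borel)" by auto
    have "prob ((U -` A \<inter> space M) \<inter> (?R -` B \<inter> space M)) = prob (U -` A \<inter> space M) * prob (?R -` B \<inter> space M)"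
      by (rule indep_setD[OF ind]) (use A B in \<open>blast intro: sigma_sets.Basic\<close>)+
    moreover have "(\<lambda>\<omega>. (U \<omega>, ?R \<omega>)) -` (A \<times> B) \<inter> space M = (U -` A \<inter> space M) \<inter> (?R -` B \<inter> space M)" by auto
    ultimately show "emeasure (distr M borel U) A * emeasure (distr M (\<Pi>\<^sub>M j\<in>J. borel) ?R) B = 
       emeasure (distr M (borel \<Otimes>\<^sub>M (\<Pi>\<^sub>M j\<in>J. borel)) (\<lambda>\<omega>. (U \<omega>, ?R \<omega>))) (A \<times> B)"
      by (simp add: emeasure_distr emeasure_eq_measure ennreal_mult)
  qed (simp cong: sets_pair_measure_cong)
qed

section \<open>Gaussian integration by parts\<close>

text \<open>Dominated convergence along an arbitrary sequence of increments. The mean value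
  inequality turns the bound on \<open>f'\<close>, valid at every parameter, into a bound on the
  difference quotients.\<close>

lemma has_real_derivative_integral:
  fixes f f' :: "real \<Rightarrow> 'a \<Rightarrow> real"
  assumes f: "\<And>x. integrable M (f x)" and f': "f' x \<in> borel_measurable M" and g: "integrable M g"
    and deriv: "\<And>x \<omega>. \<omega> \<in> space M \<Longrightarrow> ((\<lambda>x. f x \<omega>) has_real_derivative f' x \<omega>) (at x)"
    and bound: "\<And>x \<omega>. \<omega> \<in> space M \<Longrightarrow> \<bar>f' x \<omega>\<bar> \<le> g \<omega>"
  shows "((\<lambda>x. \<integral>\<omega>. f x \<omega> \<partial>M) has_real_derivative (\<integral>\<omega>. f' x \<omega> \<partial>M)) (at x)"
  unfolding DERIV_def tendsto_at_iff_sequentially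
proof (intro allI impI)
  fix h :: "nat \<Rightarrow> real" assume h: "\<forall>i. h i \<in> UNIV - {0}" "h \<longlonglongrightarrow> 0"
  have [measurable]: "f y \<in> borel_measurable M" for y using f by auto
  have "(\<lambda>n. \<integral>\<omega>. (f (x + h n) \<omega> - f x \<omega>) / h n \<partial>M) \<longlonglongrightarrow> (\<integral>\<omega>. f' x \<omega> \<partial>M)"
  proof (rule integral_dominated_convergence[where w=g])
    show "AE \<omega> in M. (\<lambda>n. (f (x + h n) \<omega> - f x \<omega>) / h n) \<longlonglongrightarrow> f' x \<omega>"
    proof (rule AE_I2)
      fix \<omega> assume "\<omega> \<in> space M"
      from deriv[OF this, of x] h show "(\<lambda>n. (f (x + h n) \<omega> - f x \<omega>) / h n) \<longlonglongrightarrow> f' x \<omega>"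
        unfolding DERIV_def tendsto_at_iff_sequentially comp_def by blast
    qed
    show "AE \<omega> in M. norm ((f (x + h n) \<omega> - f x \<omega>) / h n) \<le> g \<omega>" for n
    proof (rule AE_I2)
      fix \<omega> assume \<omega>: "\<omega> \<in> space M"
      have "norm (f (x + h n) \<omega> - f x \<omega>) \<le> g \<omega> * norm ((x + h n) - x)"
        by (rule field_differentiable_bound[of UNIV "\<lambda>x. f x \<omega>" "\<lambda>x. f' x \<omega>"])
          (use deriv[OF \<omega>] bound[OF \<omega>] in \<open>auto intro: has_field_derivative_subset\<close>)
      then show "norm ((f (x + h n) \<omega> - f x \<omega>) / h n) \<le> g \<omega>"
        using h(1) by (simp add: divide_le_eq)
    qed
  qed (use f' g in auto)
  then show "((\<lambda>h. ((\<integral>\<omega>. f (x + h) \<omega> \<partial>M) - (\<integral>\<omega>. f x \<omega> \<partial>M)) / h) \<circ> h) \<longlonglongrightarrow> (\<integral>\<omega>. f' x \<omega> \<partial>M)"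
    using f by (simp add: comp_def)
qed

text \<open>Stein's identity. The density n satisfies n' = -(x / sigma^2) n, so the difference of
  the two integrands is the derivative of n * g up to a constant factor, and n * g vanishes at both
  ends because \<open>g\<close> is bounded.\<close>

lemma integral_normal_by_parts:
  fixes g g' :: "real \<Rightarrow> real"
  assumes \<sigma>: "0 < \<sigma>" and g: "\<And>x. (g has_real_derivative g' x) (at x)" and g': "\<And>x. isCont g' x"
    and bound: "\<And>x. \<bar>g x\<bar> \<le> K" "\<And>x. \<bar>g' x\<bar> \<le> K'"
  shows "(\<integral>x. x * g x \<partial>density lborel (normal_density 0 \<sigma>)) = \<sigma>\<^sup>2 * (\<integral>x. g' x \<partial>density lborel (normal_density 0 \<sigma>))"
proof -
  let ?n = "normal_density 0 \<sigma>"
  have [measurable]: "g \<in> borel_measurable borel" "g' \<in> borel_measurable borel"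
    using DERIV_isCont[OF g] g' by (auto intro!: borel_measurable_continuous_onI continuous_at_imp_continuous_on)
  have n: "(?n has_real_derivative - (x / \<sigma>\<^sup>2) * ?n x) (at x)" for x
    unfolding normal_density_def[abs_def] using \<sigma> by (auto intro!: derivative_eq_intros simp: field_simps power2_eq_square)
  have i1: "integrable lborel (\<lambda>x. ?n x * (x * g x))"
  proof (rule Bochner_Integration.integrable_bound)
    show "integrable lborel (\<lambda>x. K * (?n x * \<bar>x\<bar>))"
      using integrable_normal_moment_abs[OF \<sigma>, of 0 1] by simp
    show "AE x in lborel. norm (?n x * (x * g x)) \<le> norm (K * (?n x * \<bar>x\<bar>))"
    proof (rule AE_I2)
      fix x
      have "\<bar>g x\<bar> \<le> \<bar>K\<bar>" using bound(1)[of x] by linarith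
      then have "\<bar>g x\<bar> * (?n x * \<bar>x\<bar>) \<le> \<bar>K\<bar> * (?n x * \<bar>x\<bar>)" by (rule mult_right_mono) auto
      then show "norm (?n x * (x * g x)) \<le> norm (K * (?n x * \<bar>x\<bar>))" by (simp add: abs_mult mult_ac)
    qed
  qed simp
  have i2: "integrable lborel (\<lambda>x. ?n x * g' x)"
  proof (rule Bochner_Integration.integrable_bound)
    show "integrable lborel (\<lambda>x. K' * ?n x)" using \<sigma> by simp
    show "AE x in lborel. norm (?n x * g' x) \<le> norm (K' * ?n x)"
    proof (rule AE_I2)
      fix x
      have "\<bar>g' x\<bar> \<le> \<bar>K'\<bar>" using bound(2)[of x] by linarith
      then have "\<bar>g' x\<bar> * ?n x \<le> \<bar>K'\<bar> * ?n x" by (rule mult_right_mono) auto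
      then show "norm (?n x * g' x) \<le> norm (K' * ?n x)" by (simp add: abs_mult mult_ac)
    qed
  qed simp
  let ?f = "\<lambda>x. ?n x * g' x - ?n x * (x * g x) / \<sigma>\<^sup>2"
  have lim: "((\<lambda>x. ?n x * g x) \<longlongrightarrow> 0) F" if "(?n \<longlongrightarrow> 0) F" for F
    using that bound(1) by (intro lim_null_mult_right_bounded[where B=K]) auto
  have n0: "(?n \<longlongrightarrow> 0) at_top" "(?n \<longlongrightarrow> 0) at_bot"
    unfolding normal_density_def[abs_def] using \<sigma> by real_asymp+
  have "(LBINT x=-\<infinity>..\<infinity>. ?f x) = 0 - 0"
  proof (rule interval_integral_FTC_integrable[where F="\<lambda>x. ?n x * g x"])
    show "((\<lambda>x. ?n x * g x) has_vector_derivative ?f x) (at x)" for x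
      unfolding has_real_derivative_iff_has_vector_derivative[symmetric]
      by (auto intro!: derivative_eq_intros n g simp: algebra_simps)
    show "isCont ?f x" for x
      using DERIV_isCont[OF n] DERIV_isCont[OF g] g' by (intro continuous_intros) (use \<sigma> in auto)
    show "set_integrable lborel (einterval (-\<infinity>) \<infinity>) ?f"
      using i1 i2 by (simp add: set_integrable_def)
    show "(((\<lambda>x. ?n x * g x) \<circ> real_of_ereal) \<longlongrightarrow> 0) (at_left \<infinity>)"
      "(((\<lambda>x. ?n x * g x) \<circ> real_of_ereal) \<longlongrightarrow> 0) (at_right (-\<infinity>))"
      unfolding ereal_tendsto_simps by (intro lim n0)+
  qed simp
  then have "(\<integral>x. ?f x \<partial>lborel) = 0"
    by (simp add: interval_lebesgue_integral_def set_lebesgue_integral_def)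
  then have "(\<integral>x. ?n x * (x * g x) \<partial>lborel) = \<sigma>\<^sup>2 * (\<integral>x. ?n x * g' x \<partial>lborel)"
    using i1 i2 \<sigma> by (subst (asm) Bochner_Integration.integral_diff) (auto simp: divide_simps mult.commute)
  then show ?thesis by (simp add: integral_density)
qed

lemma (in prob_space) distributed_normal_if_char:
  assumes X[measurable]: "X \<in> borel_measurable M" and v: "0 < v"
    and char: "\<And>s. expectation (\<lambda>\<omega>. iexp (s * X \<omega>)) = complex_of_real (exp (- (s\<^sup>2 * v) / 2))"
  shows "distributed M lborel X (normal_density 0 (sqrt v))"
proof -
  let ?Y = "\<lambda>\<omega>. X \<omega> / sqrt v"
  have "distr M borel ?Y = std_normal_distribution"
  proof (rule Levy_uniqueness)
    show "real_distribution (distr M borel ?Y)" by (rule real_distribution_distr) simp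
    show "real_distribution std_normal_distribution" by (rule real_dist_normal_dist)
    have "char (distr M borel ?Y) t = exp (- (t^2) / 2)" for t
    proof -
      have "char (distr M borel ?Y) t = expectation (\<lambda>\<omega>. iexp (t / sqrt v * X \<omega>))"
        by (simp add: char_def integral_distr)
      then show ?thesis using v by (simp only: char) (simp add: power_divide)
    qed
    then show "char (distr M borel ?Y) = char std_normal_distribution"
      by (simp add: char_std_normal_distribution fun_eq_iff)
  qed
  moreover have "distr M lborel ?Y = distr M borel ?Y" by (rule distr_cong) auto
  ultimately have "distributed M lborel ?Y std_normal_density"
    by (simp add: distributed_def)
  then show ?thesis
    using normal_standard_normal_convert[of "sqrt v" X 0] v by simp
qed

lemma (in prob_space) char_if_distributed_normal:
  assumes X: "distributed M lborel X (normal_density 0 \<sigma>)" and \<sigma>: "0 < \<sigma>"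
  shows "expectation (\<lambda>\<omega>. iexp (s * X \<omega>)) = complex_of_real (exp (- (s\<^sup>2 * \<sigma>\<^sup>2) / 2))"
proof -
  have [measurable]: "X \<in> borel_measurable M" using distributed_measurable[OF X] by simp
  have "distributed M lborel (\<lambda>x. X x / \<sigma>) std_normal_density"
    using normal_standard_normal_convert[of \<sigma> X 0] \<sigma> X by simp
  then have "distr M lborel (\<lambda>x. X x / \<sigma>) = std_normal_distribution"
    by (simp add: distributed_def)
  moreover have "distr M lborel (\<lambda>x. X x / \<sigma>) = distr M borel (\<lambda>x. X x / \<sigma>)" by (rule distr_cong) auto
  ultimately have "char (distr M borel (\<lambda>x. X x / \<sigma>)) (s * \<sigma>) = complex_of_real (exp (- ((s * \<sigma>)\<^sup>2) / 2))"
    by (simp add: char_std_normal_distribution)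
  then show ?thesis using \<sigma> by (simp add: char_def integral_distr power_mult_distrib)
qed

text \<open>\<open>V\<close>, \<open>\<kappa>\<close> and \<open>Q\<close> play the roles of the
  variance of \<open>U\<close>, its covariances with the \<open>Z j\<close> and the covariance form
  of \<open>Z\<close>, all encoded in the characteristic function. As Z = R + (U / V) kappa with
  \<open>R\<close> independent of \<open>U\<close>, Stein's identity applies in \<open>U\<close>
  with \<open>R\<close> frozen. Only the derivative of \<open>G\<close> in direction
  \<open>\<kappa>\<close> occurs, so a single function \<open>D\<close> does the work of the partial
  derivatives.\<close>

lemma (in prob_space) gaussian_integration_by_parts:
  fixes U :: "'a \<Rightarrow> real" and Z :: "'i \<Rightarrow> 'a \<Rightarrow> real" and G D :: "('i \<Rightarrow> real) \<Rightarrow> real"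
  assumes J: "finite J" and U[measurable]: "U \<in> borel_measurable M"
    and Z[measurable]: "\<And>j. j \<in> J \<Longrightarrow> Z j \<in> borel_measurable M"
    and V: "0 < V"
    and char: "\<And>s c. expectation (\<lambda>\<omega>. iexp (s * U \<omega> + (\<Sum>j\<in>J. c j * Z j \<omega>))) =
      complex_of_real (exp (- (s\<^sup>2 * V + 2 * s * (\<Sum>j\<in>J. c j * \<kappa> j) + Q c) / 2))"
    and G[measurable]: "G \<in> borel_measurable (\<Pi>\<^sub>M j\<in>J. borel)"
    and D[measurable]: "D \<in> borel_measurable (\<Pi>\<^sub>M j\<in>J. borel)"
    and deriv: "\<And>z u. ((\<lambda>u. G (\<lambda>j\<in>J. z j + u * \<kappa> j)) has_real_derivative D (\<lambda>j\<in>J. z j + u * \<kappa> j)) (at u)"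
    and cont: "\<And>z u. isCont (\<lambda>u. D (\<lambda>j\<in>J. z j + u * \<kappa> j)) u"
    and bound: "\<And>z. \<bar>G z\<bar> \<le> K" "\<And>z. \<bar>D z\<bar> \<le> K'"
  shows "expectation (\<lambda>\<omega>. U \<omega> * G (\<lambda>j\<in>J. Z j \<omega>)) = expectation (\<lambda>\<omega>. D (\<lambda>j\<in>J. Z j \<omega>))"
proof -
  define R where "R j \<omega> = Z j \<omega> - U \<omega> / V * \<kappa> j" for j \<omega>
  have R[measurable]: "R j \<in> borel_measurable M" if "j \<in> J" for j
    unfolding R_def[abs_def] using that by measurable
  have charR: "expectation (\<lambda>\<omega>. iexp (s * U \<omega> + (\<Sum>j\<in>J. c j * R j \<omega>))) =
    complex_of_real (exp (- (s\<^sup>2 * V) / 2) * exp (- (Q c - (\<Sum>j\<in>J. c j * \<kappa> j)\<^sup>2 / V) / 2))" for s c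
  proof -
    let ?k = "\<Sum>j\<in>J. c j * \<kappa> j"
    have e1: "s * U \<omega> + (\<Sum>j\<in>J. c j * R j \<omega>) = (s - ?k / V) * U \<omega> + (\<Sum>j\<in>J. c j * Z j \<omega>)" for \<omega>
      unfolding R_def by (simp add: algebra_simps sum_subtractf sum_distrib_left sum_divide_distrib)
    \<comment> \<open>Completing the square: the shift of \<open>s\<close> by \<open>?k / V\<close>
      is the one that removes the term mixing \<open>s\<close> and \<open>c\<close>.\<close>
    have e2: "(s - ?k / V)\<^sup>2 * V + 2 * (s - ?k / V) * ?k + Q c = s\<^sup>2 * V + (Q c - ?k\<^sup>2 / V)"
      using V by (simp add: field_simps power2_eq_square)
    have "exp (- (x + y) / 2) = exp (- x / 2) * exp (- y / 2)" for x y :: real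
      by (simp add: exp_add[symmetric] field_simps)
    note e3 = this
    show ?thesis unfolding e1 char e2 e3 ..
  qed
  \<comment> \<open>\<open>Q\<close> is an arbitrary function. At s = 0 and c = 0 the expectation is
    1, which shows that the factor containing \<open>Q\<close> is 1 there.\<close>
  have charU: "expectation (\<lambda>\<omega>. iexp (s * U \<omega>)) = complex_of_real (exp (- (s\<^sup>2 * V) / 2))" for s
    using charR[of s "\<lambda>_. 0"] charR[of 0 "\<lambda>_. 0"] by (simp add: prob_space)
  have ind: "distr M (borel \<Otimes>\<^sub>M (\<Pi>\<^sub>M j\<in>J. borel)) (\<lambda>\<omega>. (U \<omega>, \<lambda>j\<in>J. R j \<omega>)) =
    distr M borel U \<Otimes>\<^sub>M distr M (\<Pi>\<^sub>M j\<in>J. borel) (\<lambda>\<omega>. \<lambda>j\<in>J. R j \<omega>)"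
  proof (rule distr_pair_PiM_if_char_mult[OF J U R])
    show "expectation (\<lambda>\<omega>. iexp (s * U \<omega> + (\<Sum>j\<in>J. c j * R j \<omega>))) =
      expectation (\<lambda>\<omega>. iexp (s * U \<omega>)) * expectation (\<lambda>\<omega>. iexp (\<Sum>j\<in>J. c j * R j \<omega>))" for s c
      using charR[of s c] charR[of 0 c] charU[of s] by simp
  qed
  define \<nu> where "\<nu> = density lborel (\<lambda>x. ennreal (normal_density 0 (sqrt V) x))"
  have dU: "distributed M lborel U (normal_density 0 (sqrt V))"
    by (rule distributed_normal_if_char[OF U V charU])
  then have dU\<nu>: "distr M borel U = \<nu>"
    unfolding \<nu>_def by (subst distributed_distr_eq_density[symmetric]) (auto intro!: distr_cong)
  have [measurable_cong]: "sets \<nu> = sets borel" unfolding \<nu>_def by simp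
  let ?R = "\<lambda>\<omega>. \<lambda>j\<in>J. R j \<omega>"
  define \<rho> where "\<rho> = distr M (\<Pi>\<^sub>M j\<in>J. borel) ?R"
  have Rm[measurable]: "?R \<in> measurable M (\<Pi>\<^sub>M j\<in>J. borel)" by measurable
  have [measurable_cong]: "sets \<rho> = sets (\<Pi>\<^sub>M j\<in>J. borel)" unfolding \<rho>_def by simp
  interpret \<nu>: prob_space \<nu> unfolding dU\<nu>[symmetric] by (rule prob_space_distr) fact
  interpret \<rho>: prob_space \<rho> unfolding \<rho>_def by (rule prob_space_distr) fact
  interpret P: pair_prob_space \<nu> \<rho> ..
  have fubini: "expectation (\<lambda>\<omega>. f (U \<omega>) (?R \<omega>)) = (\<integral>r. (\<integral>u. f u r \<partial>\<nu>) \<partial>\<rho>)"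
    if [measurable]: "case_prod f \<in> borel_measurable (borel \<Otimes>\<^sub>M (\<Pi>\<^sub>M j\<in>J. borel))"
      and int: "integrable M (\<lambda>\<omega>. f (U \<omega>) (?R \<omega>))" for f :: "real \<Rightarrow> ('i \<Rightarrow> real) \<Rightarrow> real"
  proof -
    have "integrable (\<nu> \<Otimes>\<^sub>M \<rho>) (case_prod f)"
      unfolding dU\<nu>[symmetric] \<rho>_def ind[symmetric] using int by (subst integrable_distr_eq) auto
    then have "(\<integral>r. (\<integral>u. f u r \<partial>\<nu>) \<partial>\<rho>) = integral\<^sup>L (\<nu> \<Otimes>\<^sub>M \<rho>) (case_prod f)"
      by (rule P.integral_snd)
    also have "\<dots> = expectation (\<lambda>\<omega>. f (U \<omega>) (?R \<omega>))"
      unfolding dU\<nu>[symmetric] \<rho>_def ind[symmetric] by (subst integral_distr) auto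
    finally show ?thesis ..
  qed
  have ZR: "(\<lambda>j\<in>J. Z j \<omega>) = (\<lambda>j\<in>J. ?R \<omega> j + U \<omega> / V * \<kappa> j)" for \<omega>
    by (auto simp: R_def fun_eq_iff)
  have intU: "integrable M U"
    using distributed_integrable[OF dU, of "\<lambda>x. x"] integrable_normal_moment[of "sqrt V" 0 1] V by simp
  have "expectation (\<lambda>\<omega>. U \<omega> * G (\<lambda>j\<in>J. Z j \<omega>)) = (\<integral>r. (\<integral>u. u * G (\<lambda>j\<in>J. r j + u / V * \<kappa> j) \<partial>\<nu>) \<partial>\<rho>)"
    unfolding ZR
  proof (rule fubini)
    show "integrable M (\<lambda>\<omega>. U \<omega> * G (\<lambda>j\<in>J. ?R \<omega> j + U \<omega> / V * \<kappa> j))"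
    proof (rule Bochner_Integration.integrable_bound[of M "\<lambda>\<omega>. K * U \<omega>"])
      show "AE \<omega> in M. norm (U \<omega> * G (\<lambda>j\<in>J. ?R \<omega> j + U \<omega> / V * \<kappa> j)) \<le> norm (K * U \<omega>)"
        using bound(1) by (auto simp: abs_mult mult.commute[of _ "\<bar>U _\<bar>"] intro!: mult_left_mono order_trans[OF bound(1)])
    qed (use intU in auto)
  qed measurable
  also have "\<dots> = (\<integral>r. (\<integral>u. D (\<lambda>j\<in>J. r j + u / V * \<kappa> j) \<partial>\<nu>) \<partial>\<rho>)"
  proof (rule Bochner_Integration.integral_cong[OF refl])
    fix r
    \<comment> \<open>Moving \<open>u\<close> moves the argument at speed 1 / V, so the derivative
      is \<open>D / V\<close>; the factor V returns as the variance.\<close>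
    have "(\<integral>u. u * G (\<lambda>j\<in>J. r j + u / V * \<kappa> j) \<partial>\<nu>) = (sqrt V)\<^sup>2 * (\<integral>u. D (\<lambda>j\<in>J. r j + u / V * \<kappa> j) / V \<partial>\<nu>)"
      unfolding \<nu>_def
    proof (rule integral_normal_by_parts)
      show "((\<lambda>u. G (\<lambda>j\<in>J. r j + u / V * \<kappa> j)) has_real_derivative D (\<lambda>j\<in>J. r j + x / V * \<kappa> j) / V) (at x)" for x
        using DERIV_chain2[OF deriv DERIV_cdivide[OF DERIV_ident], of r] by simp
      show "isCont (\<lambda>u. D (\<lambda>j\<in>J. r j + u / V * \<kappa> j) / V) x" for x
      proof -
        have "isCont (\<lambda>u. u / V) x" using V by (intro continuous_intros) auto
        from isCont_o2[OF this cont, of r] V show ?thesis by (intro continuous_intros) auto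
      qed
      show "\<bar>D (\<lambda>j\<in>J. r j + x / V * \<kappa> j) / V\<bar> \<le> K' / V" for x
        using V bound(2) by (simp add: divide_right_mono)
    qed (use V bound in auto)
    then show "(\<integral>u. u * G (\<lambda>j\<in>J. r j + u / V * \<kappa> j) \<partial>\<nu>) = (\<integral>u. D (\<lambda>j\<in>J. r j + u / V * \<kappa> j) \<partial>\<nu>)"
      using V by simp
  qed
  also have "\<dots> = expectation (\<lambda>\<omega>. D (\<lambda>j\<in>J. Z j \<omega>))"
    unfolding ZR
  proof (rule fubini[symmetric])
    show "integrable M (\<lambda>\<omega>. D (\<lambda>j\<in>J. ?R \<omega> j + U \<omega> / V * \<kappa> j))"
      by (rule integrable_const_bound[where B=K']) (use bound in auto)
  qed measurable
  finally show ?thesis .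
qed

section \<open>Comparison of expected maxima of Gaussian vectors\<close>

text \<open>The partial derivative in \<open>x i\<close> of ln (1 + sum exp), a smooth version of
  max(0, max x). The 1 acts as an extra coordinate fixed at 0, so the weights over a finite
  \<open>I\<close> sum to less than 1.\<close>

definition softmax_weight :: "'i set \<Rightarrow> 'i \<Rightarrow> ('i \<Rightarrow> real) \<Rightarrow> real" where
  "softmax_weight I i x = exp (x i) / (1 + (\<Sum>j\<in>I. exp (x j)))"

lemma one_plus_sum_exp_pos: "0 < 1 + (\<Sum>j\<in>I. exp (x j :: real))"
  by (intro add_pos_nonneg sum_nonneg) auto

lemma softmax_weight_nonneg: "0 \<le> softmax_weight I i x"
  unfolding softmax_weight_def using one_plus_sum_exp_pos[of x I] by (simp add: divide_nonneg_pos)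

lemma softmax_weight_le_1: "finite I \<Longrightarrow> i \<in> I \<Longrightarrow> softmax_weight I i x \<le> 1"
  unfolding softmax_weight_def using one_plus_sum_exp_pos[of x I] member_le_sum[of i I "\<lambda>j. exp (x j)"]
  by (simp add: divide_le_eq)

lemma softmax_weight_restrict: "i \<in> I \<Longrightarrow> softmax_weight I i (restrict x I) = softmax_weight I i x"
  unfolding softmax_weight_def by (simp cong: sum.cong)

lemma borel_measurable_softmax_weight:
  assumes "finite I" "i \<in> I" "\<And>j. j \<in> I \<Longrightarrow> (\<lambda>\<omega>. x \<omega> j) \<in> borel_measurable M"
  shows "(\<lambda>\<omega>. softmax_weight I i (x \<omega>)) \<in> borel_measurable M"
  unfolding softmax_weight_def using assms
  by (intro borel_measurable_divide borel_measurable_add borel_measurable_sum borel_measurable_exp) auto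

text \<open>From d p i / d x j = p i * (delta i j - p j), summed along the direction
  \<open>\<kappa>\<close>.\<close>

lemma has_real_derivative_softmax_weight:
  assumes I: "finite I"
  shows "((\<lambda>u. softmax_weight I i (\<lambda>j. z j + u * \<kappa> j)) has_real_derivative
    softmax_weight I i (\<lambda>j. z j + u * \<kappa> j) * (\<kappa> i - (\<Sum>j\<in>I. \<kappa> j * softmax_weight I j (\<lambda>j. z j + u * \<kappa> j)))) (at u)"
proof -
  let ?S = "1 + (\<Sum>j\<in>I. exp (z j + u * \<kappa> j))"
  have S: "?S > 0" by (rule one_plus_sum_exp_pos)
  have "((\<lambda>u. exp (z i + u * \<kappa> i) / (1 + (\<Sum>j\<in>I. exp (z j + u * \<kappa> j)))) has_real_derivative
     (exp (z i + u * \<kappa> i) * \<kappa> i * ?S - exp (z i + u * \<kappa> i) * (\<Sum>j\<in>I. exp (z j + u * \<kappa> j) * \<kappa> j)) / (?S * ?S)) (at u)"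
    using S by (auto intro!: derivative_eq_intros)
  moreover have "(exp (z i + u * \<kappa> i) * \<kappa> i * ?S - exp (z i + u * \<kappa> i) * (\<Sum>j\<in>I. exp (z j + u * \<kappa> j) * \<kappa> j)) / (?S * ?S)
     = exp (z i + u * \<kappa> i) / ?S * (\<kappa> i - (\<Sum>j\<in>I. \<kappa> j * (exp (z j + u * \<kappa> j) / ?S)))"
  proof -
    have "(\<Sum>j\<in>I. \<kappa> j * (exp (z j + u * \<kappa> j) / ?S)) = (\<Sum>j\<in>I. exp (z j + u * \<kappa> j) * \<kappa> j) / ?S"
      by (simp add: sum_divide_distrib mult.commute)
    moreover have "(E * k * S - E * T) / (S * S) = E / S * (k - T / S)" if "S \<noteq> 0" for E k S T :: real
      using that by (simp add: field_simps)
    ultimately show ?thesis using S by simp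
  qed
  ultimately show ?thesis unfolding softmax_weight_def by simp
qed

text \<open>Integration by parts for G = \<open>softmax_weight I i\<close>. Weights in [0, 1] supply
  the bounds, and restricting the argument to \<open>I\<close> does not change them, which
  reconciles total functions with the product space.\<close>

lemma (in prob_space) expectation_mult_softmax_weight:
  fixes U :: "'a \<Rightarrow> real" and Z :: "'i \<Rightarrow> 'a \<Rightarrow> real"
  assumes I: "finite I" "i \<in> I" and U: "U \<in> borel_measurable M"
    and Z: "\<And>j. j \<in> I \<Longrightarrow> Z j \<in> borel_measurable M"
    and V: "0 < V"
    and char: "\<And>s c. expectation (\<lambda>\<omega>. iexp (s * U \<omega> + (\<Sum>j\<in>I. c j * Z j \<omega>))) =
      complex_of_real (exp (- (s\<^sup>2 * V + 2 * s * (\<Sum>j\<in>I. c j * \<kappa> j) + Q c) / 2))"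
  shows "expectation (\<lambda>\<omega>. U \<omega> * softmax_weight I i (\<lambda>j. Z j \<omega>)) =
    expectation (\<lambda>\<omega>. softmax_weight I i (\<lambda>j. Z j \<omega>) * (\<kappa> i - (\<Sum>j\<in>I. \<kappa> j * softmax_weight I j (\<lambda>j. Z j \<omega>))))"
proof -
  define D where "D z = softmax_weight I i z * (\<kappa> i - (\<Sum>j\<in>I. \<kappa> j * softmax_weight I j z))" for z
  have D_restrict: "D (restrict z I) = D z" for z
    unfolding D_def using I by (simp add: softmax_weight_restrict cong: sum.cong)
  have p[measurable]: "softmax_weight I j \<in> borel_measurable (\<Pi>\<^sub>M j\<in>I. borel)" if "j \<in> I" for j
    by (intro borel_measurable_softmax_weight I that) auto
  have Dm: "D \<in> borel_measurable (\<Pi>\<^sub>M j\<in>I. borel)"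
    unfolding D_def[abs_def] using I by measurable
  have pD: "((\<lambda>u. softmax_weight I j (\<lambda>j. z j + u * \<kappa> j)) has_real_derivative
    softmax_weight I j (\<lambda>j. z j + u * \<kappa> j) * (\<kappa> j - (\<Sum>k\<in>I. \<kappa> k * softmax_weight I k (\<lambda>j. z j + u * \<kappa> j)))) (at u)" for j z u
    by (rule has_real_derivative_softmax_weight[OF I(1)])
  have "expectation (\<lambda>\<omega>. U \<omega> * softmax_weight I i (\<lambda>j\<in>I. Z j \<omega>)) = expectation (\<lambda>\<omega>. D (\<lambda>j\<in>I. Z j \<omega>))"
  proof (rule gaussian_integration_by_parts[where V=V and \<kappa>=\<kappa> and Q=Q])
    show "((\<lambda>u. softmax_weight I i (\<lambda>j\<in>I. z j + u * \<kappa> j)) has_real_derivative D (\<lambda>j\<in>I. z j + u * \<kappa> j)) (at u)" for z u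
      using pD[of i z u] I unfolding D_restrict by (simp add: softmax_weight_restrict D_def)
    show "isCont (\<lambda>u. D (\<lambda>j\<in>I. z j + u * \<kappa> j)) u" for z u
      unfolding D_restrict unfolding D_def by (intro continuous_intros DERIV_isCont[OF pD])
    show "\<bar>softmax_weight I i z\<bar> \<le> 1" for z
      using softmax_weight_nonneg[of I i z] softmax_weight_le_1[OF I, of z] by simp
    show "\<bar>D z\<bar> \<le> \<bar>\<kappa> i\<bar> + (\<Sum>j\<in>I. \<bar>\<kappa> j\<bar>)" for z
    proof -
      have "\<bar>\<Sum>j\<in>I. \<kappa> j * softmax_weight I j z\<bar> \<le> (\<Sum>j\<in>I. \<bar>\<kappa> j\<bar>)"
        by (rule order_trans[OF sum_abs sum_mono])
          (auto simp: abs_mult softmax_weight_nonneg softmax_weight_le_1[OF I(1)] intro!: mult_left_le)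
      then have "\<bar>\<kappa> i - (\<Sum>j\<in>I. \<kappa> j * softmax_weight I j z)\<bar> \<le> \<bar>\<kappa> i\<bar> + (\<Sum>j\<in>I. \<bar>\<kappa> j\<bar>)" by linarith
      then have "softmax_weight I i z * \<bar>\<kappa> i - (\<Sum>j\<in>I. \<kappa> j * softmax_weight I j z)\<bar> \<le> 1 * (\<bar>\<kappa> i\<bar> + (\<Sum>j\<in>I. \<bar>\<kappa> j\<bar>))"
        using softmax_weight_nonneg[of I i z] softmax_weight_le_1[OF I, of z] by (intro mult_mono) auto
      then show ?thesis
        unfolding D_def abs_mult using softmax_weight_nonneg[of I i z] by simp
    qed
  qed (use I U Z V char Dm p in auto)
  then show ?thesis using I unfolding D_restrict by (simp add: softmax_weight_restrict D_def)
qed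

text \<open>Expands a quadratic form at x + t e_i. Below it isolates the variance and the mixed term
  that one distinguished variable contributes to the exponent of a characteristic function.\<close>

lemma double_sum_add_single:
  fixes C :: "'i \<Rightarrow> 'i \<Rightarrow> real"
  assumes "finite I" "i \<in> I" "\<And>j k. j \<in> I \<Longrightarrow> k \<in> I \<Longrightarrow> C j k = C k j"
  shows "(\<Sum>j\<in>I. \<Sum>k\<in>I. (x j + (if j = i then t else 0)) * (x k + (if k = i then t else 0)) * C j k) =
    (\<Sum>j\<in>I. \<Sum>k\<in>I. x j * x k * C j k) + 2 * t * (\<Sum>j\<in>I. x j * C i j) + t\<^sup>2 * C i i"
proof -
  have "(\<Sum>k\<in>I. (x j + (if j = i then t else 0)) * (x k + (if k = i then t else 0)) * C j k) =
      (\<Sum>k\<in>I. x j * x k * C j k) + x j * t * C j i + (if j = i then t * (\<Sum>k\<in>I. x k * C i k) + t\<^sup>2 * C i i else 0)" for j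
  proof -
    have "(\<Sum>k\<in>I. (x j + (if j = i then t else 0)) * (x k + (if k = i then t else 0)) * C j k) =
      (\<Sum>k\<in>I. x j * x k * C j k + (if k = i then x j * t * C j i else 0) + (if j = i then t * (x k * C i k) else 0) + (if k = i then (if j = i then t\<^sup>2 * C i i else 0) else 0))"
      by (intro sum.cong) (auto simp: algebra_simps power2_eq_square)
    then show ?thesis using assms(1,2) by (auto simp: sum.distrib sum_distrib_left)
  qed
  then have "(\<Sum>j\<in>I. \<Sum>k\<in>I. (x j + (if j = i then t else 0)) * (x k + (if k = i then t else 0)) * C j k) = 
     (\<Sum>j\<in>I. \<Sum>k\<in>I. x j * x k * C j k) + (\<Sum>j\<in>I. x j * t * C j i) + (t * (\<Sum>k\<in>I. x k * C i k) + t\<^sup>2 * C i i)"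
    using assms(1,2) by (simp add: sum.distrib)
  also have "(\<Sum>j\<in>I. x j * t * C j i) = t * (\<Sum>j\<in>I. x j * C i j)"
    unfolding sum_distrib_left using assms by (intro sum.cong) auto
  finally show ?thesis by simp
qed

text \<open>Stating normality through the characteristic function admits a singular
  \<open>C\<close>, involves no density, and reduces rotations, scaling and joint laws to algebra
  with quadratic forms.\<close>

definition centered_gaussian_vector :: "'a measure \<Rightarrow> 'i set \<Rightarrow> ('i \<Rightarrow> 'a \<Rightarrow> real) \<Rightarrow> ('i \<Rightarrow> 'i \<Rightarrow> real) \<Rightarrow> bool" where
  "centered_gaussian_vector M I X C \<longleftrightarrow> (\<forall>i\<in>I. X i \<in> borel_measurable M) \<and>
    (\<forall>c. (\<integral>\<omega>. iexp (\<Sum>i\<in>I. c i * X i \<omega>) \<partial>M) =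
      complex_of_real (exp (- (\<Sum>i\<in>I. \<Sum>j\<in>I. c i * c j * C i j) / 2)))"

lemma centered_gaussian_vector_char_component:
  assumes "centered_gaussian_vector M I X C" "finite I" "i \<in> I"
  shows "(\<integral>\<omega>. iexp (s * X i \<omega>) \<partial>M) = complex_of_real (exp (- (s\<^sup>2 * C i i) / 2))"
proof -
  have "(\<Sum>j\<in>I. (if j = i then s else 0) * X j \<omega>) = s * X i \<omega>" for \<omega>
    using assms by (simp add: if_distrib[of "\<lambda>x. x * _"] cong: if_cong)
  moreover have "(\<Sum>j\<in>I. \<Sum>k\<in>I. (if j = i then s else 0) * (if k = i then s else 0) * C j k) = s\<^sup>2 * C i i"
    using assms by (simp add: if_distrib[of "\<lambda>x. x * _"] if_distrib[of "\<lambda>x. _ * x"] power2_eq_square cong: if_cong)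
  moreover have "(\<integral>\<omega>. iexp (\<Sum>j\<in>I. c j * X j \<omega>) \<partial>M) =
      complex_of_real (exp (- (\<Sum>j\<in>I. \<Sum>k\<in>I. c j * c k * C j k) / 2))" for c
    using assms(1) unfolding centered_gaussian_vector_def by blast
  note this[of "\<lambda>j. if j = i then s else 0"]
  ultimately show ?thesis by (simp only:)
qed

lemma (in prob_space) integrable_if_char_normal:
  assumes "X \<in> borel_measurable M" "0 < v"
    and "\<And>s. expectation (\<lambda>\<omega>. iexp (s * X \<omega>)) = complex_of_real (exp (- (s\<^sup>2 * v) / 2))"
  shows "integrable M X"
  using distributed_integrable[OF distributed_normal_if_char[OF assms], of "\<lambda>x. x"]
    integrable_normal_moment[of "sqrt v" 0 1] assms(2) by simp

lemma ln_one_plus_sum_exp_le: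
  assumes "finite I"
  shows "ln (1 + (\<Sum>i\<in>I. exp (x i :: real))) \<le> ln (1 + card I) + (\<Sum>i\<in>I. \<bar>x i\<bar>)"
proof -
  have "exp (x i) \<le> exp (\<Sum>i\<in>I. \<bar>x i\<bar>)" if "i \<in> I" for i
    using member_le_sum[of i I "\<lambda>i. \<bar>x i\<bar>"] assms that by (simp add: abs_le_iff)
  then have "(\<Sum>i\<in>I. exp (x i)) \<le> (\<Sum>i\<in>I. exp (\<Sum>i\<in>I. \<bar>x i\<bar>))" by (rule sum_mono)
  then have "1 + (\<Sum>i\<in>I. exp (x i)) \<le> (1 + card I) * exp (\<Sum>i\<in>I. \<bar>x i\<bar>)"
    using one_le_exp_iff[of "\<Sum>i\<in>I. \<bar>x i\<bar>"] by (simp add: distrib_right sum_nonneg add_mono del: one_le_exp_iff)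
  then have "ln (1 + (\<Sum>i\<in>I. exp (x i))) \<le> ln ((1 + card I) * exp (\<Sum>i\<in>I. \<bar>x i\<bar>))"
    using one_plus_sum_exp_pos[of x I] by (subst ln_le_cancel_iff) auto
  then show ?thesis by (simp add: ln_mult)
qed

lemma ln_one_plus_sum_exp_nonneg: "0 \<le> ln (1 + (\<Sum>i\<in>I. exp (x i :: real)))"
  by (simp add: sum_nonneg)

lemma integrable_ln_one_plus_sum_exp:
  fixes X :: "'i \<Rightarrow> 'a \<Rightarrow> real"
  assumes I: "finite I" and M: "finite_measure M" and X: "\<And>i. i \<in> I \<Longrightarrow> integrable M (X i)"
  shows "integrable M (\<lambda>\<omega>. ln (1 + (\<Sum>i\<in>I. exp (X i \<omega>))))"
proof (rule Bochner_Integration.integrable_bound)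
  interpret finite_measure M by fact
  show "integrable M (\<lambda>\<omega>. ln (1 + card I) + (\<Sum>i\<in>I. \<bar>X i \<omega>\<bar>))"
    using X by auto
  show "AE \<omega> in M. norm (ln (1 + (\<Sum>i\<in>I. exp (X i \<omega>)))) \<le> norm (ln (1 + card I) + (\<Sum>i\<in>I. \<bar>X i \<omega>\<bar>))"
  proof (rule AE_I2)
    show "norm (ln (1 + (\<Sum>i\<in>I. exp (X i \<omega>)))) \<le> norm (ln (1 + card I) + (\<Sum>i\<in>I. \<bar>X i \<omega>\<bar>))" for \<omega>
      using ln_one_plus_sum_exp_le[OF I, of "\<lambda>i. X i \<omega>"] ln_one_plus_sum_exp_nonneg[where I=I and x="\<lambda>i. X i \<omega>"]
      unfolding real_norm_def by linarith
  qed
  have [measurable]: "\<And>i. i \<in> I \<Longrightarrow> X i \<in> borel_measurable M" using X by auto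
  show "(\<lambda>\<omega>. ln (1 + (\<Sum>i\<in>I. exp (X i \<omega>)))) \<in> borel_measurable M" by measurable
qed

text \<open>Along the rotation \<open>cos \<theta> X + sin \<theta> Y\<close> with X and Y independent, the derivative of the expected
  soft maximum is, by Gaussian integration by parts, a sum of terms \<open>(C i j - C' i j) * E (p i * p j)\<close>
  with \<open>p\<close> the softmax weights; the diagonal contributions vanish because the variances agree.\<close>

lemma expectation_softmax_mono_covariance:
  fixes X :: "'i \<Rightarrow> 'a \<Rightarrow> real" and Y :: "'i \<Rightarrow> 'b \<Rightarrow> real"
  assumes M1: "prob_space M1" and M2: "prob_space M2" and I: "finite I"
    and X: "centered_gaussian_vector M1 I X C" and Y: "centered_gaussian_vector M2 I Y C'"
    and symC: "\<And>i j. i \<in> I \<Longrightarrow> j \<in> I \<Longrightarrow> C i j = C j i"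
    and symC': "\<And>i j. i \<in> I \<Longrightarrow> j \<in> I \<Longrightarrow> C' i j = C' j i"
    and pos: "\<And>i. i \<in> I \<Longrightarrow> 0 < C i i" and diag: "\<And>i. i \<in> I \<Longrightarrow> C' i i = C i i"
    and le: "\<And>i j. i \<in> I \<Longrightarrow> j \<in> I \<Longrightarrow> C' i j \<le> C i j"
  shows "(\<integral>\<omega>. ln (1 + (\<Sum>i\<in>I. exp (X i \<omega>))) \<partial>M1) \<le> (\<integral>\<omega>. ln (1 + (\<Sum>i\<in>I. exp (Y i \<omega>))) \<partial>M2)"
proof -
  interpret M1: prob_space M1 by fact
  interpret M2: prob_space M2 by fact
  interpret P: pair_prob_space M1 M2 ..
  let ?N = "M1 \<Otimes>\<^sub>M M2"
  have Xm[measurable]: "X i \<in> borel_measurable M1" and Ym[measurable]: "Y i \<in> borel_measurable M2" if "i \<in> I" for i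
    using X Y that by (auto simp: centered_gaussian_vector_def)
  \<comment> \<open>The product space makes the two vectors independent, so their exponents
    add.\<close>
  have char: "P.expectation (\<lambda>w. iexp ((\<Sum>i\<in>I. a i * X i (fst w)) + (\<Sum>i\<in>I. b i * Y i (snd w)))) =
    complex_of_real (exp (- ((\<Sum>i\<in>I. \<Sum>j\<in>I. a i * a j * C i j) + (\<Sum>i\<in>I. \<Sum>j\<in>I. b i * b j * C' i j)) / 2))" for a b
  proof -
    have "P.expectation (\<lambda>w. iexp ((\<Sum>i\<in>I. a i * X i (fst w)) + (\<Sum>i\<in>I. b i * Y i (snd w)))) =
      (\<integral>x. (\<integral>y. iexp ((\<Sum>i\<in>I. a i * X i (fst (x, y))) + (\<Sum>i\<in>I. b i * Y i (snd (x, y)))) \<partial>M2) \<partial>M1)"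
      by (rule P.integral_fst'[symmetric], rule P.integrable_const_bound[where B=1]) auto
    also have "\<dots> = (\<integral>x. (\<integral>y. iexp (\<Sum>i\<in>I. a i * X i x) * iexp (\<Sum>i\<in>I. b i * Y i y) \<partial>M2) \<partial>M1)"
      by (simp add: exp_add distrib_left)
    also have "\<dots> = (\<integral>x. iexp (\<Sum>i\<in>I. a i * X i x) \<partial>M1) * (\<integral>y. iexp (\<Sum>i\<in>I. b i * Y i y) \<partial>M2)"
      by (simp del: of_real_sum of_real_mult)
    also have "\<dots> = complex_of_real (exp (- (\<Sum>i\<in>I. \<Sum>j\<in>I. a i * a j * C i j) / 2) * exp (- (\<Sum>i\<in>I. \<Sum>j\<in>I. b i * b j * C' i j) / 2))"
      using X Y unfolding centered_gaussian_vector_def by (simp only: of_real_mult)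
    also have "exp (- (\<Sum>i\<in>I. \<Sum>j\<in>I. a i * a j * C i j) / 2) * exp (- (\<Sum>i\<in>I. \<Sum>j\<in>I. b i * b j * C' i j) / 2) =
      exp (- ((\<Sum>i\<in>I. \<Sum>j\<in>I. a i * a j * C i j) + (\<Sum>i\<in>I. \<Sum>j\<in>I. b i * b j * C' i j)) / 2)"
      by (simp add: exp_add[symmetric] add_divide_distrib)
    finally show ?thesis .
  qed
  have Xc: "centered_gaussian_vector ?N I (\<lambda>i w. X i (fst w)) C"
    unfolding centered_gaussian_vector_def using char[of _ "\<lambda>_. 0"] by simp
  have Yc: "centered_gaussian_vector ?N I (\<lambda>i w. Y i (snd w)) C'"
    unfolding centered_gaussian_vector_def using char[of "\<lambda>_. 0"] by simp
  have intX: "integrable ?N (\<lambda>w. X i (fst w))" and intY: "integrable ?N (\<lambda>w. Y i (snd w))" if "i \<in> I" for i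
    using centered_gaussian_vector_char_component[OF Xc I that] centered_gaussian_vector_char_component[OF Yc I that] pos[OF that] diag[OF that] that
    by (auto intro!: P.integrable_if_char_normal[of _ "C i i"])
  define Z where "Z \<theta> i w = cos \<theta> * X i (fst w) + sin \<theta> * Y i (snd w)" for \<theta> i w
  \<comment> \<open>\<open>U\<close> is the derivative of \<open>Z\<close> with respect to
    \<open>\<theta>\<close>. At angle 0 the vector \<open>Z\<close> is X, at pi / 2 it is Y.\<close>
  define U where "U \<theta> i w = - sin \<theta> * X i (fst w) + cos \<theta> * Y i (snd w)" for \<theta> i w
  have Zm[measurable]: "Z \<theta> i \<in> borel_measurable ?N" and Um[measurable]: "U \<theta> i \<in> borel_measurable ?N" if "i \<in> I" for \<theta> i
    unfolding Z_def[abs_def] U_def[abs_def] using that by measurable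
  have intZ: "integrable ?N (Z \<theta> i)" and intU: "integrable ?N (U \<theta> i)" if "i \<in> I" for \<theta> i
    unfolding Z_def[abs_def] U_def[abs_def] using intX intY that by auto
  let ?F = "\<lambda>\<theta> w. ln (1 + (\<Sum>i\<in>I. exp (Z \<theta> i w)))"
  let ?p = "\<lambda>\<theta> i w. softmax_weight I i (\<lambda>j. Z \<theta> j w)"
  have pm[measurable]: "?p \<theta> i \<in> borel_measurable ?N" if "i \<in> I" for \<theta> i
    by (intro borel_measurable_softmax_weight I that) auto
  have p01: "0 \<le> ?p \<theta> i w" "?p \<theta> i w \<le> 1" if "i \<in> I" for \<theta> i w
    using softmax_weight_nonneg softmax_weight_le_1[OF I that] by auto
  have intF: "integrable ?N (?F \<theta>)" for \<theta>
    using intZ by (intro integrable_ln_one_plus_sum_exp I) (auto intro: P.finite_measure_axioms)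
  have deriv: "((\<lambda>\<theta>. P.expectation (?F \<theta>)) has_real_derivative P.expectation (\<lambda>w. \<Sum>i\<in>I. U \<theta> i w * ?p \<theta> i w)) (at \<theta>)" for \<theta>
  proof (rule has_real_derivative_integral[where g="\<lambda>w. \<Sum>i\<in>I. \<bar>X i (fst w)\<bar> + \<bar>Y i (snd w)\<bar>"])
    show "integrable ?N (?F \<theta>)" for \<theta> by (rule intF)
    show "integrable ?N (\<lambda>w. \<Sum>i\<in>I. \<bar>X i (fst w)\<bar> + \<bar>Y i (snd w)\<bar>)" using intX intY by auto
    show "((\<lambda>\<theta>. ?F \<theta> w) has_real_derivative (\<Sum>i\<in>I. U \<theta> i w * ?p \<theta> i w)) (at \<theta>)" for \<theta> w
      unfolding softmax_weight_def Z_def U_def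
      using one_plus_sum_exp_pos[of "\<lambda>i. cos \<theta> * X i (fst w) + sin \<theta> * Y i (snd w)" I]
      by (auto intro!: derivative_eq_intros simp: sum_divide_distrib mult_ac)
    show "\<bar>\<Sum>i\<in>I. U \<theta> i w * ?p \<theta> i w\<bar> \<le> (\<Sum>i\<in>I. \<bar>X i (fst w)\<bar> + \<bar>Y i (snd w)\<bar>)" for \<theta> w
    proof (rule order_trans[OF sum_abs sum_mono])
      fix i assume i: "i \<in> I"
      have "\<bar>U \<theta> i w\<bar> \<le> \<bar>- sin \<theta> * X i (fst w)\<bar> + \<bar>cos \<theta> * Y i (snd w)\<bar>" unfolding U_def by (rule abs_triangle_ineq)
      also have "\<dots> \<le> 1 * \<bar>X i (fst w)\<bar> + 1 * \<bar>Y i (snd w)\<bar>"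
        unfolding abs_mult by (intro add_mono mult_right_mono) auto
      finally have "\<bar>U \<theta> i w\<bar> * ?p \<theta> i w \<le> (\<bar>X i (fst w)\<bar> + \<bar>Y i (snd w)\<bar>) * 1"
        using p01[OF i] by (intro mult_mono) auto
      then show "\<bar>U \<theta> i w * ?p \<theta> i w\<bar> \<le> \<bar>X i (fst w)\<bar> + \<bar>Y i (snd w)\<bar>"
        using p01[OF i] by (simp add: abs_mult)
    qed
  qed measurable
  have term_nonneg: "0 \<le> P.expectation (\<lambda>w. U \<theta> i w * ?p \<theta> i w)" if i: "i \<in> I" and \<theta>: "0 \<le> \<theta>" "\<theta> \<le> pi / 2" for i \<theta>
  proof -
    \<comment> \<open>\<open>\<kappa> j\<close> is the covariance of \<open>U \<theta> i\<close>
      with \<open>Z \<theta> j\<close>. The variance of \<open>U \<theta> i\<close> is sin^2 * C i i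
      + cos^2 * C' i i, which equals \<open>C i i\<close> as the diagonals agree; this is the value
      of V below.\<close>
    define \<kappa> where "\<kappa> j = sin \<theta> * cos \<theta> * (C' i j - C i j)" for j
    define Q where "Q c = (cos \<theta>)\<^sup>2 * (\<Sum>j\<in>I. \<Sum>k\<in>I. c j * c k * C j k) + (sin \<theta>)\<^sup>2 * (\<Sum>j\<in>I. \<Sum>k\<in>I. c j * c k * C' j k)" for c
    have "P.expectation (\<lambda>w. U \<theta> i w * ?p \<theta> i w) = P.expectation (\<lambda>w. ?p \<theta> i w * (\<kappa> i - (\<Sum>j\<in>I. \<kappa> j * ?p \<theta> j w)))"
    proof (rule P.expectation_mult_softmax_weight[where V="C i i" and Q=Q])
      fix s c
      \<comment> \<open>Coefficients of the X j and the Y j in the combination; \<open>U\<close>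
        contributes only at index \<open>i\<close>.\<close>
      let ?a = "\<lambda>j. cos \<theta> * c j + (if j = i then - sin \<theta> * s else 0)"
      let ?b = "\<lambda>j. sin \<theta> * c j + (if j = i then cos \<theta> * s else 0)"
      have lin: "s * U \<theta> i w + (\<Sum>j\<in>I. c j * Z \<theta> j w) = (\<Sum>j\<in>I. ?a j * X j (fst w)) + (\<Sum>j\<in>I. ?b j * Y j (snd w))" for w
      proof -
        have "(\<Sum>j\<in>I. ?a j * X j (fst w)) = (\<Sum>j\<in>I. cos \<theta> * c j * X j (fst w)) - sin \<theta> * s * X i (fst w)"
          "(\<Sum>j\<in>I. ?b j * Y j (snd w)) = (\<Sum>j\<in>I. sin \<theta> * c j * Y j (snd w)) + cos \<theta> * s * Y i (snd w)"
          using I i by (simp_all add: distrib_right sum.distrib if_distrib[of "\<lambda>x. x * _"] cong: if_cong)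
        then show ?thesis unfolding U_def Z_def by (simp add: algebra_simps sum.distrib)
      qed
      have "(\<Sum>j\<in>I. \<Sum>k\<in>I. ?a j * ?a k * C j k) + (\<Sum>j\<in>I. \<Sum>k\<in>I. ?b j * ?b k * C' j k) =
         ((cos \<theta>)\<^sup>2 * (\<Sum>j\<in>I. \<Sum>k\<in>I. c j * c k * C j k) - 2 * sin \<theta> * s * cos \<theta> * (\<Sum>j\<in>I. c j * C i j) + (sin \<theta>)\<^sup>2 * s\<^sup>2 * C i i) +
         ((sin \<theta>)\<^sup>2 * (\<Sum>j\<in>I. \<Sum>k\<in>I. c j * c k * C' j k) + 2 * cos \<theta> * s * sin \<theta> * (\<Sum>j\<in>I. c j * C' i j) + (cos \<theta>)\<^sup>2 * s\<^sup>2 * C i i)"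
      proof -
        have "(\<Sum>j\<in>I. \<Sum>k\<in>I. r * c j * (r * c k) * D j k) = r\<^sup>2 * (\<Sum>j\<in>I. \<Sum>k\<in>I. c j * c k * D j k)"
          "(\<Sum>j\<in>I. r * c j * D i j) = r * (\<Sum>j\<in>I. c j * D i j)" for r and D :: "'i \<Rightarrow> 'i \<Rightarrow> real"
          by (simp_all add: sum_distrib_left power2_eq_square mult_ac)
        with double_sum_add_single[OF I i symC, where x="\<lambda>j. cos \<theta> * c j" and t="- sin \<theta> * s"]
          double_sum_add_single[OF I i symC', where x="\<lambda>j. sin \<theta> * c j" and t="cos \<theta> * s"] diag[OF i]
        show ?thesis by (simp add: power_mult_distrib)
      qed
      also have "\<dots> = ((sin \<theta>)\<^sup>2 + (cos \<theta>)\<^sup>2) * (s\<^sup>2 * C i i) + 2 * s * (sin \<theta> * cos \<theta> * ((\<Sum>j\<in>I. c j * C' i j) - (\<Sum>j\<in>I. c j * C i j))) + Q c"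
      proof -
        have "C i i * (s\<^sup>2 * (cos \<theta>)\<^sup>2) + C i i * (s\<^sup>2 * (sin \<theta>)\<^sup>2) = C i i * s\<^sup>2"
          by (simp add: mult.assoc[symmetric] distrib_left[symmetric])
        then show ?thesis unfolding Q_def by (simp add: algebra_simps)
      qed
      also have "sin \<theta> * cos \<theta> * ((\<Sum>j\<in>I. c j * C' i j) - (\<Sum>j\<in>I. c j * C i j)) = (\<Sum>j\<in>I. c j * \<kappa> j)"
        unfolding \<kappa>_def by (simp add: sum_distrib_left sum_subtractf right_diff_distrib mult_ac)
      finally have quad: "(\<Sum>j\<in>I. \<Sum>k\<in>I. ?a j * ?a k * C j k) + (\<Sum>j\<in>I. \<Sum>k\<in>I. ?b j * ?b k * C' j k) =
         s\<^sup>2 * C i i + 2 * s * (\<Sum>j\<in>I. c j * \<kappa> j) + Q c" by simp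
      show "P.expectation (\<lambda>w. iexp (s * U \<theta> i w + (\<Sum>j\<in>I. c j * Z \<theta> j w))) =
        complex_of_real (exp (- (s\<^sup>2 * C i i + 2 * s * (\<Sum>j\<in>I. c j * \<kappa> j) + Q c) / 2))"
        unfolding lin char quad ..
    qed (use I i pos in auto)
    moreover have "0 \<le> ?p \<theta> i w * (\<kappa> i - (\<Sum>j\<in>I. \<kappa> j * ?p \<theta> j w))" for w
    proof -
      \<comment> \<open>In the first quadrant the covariances \<open>\<kappa> j\<close> have the
        sign of C' - C, hence are nonpositive, and \<open>\<kappa> i\<close> is 0; subtracting the
        weighted sum can only increase the value.\<close>
      have "0 \<le> sin \<theta> * cos \<theta>" using \<theta> by (intro mult_nonneg_nonneg sin_ge_zero cos_ge_zero) auto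
      then have "\<kappa> j \<le> 0" if "j \<in> I" for j
        unfolding \<kappa>_def using le[OF i that] by (intro mult_nonneg_nonpos) auto
      then have "(\<Sum>j\<in>I. \<kappa> j * ?p \<theta> j w) \<le> 0"
        using p01 by (intro sum_nonpos mult_nonpos_nonneg) auto
      moreover have "\<kappa> i = 0" unfolding \<kappa>_def using diag[OF i] by simp
      ultimately show ?thesis using p01[OF i] by (intro mult_nonneg_nonneg) auto
    qed
    ultimately show ?thesis by (simp add: Bochner_Integration.integral_nonneg)
  qed
  have mono: "P.expectation (?F 0) \<le> P.expectation (?F (pi / 2))"
  proof (rule DERIV_nonneg_imp_nondecreasing[where f="\<lambda>\<theta>. P.expectation (?F \<theta>)"])
    fix \<theta> assume \<theta>: "0 \<le> \<theta>" "\<theta> \<le> pi / 2"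
    have "integrable ?N (\<lambda>w. U \<theta> i w * ?p \<theta> i w)" if i: "i \<in> I" for i
      by (rule Bochner_Integration.integrable_bound[OF intU[OF i, of \<theta>]])
        (use i p01[OF i] in \<open>auto simp: abs_mult intro!: mult_left_le\<close>)
    then have "P.expectation (\<lambda>w. \<Sum>i\<in>I. U \<theta> i w * ?p \<theta> i w) = (\<Sum>i\<in>I. P.expectation (\<lambda>w. U \<theta> i w * ?p \<theta> i w))"
      by (rule Bochner_Integration.integral_sum)
    also have "\<dots> \<ge> 0" using term_nonneg \<theta> by (intro sum_nonneg) auto
    finally show "\<exists>y. ((\<lambda>\<theta>. P.expectation (?F \<theta>)) has_real_derivative y) (at \<theta>) \<and> 0 \<le> y"
      using deriv by blast
  qed simp
  have "P.expectation (?F 0) = (\<integral>x. (\<integral>y. ?F 0 (x, y) \<partial>M2) \<partial>M1)"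
    by (rule P.integral_fst'[symmetric, OF intF])
  also have "\<dots> = (\<integral>\<omega>. ln (1 + (\<Sum>i\<in>I. exp (X i \<omega>))) \<partial>M1)" by (simp add: Z_def M2.prob_space)
  finally have F0: "P.expectation (?F 0) = (\<integral>\<omega>. ln (1 + (\<Sum>i\<in>I. exp (X i \<omega>))) \<partial>M1)" .
  have "P.expectation (?F (pi / 2)) = (\<integral>y. (\<integral>x. ?F (pi / 2) (x, y) \<partial>M1) \<partial>M2)"
    using P.integral_snd[of "\<lambda>x y. ?F (pi / 2) (x, y)"] intF by (simp add: case_prod_beta')
  also have "\<dots> = (\<integral>\<omega>. ln (1 + (\<Sum>i\<in>I. exp (Y i \<omega>))) \<partial>M2)" by (simp add: Z_def M1.prob_space)
  finally show ?thesis using mono unfolding F0 by simp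
qed

section \<open>From the soft maximum to the maximum\<close>

lemma max_0_Max_le_ln_one_plus_sum_exp:
  assumes "finite I" "I \<noteq> {}"
  shows "max 0 (MAX i\<in>I. x i) \<le> ln (1 + (\<Sum>i\<in>I. exp (x i :: real)))"
proof -
  have "(MAX i\<in>I. x i) \<in> x ` I" using assms by (intro Max_in) auto
  then obtain i where i: "i \<in> I" "(MAX i\<in>I. x i) = x i" by auto
  have "exp (x i) \<le> 1 + (\<Sum>i\<in>I. exp (x i))"
    using member_le_sum[of i I "\<lambda>i. exp (x i)"] i assms by simp
  then have "x i \<le> ln (1 + (\<Sum>i\<in>I. exp (x i)))"
    using one_plus_sum_exp_pos[of x I] by (simp add: ln_ge_iff)
  then show ?thesis using i ln_one_plus_sum_exp_nonneg[where I=I and x=x] by simp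
qed

text \<open>The error ln (1 + card I) does not depend on the size of \<open>x\<close>, so scaling
  makes it negligible.\<close>

lemma ln_one_plus_sum_exp_le_max:
  assumes "finite I" "I \<noteq> {}"
  shows "ln (1 + (\<Sum>i\<in>I. exp (x i :: real))) \<le> ln (1 + card I) + max 0 (MAX i\<in>I. x i)"
proof -
  let ?m = "max 0 (MAX i\<in>I. x i)"
  have "(\<Sum>i\<in>I. exp (x i)) \<le> (\<Sum>i\<in>I. exp ?m)"
    using assms by (intro sum_mono) (simp add: le_max_iff_disj)
  moreover have "1 \<le> exp ?m" by simp
  ultimately have "1 + (\<Sum>i\<in>I. exp (x i)) \<le> (1 + card I) * exp ?m" by (simp add: distrib_right del: one_le_exp_iff)
  then have "ln (1 + (\<Sum>i\<in>I. exp (x i))) \<le> ln ((1 + card I) * exp ?m)"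
    using one_plus_sum_exp_pos[of x I] by (subst ln_le_cancel_iff) auto
  then show ?thesis by (simp add: ln_mult)
qed

lemma centered_gaussian_vector_scale:
  assumes "centered_gaussian_vector M I X C"
  shows "centered_gaussian_vector M I (\<lambda>i \<omega>. b * X i \<omega>) (\<lambda>i j. b\<^sup>2 * C i j)"
proof -
  have "(\<integral>\<omega>. iexp (\<Sum>i\<in>I. c i * (b * X i \<omega>)) \<partial>M) =
      complex_of_real (exp (- (\<Sum>i\<in>I. \<Sum>j\<in>I. c i * c j * (b\<^sup>2 * C i j)) / 2))" for c
  proof -
    have "(\<integral>\<omega>. iexp (\<Sum>i\<in>I. (c i * b) * X i \<omega>) \<partial>M) =
      complex_of_real (exp (- (\<Sum>i\<in>I. \<Sum>j\<in>I. (c i * b) * (c j * b) * C i j) / 2))"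
      using assms unfolding centered_gaussian_vector_def by (elim conjE) (erule allE)
    then show ?thesis by (simp add: power2_eq_square mult_ac)
  qed
  then show ?thesis using assms unfolding centered_gaussian_vector_def by auto
qed

lemma (in prob_space) centered_gaussian_vector_integrable:
  assumes "centered_gaussian_vector M I X C" "finite I" "i \<in> I" "0 < C i i"
  shows "integrable M (X i)"
  using centered_gaussian_vector_char_component[OF assms(1-3)] assms
  by (intro integrable_if_char_normal[of _ "C i i"]) (auto simp: centered_gaussian_vector_def)

lemma integrable_max_0_Max:
  fixes X :: "'i \<Rightarrow> 'a \<Rightarrow> real"
  assumes I: "finite I" "I \<noteq> {}" and X: "\<And>i. i \<in> I \<Longrightarrow> integrable M (X i)"
  shows "integrable M (\<lambda>\<omega>. max 0 (MAX i\<in>I. X i \<omega>))"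
proof (rule Bochner_Integration.integrable_bound)
  have [measurable]: "\<And>i. i \<in> I \<Longrightarrow> X i \<in> borel_measurable M" using X by auto
  show "(\<lambda>\<omega>. max 0 (MAX i\<in>I. X i \<omega>)) \<in> borel_measurable M" using I by measurable
  show "integrable M (\<lambda>\<omega>. \<Sum>i\<in>I. \<bar>X i \<omega>\<bar>)" using X by auto
  show "AE \<omega> in M. norm (max 0 (MAX i\<in>I. X i \<omega>)) \<le> norm (\<Sum>i\<in>I. \<bar>X i \<omega>\<bar>)"
  proof (rule AE_I2)
    fix \<omega>
    have "X i \<omega> \<le> (\<Sum>i\<in>I. \<bar>X i \<omega>\<bar>)" if "i \<in> I" for i
      using member_le_sum[of i I "\<lambda>i. \<bar>X i \<omega>\<bar>"] I that by (simp add: abs_le_iff)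
    then have "(MAX i\<in>I. X i \<omega>) \<le> (\<Sum>i\<in>I. \<bar>X i \<omega>\<bar>)" using I by simp
    then show "norm (max 0 (MAX i\<in>I. X i \<omega>)) \<le> norm (\<Sum>i\<in>I. \<bar>X i \<omega>\<bar>)"
      by (simp add: sum_nonneg)
  qed
qed

text \<open>The soft comparison is applied to \<open>b * X\<close> and \<open>b * Y\<close>. The
  true maximum is homogeneous and lies within ln (1 + card I) of the soft one, so after division by
  \<open>b\<close> the error is at most ln (1 + card I) / b.\<close>

lemma expectation_max_mono_covariance:
  fixes X :: "'i \<Rightarrow> 'a \<Rightarrow> real" and Y :: "'i \<Rightarrow> 'b \<Rightarrow> real"
  assumes M1: "prob_space M1" and M2: "prob_space M2" and I: "finite I" "I \<noteq> {}"
    and X: "centered_gaussian_vector M1 I X C" and Y: "centered_gaussian_vector M2 I Y C'"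
    and symC: "\<And>i j. i \<in> I \<Longrightarrow> j \<in> I \<Longrightarrow> C i j = C j i"
    and symC': "\<And>i j. i \<in> I \<Longrightarrow> j \<in> I \<Longrightarrow> C' i j = C' j i"
    and pos: "\<And>i. i \<in> I \<Longrightarrow> 0 < C i i" and diag: "\<And>i. i \<in> I \<Longrightarrow> C' i i = C i i"
    and le: "\<And>i j. i \<in> I \<Longrightarrow> j \<in> I \<Longrightarrow> C' i j \<le> C i j"
  shows "(\<integral>\<omega>. max 0 (MAX i\<in>I. X i \<omega>) \<partial>M1) \<le> (\<integral>\<omega>. max 0 (MAX i\<in>I. Y i \<omega>) \<partial>M2)"
proof (rule field_le_epsilon)
  interpret M1: prob_space M1 by fact
  interpret M2: prob_space M2 by fact
  have iX: "integrable M1 (X i)" and iY: "integrable M2 (Y i)" if "i \<in> I" for i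
    using M1.centered_gaussian_vector_integrable[OF X I(1) that] M2.centered_gaussian_vector_integrable[OF Y I(1) that] pos[OF that] diag[OF that] by auto
  fix e :: real assume e: "0 < e"
  \<comment> \<open>Makes \<open>b * e\<close> equal to ln (1 + card I) + 1, which exceeds the error
    of the soft maximum.\<close>
  define b where "b = (ln (1 + card I) + 1) / e"
  have b: "0 < b" unfolding b_def using e by (simp add: add_nonneg_pos)
  have scale: "max 0 (MAX i\<in>I. b * x i) = b * max 0 (MAX i\<in>I. x i)" for x :: "'i \<Rightarrow> real"
  proof -
    have "(MAX i\<in>I. b * x i) = b * (MAX i\<in>I. x i)"
      using mono_Max_commute[of "\<lambda>y. b * y" "x ` I"] I b by (simp add: mono_def image_image)
    then show ?thesis using b by (simp add: max_def mult_le_0_iff zero_le_mult_iff)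
  qed
  have "b * (\<integral>\<omega>. max 0 (MAX i\<in>I. X i \<omega>) \<partial>M1) = (\<integral>\<omega>. max 0 (MAX i\<in>I. b * X i \<omega>) \<partial>M1)"
    unfolding scale by simp
  also have "\<dots> \<le> (\<integral>\<omega>. ln (1 + (\<Sum>i\<in>I. exp (b * X i \<omega>))) \<partial>M1)"
    using iX I by (intro integral_mono integrable_max_0_Max integrable_ln_one_plus_sum_exp max_0_Max_le_ln_one_plus_sum_exp)
      (auto intro: M1.finite_measure_axioms)
  also have "\<dots> \<le> (\<integral>\<omega>. ln (1 + (\<Sum>i\<in>I. exp (b * Y i \<omega>))) \<partial>M2)"
    using symC symC' pos diag le b
    by (intro expectation_softmax_mono_covariance[OF M1 M2 I(1) centered_gaussian_vector_scale[OF X, of b] centered_gaussian_vector_scale[OF Y, of b]]) auto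
  also have "\<dots> \<le> (\<integral>\<omega>. ln (1 + card I) + max 0 (MAX i\<in>I. b * Y i \<omega>) \<partial>M2)"
    using iY I by (intro integral_mono integrable_ln_one_plus_sum_exp ln_one_plus_sum_exp_le_max Bochner_Integration.integrable_add integrable_max_0_Max)
      (auto intro: M2.finite_measure_axioms)
  also have "\<dots> = ln (1 + card I) + b * (\<integral>\<omega>. max 0 (MAX i\<in>I. Y i \<omega>) \<partial>M2)"
    unfolding scale using iY I by (subst Bochner_Integration.integral_add) (auto intro!: integrable_max_0_Max simp: M2.prob_space)
  also have "\<dots> \<le> b * e + b * (\<integral>\<omega>. max 0 (MAX i\<in>I. Y i \<omega>) \<partial>M2)"
    unfolding b_def using e by simp
  finally have "b * (\<integral>\<omega>. max 0 (MAX i\<in>I. X i \<omega>) \<partial>M1) \<le> b * ((\<integral>\<omega>. max 0 (MAX i\<in>I. Y i \<omega>) \<partial>M2) + e)"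
    by (simp add: algebra_simps)
  then show "(\<integral>\<omega>. max 0 (MAX i\<in>I. X i \<omega>) \<partial>M1) \<le> (\<integral>\<omega>. max 0 (MAX i\<in>I. Y i \<omega>) \<partial>M2) + e"
    using b by (simp add: mult_le_cancel_left_pos)
qed

section \<open>Gaussian random walks\<close>

abbreviation std_normal_product :: "'i set \<Rightarrow> ('i \<Rightarrow> real) measure" where
  "std_normal_product J \<equiv> (\<Pi>\<^sub>M j\<in>J. std_normal_distribution)"

lemma prob_space_std_normal: "prob_space std_normal_distribution"
  using real_dist_normal_dist by (simp add: real_distribution_def)

lemma prob_space_std_normal_product: "prob_space (std_normal_product J)"
  by (intro prob_space_PiM prob_space_std_normal)

lemma char_std_normal_product:
  assumes J: "finite J"
  shows "(\<integral>g. iexp (\<Sum>j\<in>J. a j * g j) \<partial>std_normal_product J) = complex_of_real (exp (- (\<Sum>j\<in>J. (a j)\<^sup>2) / 2))"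
proof -
  interpret product_sigma_finite "\<lambda>_. std_normal_distribution"
    by (intro product_sigma_finite.intro prob_space_imp_sigma_finite prob_space_std_normal)
  interpret N: prob_space std_normal_distribution by (rule prob_space_std_normal)
  have "(\<integral>g. iexp (\<Sum>j\<in>J. a j * g j) \<partial>std_normal_product J) = (\<integral>g. (\<Prod>j\<in>J. iexp (a j * g j)) \<partial>std_normal_product J)"
    using J by (simp add: sum_distrib_left exp_sum)
  also have "\<dots> = (\<Prod>j\<in>J. char std_normal_distribution (a j))"
    unfolding char_def by (rule product_integral_prod[OF J]) (auto intro!: N.integrable_const_bound[where B=1])
  also have "\<dots> = complex_of_real (exp (- (\<Sum>j\<in>J. (a j)\<^sup>2) / 2))"
    unfolding char_std_normal_distribution using J
    by (simp add: exp_sum[symmetric] sum_negf sum_divide_distrib flip: of_real_prod)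
  finally show ?thesis .
qed

lemma distributed_sum_std_normal_product:
  fixes a :: "'i \<Rightarrow> real"
  assumes J: "finite J" "J \<noteq> {}" and a: "\<And>j. j \<in> J \<Longrightarrow> 0 < a j"
  shows "distributed (std_normal_product J) lborel (\<lambda>g. \<Sum>j\<in>J. a j * g j) (normal_density 0 (sqrt (\<Sum>j\<in>J. (a j)\<^sup>2)))"
proof -
  interpret prob_space "std_normal_product J" by (rule prob_space_std_normal_product)
  show ?thesis
  proof (rule distributed_normal_if_char)
    show "0 < (\<Sum>j\<in>J. (a j)\<^sup>2)" by (intro sum_pos zero_less_power a J)
    show "expectation (\<lambda>g. iexp (s * (\<Sum>j\<in>J. a j * g j))) = complex_of_real (exp (- (s\<^sup>2 * (\<Sum>j\<in>J. (a j)\<^sup>2)) / 2))" for s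
      using char_std_normal_product[OF J(1), of "\<lambda>j. s * a j"]
      by (simp add: sum_distrib_left power_mult_distrib mult_ac)
    show "(\<lambda>g. \<Sum>j\<in>J. a j * g j) \<in> borel_measurable (std_normal_product J)"
      by measurable
  qed
qed

text \<open>W and -W have the same law, and 2 |W| <= |z + W| + |z - W|.\<close>

lemma (in prob_space) expectation_abs_add_normal_ge:
  assumes W: "distributed M lborel W (normal_density 0 \<sigma>)" and \<sigma>: "0 < \<sigma>"
  shows "expectation (\<lambda>\<omega>. \<bar>W \<omega>\<bar>) \<le> expectation (\<lambda>\<omega>. \<bar>z + W \<omega>\<bar>)"
proof -
  have int: "integrable M W"
    using distributed_integrable[OF W, of "\<lambda>x. x"] integrable_normal_moment[OF \<sigma>, of 0 1] by simp
  have W': "distributed M lborel (\<lambda>x. - W x) (normal_density 0 \<sigma>)"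
    using normal_density_affine[OF W \<sigma>, of "-1" 0] by simp
  have "expectation (\<lambda>\<omega>. \<bar>z - W \<omega>\<bar>) = (\<integral>x. normal_density 0 \<sigma> x * \<bar>z + x\<bar> \<partial>lborel)"
    using distributed_integral[OF W', of "\<lambda>x. \<bar>z + x\<bar>"] by simp
  also have "\<dots> = expectation (\<lambda>\<omega>. \<bar>z + W \<omega>\<bar>)"
    using distributed_integral[OF W, of "\<lambda>x. \<bar>z + x\<bar>"] by simp
  finally have eq: "expectation (\<lambda>\<omega>. \<bar>z - W \<omega>\<bar>) = expectation (\<lambda>\<omega>. \<bar>z + W \<omega>\<bar>)" .
  have "2 * expectation (\<lambda>\<omega>. \<bar>W \<omega>\<bar>) = expectation (\<lambda>\<omega>. 2 * \<bar>W \<omega>\<bar>)" by simp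
  also have "\<dots> \<le> expectation (\<lambda>\<omega>. \<bar>z + W \<omega>\<bar> + \<bar>z - W \<omega>\<bar>)"
    using int by (intro integral_mono) auto
  also have "\<dots> = expectation (\<lambda>\<omega>. \<bar>z + W \<omega>\<bar>) + expectation (\<lambda>\<omega>. \<bar>z - W \<omega>\<bar>)"
    using int by (intro Bochner_Integration.integral_add) auto
  finally show ?thesis using eq by simp
qed

text \<open>As 2 max(0, x) = x + |x| and E W = 0, both sides become z plus a mean absolute value. It
  serves to compare a walk started at \<open>z\<close> with the one started at 0.\<close>

lemma (in prob_space) add_pos_part_normal_le:
  assumes W: "distributed M lborel W (normal_density 0 \<sigma>)" and \<sigma>: "0 < \<sigma>" and z: "0 \<le> z"
  shows "ennreal z + (\<integral>\<^sup>+\<omega>. ennreal (2 * max 0 (W \<omega>)) \<partial>M) \<le> (\<integral>\<^sup>+\<omega>. ennreal (2 * max 0 (z + W \<omega>)) \<partial>M)"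
proof -
  have int: "integrable M W"
    using distributed_integrable[OF W, of "\<lambda>x. x"] integrable_normal_moment[OF \<sigma>, of 0 1] by simp
  have mx: "2 * max 0 x = x + \<bar>x\<bar>" for x :: real by simp
  have EW: "expectation W = 0" using normal_distributed_expectation[OF \<sigma> W] .
  have "z + expectation (\<lambda>\<omega>. 2 * max 0 (W \<omega>)) \<le> expectation (\<lambda>\<omega>. 2 * max 0 (z + W \<omega>))"
    unfolding mx using int expectation_abs_add_normal_ge[OF W \<sigma>, of z] EW prob_space by simp
  then show ?thesis
    using int z by (subst (1 2) nn_integral_eq_integral) (auto simp: ennreal_plus[symmetric] simp del: ennreal_plus intro!: Bochner_Integration.integral_nonneg)
qed

text \<open>An integrated form of the reflection bound P(max >= x) <= 2 P(S n >= x). The walk starts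
  at time \<open>m\<close> from an arbitrary \<open>z\<close>, so that the induction, downward in
  \<open>m\<close>, can move the first step into the start. Nonnegative integrals allow Fubini
  without integrability obligations.\<close>

lemma nn_integral_max_random_walk_le:
  fixes s :: "nat \<Rightarrow> real"
  assumes s: "\<And>j. 0 < s j" and "m \<le> n"
  shows "(\<integral>\<^sup>+g. ennreal (max 0 (MAX k\<in>{m..n}. z + (\<Sum>j=m..<k. s j * g j))) \<partial>std_normal_product {m..<n})
    \<le> (\<integral>\<^sup>+g. ennreal (2 * max 0 (z + (\<Sum>j=m..<n. s j * g j))) \<partial>std_normal_product {m..<n})"
  using \<open>m \<le> n\<close>
proof (induction arbitrary: z rule: inc_induct)
  case base
  show ?case by (intro nn_integral_mono) simp
next
  case (step m z)
  interpret product_sigma_finite "\<lambda>_. std_normal_distribution"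
    by (intro product_sigma_finite.intro prob_space_imp_sigma_finite prob_space_std_normal)
  have le0: "(\<integral>\<^sup>+g. ennreal (max 0 (MAX k\<in>{m..n}. z + (\<Sum>j=m..<k. s j * g j))) \<partial>std_normal_product {m..<n})
    \<le> (\<integral>\<^sup>+g. ennreal (2 * max 0 (z + (\<Sum>j=m..<n. s j * g j))) \<partial>std_normal_product {m..<n})"
    if z: "z \<le> 0" for z
  proof -
    have ins: "{m..<n} = insert m {Suc m..<n}" using step by auto
    have upd: "(\<Sum>j=m..<k. s j * (g(m := y)) j) = s m * y + (\<Sum>j=Suc m..<k. s j * g j)"
      if "k \<in> {Suc m..n}" for k y and g :: "nat \<Rightarrow> real"
    proof -
      have "{m..<k} = insert m {Suc m..<k}" using that by auto
      then show ?thesis by (auto intro!: sum.cong)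
    qed
    have mx: "max 0 (MAX k\<in>{m..n}. z + (\<Sum>j=m..<k. s j * (g(m := y)) j)) =
       max 0 (MAX k\<in>{Suc m..n}. (z + s m * y) + (\<Sum>j=Suc m..<k. s j * g j))" for g :: "nat \<Rightarrow> real" and y
    proof -
      have "{m..n} = insert m {Suc m..n}" using step by auto
      then have "(MAX k\<in>{m..n}. z + (\<Sum>j=m..<k. s j * (g(m := y)) j)) = 
        max z (MAX k\<in>{Suc m..n}. z + (\<Sum>j=m..<k. s j * (g(m := y)) j))" using step by simp
      also have "(MAX k\<in>{Suc m..n}. z + (\<Sum>j=m..<k. s j * (g(m := y)) j)) = (MAX k\<in>{Suc m..n}. (z + s m * y) + (\<Sum>j=Suc m..<k. s j * g j))"
        by (intro arg_cong[where f=Max] image_cong refl) (simp only: upd add.assoc)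
      finally show ?thesis using z by simp
    qed
    have "(\<integral>\<^sup>+g. ennreal (max 0 (MAX k\<in>{m..n}. z + (\<Sum>j=m..<k. s j * g j))) \<partial>std_normal_product {m..<n}) =
      (\<integral>\<^sup>+y. (\<integral>\<^sup>+g. ennreal (max 0 (MAX k\<in>{m..n}. z + (\<Sum>j=m..<k. s j * (g(m := y)) j))) \<partial>std_normal_product {Suc m..<n}) \<partial>std_normal_distribution)"
      unfolding ins
      by (rule product_nn_integral_insert_rev) (auto simp: ins[symmetric])
    also have "\<dots> \<le> (\<integral>\<^sup>+y. (\<integral>\<^sup>+g. ennreal (2 * max 0 ((z + s m * y) + (\<Sum>j=Suc m..<n. s j * g j))) \<partial>std_normal_product {Suc m..<n}) \<partial>std_normal_distribution)"
      unfolding mx by (intro nn_integral_mono step.IH)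
    also have "\<dots> = (\<integral>\<^sup>+y. (\<integral>\<^sup>+g. ennreal (2 * max 0 (z + (\<Sum>j=m..<n. s j * (g(m := y)) j))) \<partial>std_normal_product {Suc m..<n}) \<partial>std_normal_distribution)"
      using upd[of n] step by (simp add: add.assoc)
    also have "\<dots> = (\<integral>\<^sup>+g. ennreal (2 * max 0 (z + (\<Sum>j=m..<n. s j * g j))) \<partial>std_normal_product {m..<n})"
      unfolding ins
      by (rule product_nn_integral_insert_rev[symmetric]) (auto simp: ins[symmetric])
    finally show ?thesis .
  qed
  show ?case
  proof (cases "z \<le> 0")
    case False
    interpret P: prob_space "std_normal_product {m..<n}" by (rule prob_space_std_normal_product)
    have W: "distributed (std_normal_product {m..<n}) lborel (\<lambda>g. \<Sum>j=m..<n. s j * g j) (normal_density 0 (sqrt (\<Sum>j=m..<n. (s j)\<^sup>2)))"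
      using step s by (intro distributed_sum_std_normal_product) auto
    have \<sigma>: "0 < sqrt (\<Sum>j=m..<n. (s j)\<^sup>2)"
      using step by (intro real_sqrt_gt_zero sum_pos zero_less_power s) auto
    \<comment> \<open>A positive start is taken out of the maximum. What remains is nonnegative
      because k = m contributes the empty sum, and \<open>le0\<close> applies to it with start
      0.\<close>
    have mx: "max 0 (MAX k\<in>{m..n}. z + (\<Sum>j=m..<k. s j * g j)) = z + max 0 (MAX k\<in>{m..n}. 0 + (\<Sum>j=m..<k. s j * g j))" for g :: "nat \<Rightarrow> real"
    proof -
      have ne: "{m..n} \<noteq> {}" using step by simp
      have "(MAX k\<in>{m..n}. z + (\<Sum>j=m..<k. s j * g j)) = z + (MAX k\<in>{m..n}. (\<Sum>j=m..<k. s j * g j))"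
        using Max_add_commute[of "{m..n}" "\<lambda>k. \<Sum>j=m..<k. s j * g j" z] ne by (simp add: add.commute)
      moreover have "(\<Sum>j=m..<m. s j * g j) \<le> (MAX k\<in>{m..n}. (\<Sum>j=m..<k. s j * g j))"
        using step by (intro Max_ge finite_imageI imageI) auto
      ultimately show ?thesis using False by simp
    qed
    have "(\<integral>\<^sup>+g. ennreal (max 0 (MAX k\<in>{m..n}. z + (\<Sum>j=m..<k. s j * g j))) \<partial>std_normal_product {m..<n}) =
      (\<integral>\<^sup>+g. ennreal z + ennreal (max 0 (MAX k\<in>{m..n}. 0 + (\<Sum>j=m..<k. s j * g j))) \<partial>std_normal_product {m..<n})"
      unfolding mx using False by (intro nn_integral_cong ennreal_plus) auto
    also have "\<dots> = ennreal z + (\<integral>\<^sup>+g. ennreal (max 0 (MAX k\<in>{m..n}. 0 + (\<Sum>j=m..<k. s j * g j))) \<partial>std_normal_product {m..<n})"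
      by (subst nn_integral_add) (auto simp: P.emeasure_space_1)
    also have "\<dots> \<le> ennreal z + (\<integral>\<^sup>+g. ennreal (2 * max 0 (0 + (\<Sum>j=m..<n. s j * g j))) \<partial>std_normal_product {m..<n})"
      by (intro add_left_mono le0) simp
    also have "\<dots> \<le> (\<integral>\<^sup>+g. ennreal (2 * max 0 (z + (\<Sum>j=m..<n. s j * g j))) \<partial>std_normal_product {m..<n})"
      using P.add_pos_part_normal_le[OF W \<sigma>, of z] False by simp
    finally show ?thesis .
  qed (rule le0)
qed

text \<open>The bound 2 E max(0, S n) from the preceding lemma equals E |S n| because S n has mean
  0, and a centered normal variable with deviation sigma has mean absolute value sigma * sqrt (2 /
  pi).\<close>

lemma expectation_max_random_walk_le:
  fixes s :: "nat \<Rightarrow> real"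
  assumes s: "\<And>j. 0 < s j" and n: "0 < n"
  shows "(\<integral>g. max 0 (MAX k\<in>{1..n}. \<Sum>j<k. s j * g j) \<partial>std_normal_product {..<n}) \<le> sqrt (\<Sum>j<n. (s j)\<^sup>2) * sqrt (2 / pi)"
proof -
  interpret P: prob_space "std_normal_product {..<n}" by (rule prob_space_std_normal_product)
  let ?W = "\<lambda>g. \<Sum>j<n. s j * g j" and ?\<sigma> = "sqrt (\<Sum>j<n. (s j)\<^sup>2)"
  have W: "distributed (std_normal_product {..<n}) lborel ?W (normal_density 0 ?\<sigma>)"
    using n s by (intro distributed_sum_std_normal_product) auto
  have \<sigma>: "0 < ?\<sigma>" using n by (intro real_sqrt_gt_zero sum_pos zero_less_power s) auto
  have int: "integrable (std_normal_product {..<n}) ?W"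
    using distributed_integrable[OF W, of "\<lambda>x. x"] integrable_normal_moment[OF \<sigma>, of 0 1] by simp
  \<comment> \<open>Time 0 contributes the value 0, already present in \<open>max 0\<close>; the
    indices can therefore start at 1, where the variances are positive.\<close>
  have "{0..n} = insert 0 {1..n}" using n by auto
  then have mx: "max 0 (MAX k\<in>{0..n}. 0 + (\<Sum>j=0..<k. s j * g j)) = max 0 (MAX k\<in>{1..n}. \<Sum>j<k. s j * g j)" for g :: "nat \<Rightarrow> real"
    using n by (simp add: atLeast0LessThan)
  have "(\<integral>\<^sup>+g. ennreal (max 0 (MAX k\<in>{1..n}. \<Sum>j<k. s j * g j)) \<partial>std_normal_product {..<n}) \<le>
     (\<integral>\<^sup>+g. ennreal (2 * max 0 (\<Sum>j<n. s j * g j)) \<partial>std_normal_product {..<n})"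
    using nn_integral_max_random_walk_le[of s 0 n 0, OF s] unfolding mx by (simp add: atLeast0LessThan)
  then have "(\<integral>g. max 0 (MAX k\<in>{1..n}. \<Sum>j<k. s j * g j) \<partial>std_normal_product {..<n}) \<le> P.expectation (\<lambda>g. 2 * max 0 (?W g))"
    using int by (subst (asm) (2) nn_integral_eq_integral) (auto intro!: integral_real_bounded Bochner_Integration.integral_nonneg)
  also have "\<dots> = P.expectation (\<lambda>g. ?W g + \<bar>?W g\<bar>)"
    by (intro Bochner_Integration.integral_cong) auto
  also have "\<dots> = P.expectation (\<lambda>g. \<bar>?W g\<bar>)"
    using int P.normal_distributed_expectation[OF \<sigma> W] by simp
  also have "\<dots> = ?\<sigma> * sqrt (2 / pi)"
    using distributed_integral[OF W, of "\<lambda>x. \<bar>x\<bar>"] integral_normal_moment_abs_odd[OF \<sigma>, of 0 0] by simp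
  finally show ?thesis .
qed

text \<open>After interchanging the sums, the coefficient of \<open>g j\<close> is
  \<open>s j\<close> times the sum of the c k over k > j. Summing its square over j yields the
  covariance form, since the steps shared by times k and l are those below
  \<open>min k l\<close>.\<close>

lemma centered_gaussian_vector_random_walk:
  fixes s :: "nat \<Rightarrow> real"
  shows "centered_gaussian_vector (std_normal_product {..<n}) {1..n} (\<lambda>k g. \<Sum>j<k. s j * g j) (\<lambda>k l. \<Sum>j<min k l. (s j)\<^sup>2)"
  unfolding centered_gaussian_vector_def
proof (intro conjI allI ballI)
  fix k assume "k \<in> {1..n}"
  then show "(\<lambda>g. \<Sum>j<k. s j * g j) \<in> borel_measurable (std_normal_product {..<n})"
    by (intro borel_measurable_sum borel_measurable_times measurable_const measurable_component_singleton[THEN measurable_compose, where g="\<lambda>x. x"]) auto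
next
  fix c :: "nat \<Rightarrow> real"
  define a where "a j = s j * (\<Sum>k=1..n. if j < k then c k else 0)" for j
  have lin: "(\<Sum>k=1..n. c k * (\<Sum>j<k. s j * g j)) = (\<Sum>j<n. a j * g j)" for g
  proof -
    have "(\<Sum>k=1..n. c k * (\<Sum>j<k. s j * g j)) = (\<Sum>k=1..n. \<Sum>j<n. if j < k then c k * s j * g j else 0)"
    proof (intro sum.cong refl)
      fix k assume k: "k \<in> {1..n}"
      have "(\<Sum>j<n. if j < k then c k * s j * g j else 0) = (\<Sum>j\<in>{..<n} \<inter> {j. j < k}. c k * s j * g j)"
        by (simp add: sum.inter_restrict)
      also have "{..<n} \<inter> {j. j < k} = {..<k}" using k by auto
      finally show "c k * (\<Sum>j<k. s j * g j) = (\<Sum>j<n. if j < k then c k * s j * g j else 0)"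
        by (simp add: sum_distrib_left mult.assoc)
    qed
    also have "\<dots> = (\<Sum>j<n. \<Sum>k=1..n. if j < k then c k * s j * g j else 0)" by (rule sum.swap)
    also have "\<dots> = (\<Sum>j<n. a j * g j)"
      unfolding a_def by (auto simp: sum_distrib_left sum_distrib_right intro!: sum.cong)
    finally show ?thesis .
  qed
  have quad: "(\<Sum>j<n. (a j)\<^sup>2) = (\<Sum>k=1..n. \<Sum>l=1..n. c k * c l * (\<Sum>j<min k l. (s j)\<^sup>2))"
  proof -
    have "(\<Sum>j<n. (a j)\<^sup>2) = (\<Sum>j<n. \<Sum>k=1..n. \<Sum>l=1..n. if j < min k l then c k * c l * (s j)\<^sup>2 else 0)"
    proof (intro sum.cong refl)
      fix j
      let ?c = "\<lambda>k. if j < k then c k else 0"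
      have "(a j)\<^sup>2 = (s j)\<^sup>2 * (\<Sum>k=1..n. \<Sum>l=1..n. ?c k * ?c l)"
        unfolding a_def power_mult_distrib power2_eq_square[of "sum _ _"] sum_product ..
      also have "\<dots> = (\<Sum>k=1..n. \<Sum>l=1..n. if j < min k l then c k * c l * (s j)\<^sup>2 else 0)"
        unfolding sum_distrib_left by (intro sum.cong refl) auto
      finally show "(a j)\<^sup>2 = (\<Sum>k=1..n. \<Sum>l=1..n. if j < min k l then c k * c l * (s j)\<^sup>2 else 0)" .
    qed
    also have "\<dots> = (\<Sum>k=1..n. \<Sum>j<n. \<Sum>l=1..n. if j < min k l then c k * c l * (s j)\<^sup>2 else 0)"
      by (rule sum.swap)
    also have "\<dots> = (\<Sum>k=1..n. \<Sum>l=1..n. \<Sum>j<n. if j < min k l then c k * c l * (s j)\<^sup>2 else 0)"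
      by (rule sum.cong[OF refl]) (rule sum.swap)
    also have "\<dots> = (\<Sum>k=1..n. \<Sum>l=1..n. c k * c l * (\<Sum>j<min k l. (s j)\<^sup>2))"
    proof (intro sum.cong refl)
      fix k l assume kl: "k \<in> {1..n}" "l \<in> {1..n}"
      have "(\<Sum>j<n. if j < min k l then c k * c l * (s j)\<^sup>2 else 0) = (\<Sum>j\<in>{..<n} \<inter> {j. j < min k l}. c k * c l * (s j)\<^sup>2)"
        by (simp only: sum.inter_restrict finite_lessThan mem_Collect_eq)
      also have "{..<n} \<inter> {j. j < min k l} = {..<min k l}" using kl by auto
      finally show "(\<Sum>j<n. if j < min k l then c k * c l * (s j)\<^sup>2 else 0) = c k * c l * (\<Sum>j<min k l. (s j)\<^sup>2)"
        by (simp add: sum_distrib_left)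
    qed
    finally show ?thesis .
  qed
  show "(\<integral>g. iexp (\<Sum>k=1..n. c k * (\<Sum>j<k. s j * g j)) \<partial>std_normal_product {..<n}) =
    complex_of_real (exp (- (\<Sum>k=1..n. \<Sum>l=1..n. c k * c l * (\<Sum>j<min k l. (s j)\<^sup>2)) / 2))"
    unfolding lin quad[symmetric] by (rule char_std_normal_product) simp
qed

section \<open>Path functionals on grids\<close>

text \<open>Since p - 1 >= 0, x^p = x * x^(p - 1) <= x * (x + y)^(p - 1), and likewise for y. With p
  = 2 * H this is how \<open>1 / 2 < H\<close> acts.\<close>

lemma powr_superadditive:
  fixes x y p :: real
  assumes "0 \<le> x" "0 \<le> y" "1 \<le> p"
  shows "x powr p + y powr p \<le> (x + y) powr p"
proof -
  have *: "z powr p = z * z powr (p - 1)" if "0 \<le> z" for z :: real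
    using that assms by (cases "z = 0") (simp_all add: powr_diff)
  have "x * x powr (p - 1) + y * y powr (p - 1) \<le> x * (x + y) powr (p - 1) + y * (x + y) powr (p - 1)"
    using assms by (intro add_mono mult_left_mono powr_mono2) auto
  then show ?thesis using * assms by (simp add: distrib_right)
qed

lemma tendsto_grid_floor:
  fixes a u :: real
  assumes a: "0 < a"
  shows "(\<lambda>n. a * real_of_int \<lfloor>u * Suc n / a\<rfloor> / Suc n) \<longlonglongrightarrow> u"
proof (rule real_tendsto_sandwich)
  have fl: "u * Suc n / a - 1 \<le> real_of_int \<lfloor>u * Suc n / a\<rfloor>" "real_of_int \<lfloor>u * Suc n / a\<rfloor> \<le> u * Suc n / a" for n
    by linarith+
  have "a * real_of_int \<lfloor>u * Suc n / a\<rfloor> / Suc n \<le> u" for n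
  proof -
    have "a * real_of_int \<lfloor>u * Suc n / a\<rfloor> / Suc n \<le> a * (u * Suc n / a) / Suc n"
      using fl(2)[of n] a by (intro divide_right_mono mult_left_mono) auto
    also have "\<dots> = u" using a by simp
    finally show ?thesis .
  qed
  then show "\<forall>\<^sub>F n in sequentially. a * real_of_int \<lfloor>u * Suc n / a\<rfloor> / Suc n \<le> u" by (intro always_eventually) auto
  have "u - a / Suc n \<le> a * real_of_int \<lfloor>u * Suc n / a\<rfloor> / Suc n" for n
  proof -
    have "u - a / Suc n = a * (u * Suc n / a - 1) / Suc n"
      using a by (simp add: right_diff_distrib diff_divide_distrib del: of_nat_Suc)
    also have "\<dots> \<le> a * real_of_int \<lfloor>u * Suc n / a\<rfloor> / Suc n"
      using fl(1)[of n] a by (intro divide_right_mono mult_left_mono) auto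
    finally show ?thesis .
  qed
  then show "\<forall>\<^sub>F n in sequentially. u - a / Suc n \<le> a * real_of_int \<lfloor>u * Suc n / a\<rfloor> / Suc n" by simp
  have "(\<lambda>n. u - a * inverse (real (Suc n))) \<longlonglongrightarrow> u - a * 0"
    by (intro tendsto_intros LIMSEQ_inverse_real_of_nat)
  then show "(\<lambda>n. u - a / Suc n) \<longlonglongrightarrow> u" by (simp add: divide_inverse)
qed simp

text \<open>With \<open>Suc n\<close> cells the denominator is never 0 and the end \<open>a\<close>
  has index \<open>Suc n\<close>. Grids for successive n are not nested.\<close>

definition grid :: "real \<Rightarrow> nat \<Rightarrow> nat \<Rightarrow> real" where
  "grid a n k = a * real k / real (Suc n)"

lemma grid_in: "0 \<le> a \<Longrightarrow> k \<le> Suc n \<Longrightarrow> grid a n k \<in> {0..a}"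
  unfolding grid_def by (simp add: divide_le_eq mult_left_mono)

lemma grid_0 [simp]: "grid a n 0 = 0" and grid_Suc [simp]: "grid a n (Suc n) = a"
  unfolding grid_def by auto

lemma grid_eq_0_iff: "0 < a \<Longrightarrow> grid a n k = 0 \<longleftrightarrow> k = 0"
  unfolding grid_def by simp

lemma grid_mono: "0 \<le> a \<Longrightarrow> k \<le> l \<Longrightarrow> grid a n k \<le> grid a n l"
  unfolding grid_def by (intro divide_right_mono mult_left_mono) auto

lemma grid_less: "0 < a \<Longrightarrow> k < l \<Longrightarrow> grid a n k < grid a n l"
  unfolding grid_def by (intro divide_strict_right_mono mult_strict_left_mono) auto

lemma grid_index:
  fixes a u :: real
  assumes a: "0 < a" and u: "u \<in> {0..a}"
  shows "nat \<lfloor>u * Suc n / a\<rfloor> \<le> Suc n" 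
    and "grid a n (nat \<lfloor>u * Suc n / a\<rfloor>) = a * real_of_int \<lfloor>u * Suc n / a\<rfloor> / Suc n"
proof -
  have "u * Suc n / a \<le> real (Suc n)" using a u by (simp add: divide_le_eq mult.commute mult_right_mono)
  then show "nat \<lfloor>u * Suc n / a\<rfloor> \<le> Suc n" by linarith
  have "0 \<le> \<lfloor>u * Suc n / a\<rfloor>" using a u by simp
  then show "grid a n (nat \<lfloor>u * Suc n / a\<rfloor>) = a * real_of_int \<lfloor>u * Suc n / a\<rfloor> / Suc n"
    unfolding grid_def by simp
qed

lemma tendsto_grid_index:
  assumes "0 < a" "u \<in> {0..a}" "continuous_on {0..a} (f :: real \<Rightarrow> real)"
  shows "(\<lambda>n. f (grid a n (nat \<lfloor>u * Suc n / a\<rfloor>))) \<longlonglongrightarrow> f u"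
proof -
  have "(\<lambda>n. grid a n (nat \<lfloor>u * Suc n / a\<rfloor>)) \<longlonglongrightarrow> u"
    unfolding grid_index(2)[OF assms(1,2)] by (rule tendsto_grid_floor[OF assms(1)])
  then show ?thesis
    using assms grid_index(1)[OF assms(1,2)]
    by (intro continuous_on_tendsto_compose[OF assms(3)]) (auto intro!: always_eventually grid_in simp del: atLeastAtMost_iff)
qed

lemma continuous_on_bounded_image:
  "continuous_on {0..a::real} (f :: real \<Rightarrow> real) \<Longrightarrow> bdd_above (f ` {0..a}) \<and> bdd_below (f ` {0..a})"
  using compact_imp_bounded[OF compact_continuous_image[of "{0..a}" f]]
  by (auto intro: bounded_imp_bdd_above bounded_imp_bdd_below)

text \<open>Compactness gives a maximizer; the values at the grid points just below it squeeze the
  grid maxima against the supremum.\<close>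

lemma tendsto_grid_max:
  assumes a: "0 < a" and f: "continuous_on {0..a} (f :: real \<Rightarrow> real)" and f0: "f 0 = 0"
  shows "(\<lambda>n. max 0 (MAX k\<in>{1..Suc n}. f (grid a n k))) \<longlonglongrightarrow> (SUP v\<in>{0..a}. f v)"
proof -
  obtain u where u: "u \<in> {0..a}" "\<And>v. v \<in> {0..a} \<Longrightarrow> f v \<le> f u"
    using continuous_attains_sup[of "{0..a}" f] a f by auto
  have sup: "(SUP v\<in>{0..a}. f v) = f u"
    using u by (intro cSup_eq_maximum) auto
  show ?thesis unfolding sup
  proof (rule real_tendsto_sandwich[OF _ _ tendsto_grid_index[OF a u(1) f] tendsto_const])
    have "f (grid a n (nat \<lfloor>u * Suc n / a\<rfloor>)) \<le> max 0 (MAX k\<in>{1..Suc n}. f (grid a n k))" for n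
    proof (cases "nat \<lfloor>u * Suc n / a\<rfloor>")
      case 0
      \<comment> \<open>Index 0 is not part of the maximum, but its value f 0 = 0 is covered by
        \<open>max 0\<close>.\<close>
      then show ?thesis by (simp only: grid_0 f0 max.cobounded1)
    next
      case (Suc k)
      then have "nat \<lfloor>u * Suc n / a\<rfloor> \<in> {1..Suc n}" using grid_index(1)[OF a u(1), of n] by (simp only: atLeastAtMost_iff) simp
      then have "f (grid a n (nat \<lfloor>u * Suc n / a\<rfloor>)) \<le> (MAX k\<in>{1..Suc n}. f (grid a n k))"
        by (intro Max_ge finite_imageI imageI) auto
      then show ?thesis by simp
    qed
    then show "\<forall>\<^sub>F n in sequentially. f (grid a n (nat \<lfloor>u * Suc n / a\<rfloor>)) \<le> max 0 (MAX k\<in>{1..Suc n}. f (grid a n k))"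
      by (intro always_eventually) auto
    have "f (grid a n k) \<le> f u" if "k \<in> {1..Suc n}" for n k
      using that a by (intro u(2) grid_in) auto
    then have "(MAX k\<in>{1..Suc n}. f (grid a n k)) \<le> f u" for n
      by (subst Max_le_iff) auto
    then show "\<forall>\<^sub>F n in sequentially. max 0 (MAX k\<in>{1..Suc n}. f (grid a n k)) \<le> f u"
      using u(2)[of 0] f0 a by (intro always_eventually) auto
  qed
qed

text \<open>A real supremum has this property over nonempty bounded sets; continuity gives the bound
  and \<open>0 \<le> a\<close> the pair (0, 0).\<close>

lemma max_loss_le_iff:
  assumes a: "0 \<le> a" and X: "continuous_on {0..a} (\<lambda>t. X t \<omega>)"
  shows "max_loss X a \<omega> \<le> y \<longleftrightarrow> (\<forall>u v. 0 \<le> u \<longrightarrow> u \<le> v \<longrightarrow> v \<le> a \<longrightarrow> X u \<omega> - X v \<omega> \<le> y)"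
proof -
  let ?D = "{(u, v). 0 \<le> u \<and> u \<le> v \<and> v \<le> a}"
  obtain l h where "\<forall>v\<in>{0..a}. X v \<omega> \<le> h" "\<forall>v\<in>{0..a}. l \<le> X v \<omega>"
    using continuous_on_bounded_image[OF X] unfolding bdd_above_def bdd_below_def ball_simps by blast
  then have bdd: "bdd_above ((\<lambda>(u, v). X u \<omega> - X v \<omega>) ` ?D)"
    by (intro bdd_aboveI[of _ "h - l"]) (auto intro!: diff_mono)
  have "(0, 0) \<in> ?D" using a by simp
  then have ne: "?D \<noteq> {}" by blast
  show ?thesis unfolding max_loss_def using cSUP_le_iff[OF ne bdd] by auto
qed

lemma max_loss_ge:
  assumes "continuous_on {0..a} (\<lambda>t. X t \<omega>)" "0 \<le> u" "u \<le> v" "v \<le> a"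
  shows "X u \<omega> - X v \<omega> \<le> max_loss X a \<omega>"
  using max_loss_le_iff[of a X \<omega> "max_loss X a \<omega>"] assms by simp

text \<open>Replaces uncountably many pairs by countably many grid pairs. Measurability follows, and
  later the event becomes a decreasing limit of events with finitely many times. The floor index is
  monotone, so u <= v stays ordered after rounding.\<close>

lemma max_loss_le_iff_grid:
  assumes a: "0 < a" and X: "continuous_on {0..a} (\<lambda>t. X t \<omega>)"
  shows "max_loss X a \<omega> \<le> y \<longleftrightarrow> (\<forall>n j. \<forall>i\<le>j. j \<le> Suc n \<longrightarrow> X (grid a n i) \<omega> - X (grid a n j) \<omega> \<le> y)"
    (is "_ \<longleftrightarrow> ?G")
proof
  assume "max_loss X a \<omega> \<le> y"
  then show ?G
    using a grid_in[of a] grid_mono[of a] by (subst (asm) max_loss_le_iff[where X=X and \<omega>=\<omega>, OF _ X]) auto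
next
  assume G: ?G
  have "X u \<omega> - X v \<omega> \<le> y" if uv: "0 \<le> u" "u \<le> v" "v \<le> a" for u v
  proof (rule LIMSEQ_le_const2)
    let ?i = "\<lambda>(u::real) (n::nat). nat \<lfloor>u * Suc n / a\<rfloor>"
    have u: "u \<in> {0..a}" and v: "v \<in> {0..a}" using uv by auto
    show "(\<lambda>n. X (grid a n (?i u n)) \<omega> - X (grid a n (?i v n)) \<omega>) \<longlonglongrightarrow> X u \<omega> - X v \<omega>"
      by (intro tendsto_diff tendsto_grid_index[OF a u X] tendsto_grid_index[OF a v X])
    have "?i u n \<le> ?i v n" for n
      using uv a by (intro nat_mono floor_mono divide_right_mono mult_right_mono) auto
    then show "\<exists>N. \<forall>n\<ge>N. X (grid a n (?i u n)) \<omega> - X (grid a n (?i v n)) \<omega> \<le> y"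
      using G grid_index(1)[OF a v] by blast
  qed
  then show "max_loss X a \<omega> \<le> y" using a by (subst max_loss_le_iff[where X=X and \<omega>=\<omega>, OF _ X]) auto
qed

lemma max_loss_measurable:
  fixes X :: "real \<Rightarrow> 'a \<Rightarrow> real"
  assumes a: "0 < a" and X: "\<And>t. t \<in> {0..a} \<Longrightarrow> X t \<in> borel_measurable M"
    and cont: "\<And>\<omega>. \<omega> \<in> space M \<Longrightarrow> continuous_on {0..a} (\<lambda>t. X t \<omega>)"
  shows "max_loss X a \<in> borel_measurable M"
  unfolding borel_measurable_iff_le
proof
  fix y
  have [measurable]: "X (grid a n i) \<in> borel_measurable M" if "i \<le> Suc n" for n i
    using that a by (intro X grid_in) auto
  have "{\<omega> \<in> space M. max_loss X a \<omega> \<le> y} =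
     {\<omega> \<in> space M. \<forall>n j. \<forall>i\<le>j. j \<le> Suc n \<longrightarrow> X (grid a n i) \<omega> - X (grid a n j) \<omega> \<le> y}"
    using max_loss_le_iff_grid[OF a, of X] cont by auto
  also have "\<dots> = {\<omega> \<in> space M. \<forall>n. \<forall>j\<in>{..Suc n}. \<forall>i\<in>{..j}. X (grid a n i) \<omega> - X (grid a n j) \<omega> \<le> y}"
    by auto
  also have "\<dots> \<in> sets M" by measurable
  finally show "{\<omega> \<in> space M. max_loss X a \<omega> \<le> y} \<in> sets M" .
qed


section \<open>Running extrema, range and passage to the limit\<close>

lemma running_sup_ge:
  "continuous_on {0..a} (\<lambda>t. X t \<omega>) \<Longrightarrow> u \<in> {0..a} \<Longrightarrow> X u \<omega> \<le> running_sup X a \<omega>"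
  unfolding running_sup_def using continuous_on_bounded_image[of a "\<lambda>t. X t \<omega>"] by (intro cSUP_upper) auto

lemma running_inf_le:
  "continuous_on {0..a} (\<lambda>t. X t \<omega>) \<Longrightarrow> u \<in> {0..a} \<Longrightarrow> running_inf X a \<omega> \<le> X u \<omega>"
  unfolding running_inf_def using continuous_on_bounded_image[of a "\<lambda>t. X t \<omega>"] by (intro cINF_lower) auto

lemma running_inf_eq: "running_inf X a \<omega> = - running_sup (\<lambda>t \<omega>. - X t \<omega>) a \<omega>"
  unfolding running_inf_def running_sup_def Inf_real_def by (simp add: image_image)

lemma diff_le_process_range:
  "continuous_on {0..a} (\<lambda>t. X t \<omega>) \<Longrightarrow> u \<in> {0..a} \<Longrightarrow> v \<in> {0..a} \<Longrightarrow> X u \<omega> - X v \<omega> \<le> process_range X a \<omega>"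
  unfolding process_range_def using running_sup_ge[of a X \<omega> u] running_inf_le[of a X \<omega> v] by (intro diff_mono) auto

lemma max_loss_le_process_range:
  "0 \<le> a \<Longrightarrow> continuous_on {0..a} (\<lambda>t. X t \<omega>) \<Longrightarrow> max_loss X a \<omega> \<le> process_range X a \<omega>"
  by (subst max_loss_le_iff) (auto intro!: diff_le_process_range)

text \<open>Fatou's lemma rather than monotone convergence, because the grids are not nested;
  integrability of the limit comes with the bound.\<close>

lemma integrable_limit_bound:
  fixes f :: "nat \<Rightarrow> 'a \<Rightarrow> real"
  assumes f: "\<And>n. integrable M (f n)" "\<And>n \<omega>. 0 \<le> f n \<omega>" "\<And>n. (\<integral>\<omega>. f n \<omega> \<partial>M) \<le> c"
    and lim: "\<And>\<omega>. \<omega> \<in> space M \<Longrightarrow> (\<lambda>n. f n \<omega>) \<longlonglongrightarrow> g \<omega>"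
  shows "integrable M g" and "(\<integral>\<omega>. g \<omega> \<partial>M) \<le> c"
proof -
  have g[measurable]: "g \<in> borel_measurable M"
    by (rule borel_measurable_LIMSEQ_real[OF lim]) (use f(1) in auto)
  have g0: "0 \<le> g \<omega>" if "\<omega> \<in> space M" for \<omega>
    using LIMSEQ_le_const[OF lim[OF that]] f(2) by auto
  have "(\<integral>\<^sup>+\<omega>. ennreal (g \<omega>) \<partial>M) = (\<integral>\<^sup>+\<omega>. liminf (\<lambda>n. ennreal (f n \<omega>)) \<partial>M)"
    using lim by (intro nn_integral_cong) (auto intro!: lim_imp_Liminf[symmetric])
  also have "\<dots> \<le> liminf (\<lambda>n. \<integral>\<^sup>+\<omega>. ennreal (f n \<omega>) \<partial>M)"
    using f(1) by (intro nn_integral_liminf) auto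
  also have "\<dots> \<le> ennreal c"
  proof (rule Liminf_le)
    show "\<forall>\<^sub>F n in sequentially. (\<integral>\<^sup>+\<omega>. ennreal (f n \<omega>) \<partial>M) \<le> ennreal c"
      using f by (intro always_eventually allI) (simp add: nn_integral_eq_integral ennreal_leI)
  qed simp
  finally have le: "(\<integral>\<^sup>+\<omega>. ennreal (g \<omega>) \<partial>M) \<le> ennreal c" .
  show int: "integrable M g"
    using le g0 by (intro integrableI_nonneg) (auto intro: le_less_trans)
  have "0 \<le> c" using order_trans[OF Bochner_Integration.integral_nonneg f(3)] f(2) by blast
  then show "(\<integral>\<omega>. g \<omega> \<partial>M) \<le> c"
    using le g0 by (subst (asm) nn_integral_eq_integral[OF int]) auto
qed

text \<open>Passes from a process indexed by times to one indexed by grid numbers, the index set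
  that the walk uses.\<close>

lemma centered_gaussian_vector_reindex:
  assumes C: "centered_gaussian_vector M (\<tau> ` I) X C" and inj: "inj_on \<tau> I"
  shows "centered_gaussian_vector M I (\<lambda>i. X (\<tau> i)) (\<lambda>i j. C (\<tau> i) (\<tau> j))"
proof -
  have "(\<integral>\<omega>. iexp (\<Sum>i\<in>I. c i * X (\<tau> i) \<omega>) \<partial>M) =
      complex_of_real (exp (- (\<Sum>i\<in>I. \<Sum>j\<in>I. c i * c j * C (\<tau> i) (\<tau> j)) / 2))" for c
  proof -
    have "(\<integral>\<omega>. iexp (\<Sum>t\<in>\<tau> ` I. c (the_inv_into I \<tau> t) * X t \<omega>) \<partial>M) =
      complex_of_real (exp (- (\<Sum>s\<in>\<tau> ` I. \<Sum>t\<in>\<tau> ` I. c (the_inv_into I \<tau> s) * c (the_inv_into I \<tau> t) * C s t) / 2))"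
      using C unfolding centered_gaussian_vector_def by (elim conjE) (erule allE)
    then show ?thesis
      by (simp only: sum.reindex[OF inj] comp_def the_inv_into_f_f[OF inj] cong: sum.cong)
  qed
  then show ?thesis using C unfolding centered_gaussian_vector_def by auto
qed

section \<open>Fractional Brownian motion\<close>

lemma (in prob_space) gaussian_rv_integrable_square:
  assumes "gaussian_rv M Y"
  shows "integrable M (\<lambda>\<omega>. (Y \<omega>)\<^sup>2)"
proof -
  have [measurable]: "Y \<in> borel_measurable M" using assms by (simp add: gaussian_rv_def)
  consider \<mu> where "AE \<omega> in M. Y \<omega> = \<mu>"
    | \<mu> \<sigma> where "0 < \<sigma>" "distributed M lborel Y (normal_density \<mu> \<sigma>)"
    using assms by (auto simp: gaussian_rv_def)
  then show ?thesis
  proof cases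
    case 1
    then have "integrable M (\<lambda>\<omega>. (Y \<omega>)\<^sup>2) \<longleftrightarrow> integrable M (\<lambda>\<omega>. \<mu>\<^sup>2)"
      by (intro integrable_cong_AE) auto
    then show ?thesis by simp
  next
    case 2
    have "integrable lborel (\<lambda>x. normal_density \<mu> \<sigma> x * (x - \<mu>)\<^sup>2 + 2 * \<mu> * (normal_density \<mu> \<sigma> x * (x - \<mu>)) + \<mu>\<^sup>2 * normal_density \<mu> \<sigma> x)"
      using integrable_normal_moment[OF 2(1), of \<mu> 2] integrable_normal_moment[OF 2(1), of \<mu> 1] integrable_normal_density[OF 2(1)]
      by (intro Bochner_Integration.integrable_add integrable_mult_right) simp_all
    also have "(\<lambda>x. normal_density \<mu> \<sigma> x * (x - \<mu>)\<^sup>2 + 2 * \<mu> * (normal_density \<mu> \<sigma> x * (x - \<mu>)) + \<mu>\<^sup>2 * normal_density \<mu> \<sigma> x) = (\<lambda>x. normal_density \<mu> \<sigma> x * x\<^sup>2)"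
      by (simp add: fun_eq_iff power2_eq_square algebra_simps)
    finally show ?thesis using distributed_integrable[OF 2(2), of "\<lambda>x. x\<^sup>2"] by simp
  qed
qed

text \<open>In the degenerate case mean 0 forces Y = 0 almost surely and both sides are 1; otherwise
  the parameter mu is the mean 0 and the second moment is sigma^2.\<close>

lemma (in prob_space) gaussian_rv_char:
  assumes Y: "gaussian_rv M Y" and mean: "expectation Y = 0"
  shows "expectation (\<lambda>\<omega>. iexp (Y \<omega>)) = complex_of_real (exp (- expectation (\<lambda>\<omega>. (Y \<omega>)\<^sup>2) / 2))"
proof -
  have [measurable]: "Y \<in> borel_measurable M" using assms by (simp add: gaussian_rv_def)
  consider \<mu> where "AE \<omega> in M. Y \<omega> = \<mu>"
    | \<mu> \<sigma> where "0 < \<sigma>" "distributed M lborel Y (normal_density \<mu> \<sigma>)"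
    using assms by (auto simp: gaussian_rv_def)
  then show ?thesis
  proof cases
    case 1
    then have "expectation Y = expectation (\<lambda>_. \<mu>)" by (intro integral_cong_AE) auto
    then have "\<mu> = 0" using mean by (simp add: prob_space)
    then have "AE \<omega> in M. Y \<omega> = 0" using 1 by simp
    then have AE: "AE \<omega> in M. iexp (Y \<omega>) = 1" "AE \<omega> in M. (Y \<omega>)\<^sup>2 = 0" by auto
    have "expectation (\<lambda>\<omega>. iexp (Y \<omega>)) = expectation (\<lambda>_. 1)"
      by (rule integral_cong_AE) (use AE in auto)
    moreover have "expectation (\<lambda>\<omega>. (Y \<omega>)\<^sup>2) = expectation (\<lambda>_. 0)"
      by (rule integral_cong_AE) (use AE in auto)
    ultimately show ?thesis by (simp add: prob_space)
  next
    case 2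
    have "\<mu> = 0" using normal_distributed_expectation[OF 2] mean by simp
    moreover have "expectation (\<lambda>\<omega>. (Y \<omega>)\<^sup>2) = \<sigma>\<^sup>2" using normal_distributed_variance[OF 2] mean by simp
    ultimately show ?thesis using char_if_distributed_normal[of Y \<sigma> 1] 2 by simp
  qed
qed

definition fbm_cov :: "real \<Rightarrow> real \<Rightarrow> real \<Rightarrow> real" where
  "fbm_cov H s t = (s powr (2 * H) + t powr (2 * H) - \<bar>s - t\<bar> powr (2 * H)) / 2"

lemma fbm_cov_commute: "fbm_cov H s t = fbm_cov H t s"
  unfolding fbm_cov_def by (simp add: abs_minus_commute)

lemma fbm_cov_diag: "0 < H \<Longrightarrow> fbm_cov H t t = t powr (2 * H)"
  unfolding fbm_cov_def by simp

text \<open>Superadditivity applied to s and t - s. The left side is the variance at the earlier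
  time, that is, the covariance of a process with independent increments and the same
  variances.\<close>

lemma fbm_cov_ge:
  assumes "1 / 2 < H" "0 \<le> s" "s \<le> t"
  shows "s powr (2 * H) \<le> fbm_cov H s t"
  using powr_superadditive[of s "t - s" "2 * H"] assms unfolding fbm_cov_def by (simp add: abs_if)

locale fbm = prob_space M for M :: "'a measure" +
  fixes H :: real and B :: "real \<Rightarrow> 'a \<Rightarrow> real"
  assumes fbm: "fractional_brownian_motion M H B" and H_half: "1 / 2 < H"
begin

lemma H_pos: "0 < H" using H_half by linarith

lemma gaussian_sum: "finite T \<Longrightarrow> T \<subseteq> {0..} \<Longrightarrow> gaussian_rv M (\<lambda>\<omega>. \<Sum>t\<in>T. c t * B t \<omega>)"
  using fbm by (simp add: fractional_brownian_motion_def gaussian_process_def)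

lemma gaussian_B: "0 \<le> t \<Longrightarrow> gaussian_rv M (B t)"
  using gaussian_sum[of "{t}" "\<lambda>_. 1"] by simp

lemma B_measurable: "0 \<le> t \<Longrightarrow> B t \<in> borel_measurable M"
  using gaussian_B by (simp add: gaussian_rv_def)

lemma B_integrable: "0 \<le> t \<Longrightarrow> integrable M (B t)"
  using fbm by (simp add: fractional_brownian_motion_def centered_process_def)

lemma B_mean: "0 \<le> t \<Longrightarrow> expectation (B t) = 0"
  using fbm by (simp add: fractional_brownian_motion_def centered_process_def)

lemma B_0: "\<omega> \<in> space M \<Longrightarrow> B 0 \<omega> = 0"
  using fbm by (simp add: fractional_brownian_motion_def)

lemma B_continuous: "\<omega> \<in> space M \<Longrightarrow> continuous_on {0..a} (\<lambda>t. B t \<omega>)"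
  using fbm by (auto simp: fractional_brownian_motion_def continuous_process_def intro: continuous_on_subset)

lemma B_cov: "0 \<le> s \<Longrightarrow> 0 \<le> t \<Longrightarrow> expectation (\<lambda>\<omega>. B s \<omega> * B t \<omega>) = fbm_cov H s t"
  using fbm by (simp add: fractional_brownian_motion_def fbm_cov_def)

lemma B_mult_integrable:
  assumes "0 \<le> s" "0 \<le> t"
  shows "integrable M (\<lambda>\<omega>. B s \<omega> * B t \<omega>)"
proof (rule Bochner_Integration.integrable_bound)
  show "integrable M (\<lambda>\<omega>. (B s \<omega>)\<^sup>2 + (B t \<omega>)\<^sup>2)"
    using assms by (intro Bochner_Integration.integrable_add gaussian_rv_integrable_square gaussian_B)
  have [measurable]: "B s \<in> borel_measurable M" "B t \<in> borel_measurable M" using assms B_measurable by auto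
  show "(\<lambda>\<omega>. B s \<omega> * B t \<omega>) \<in> borel_measurable M" by measurable
  show "AE \<omega> in M. norm (B s \<omega> * B t \<omega>) \<le> norm ((B s \<omega>)\<^sup>2 + (B t \<omega>)\<^sup>2)"
  proof (rule AE_I2)
    fix \<omega>
    have "2 * (\<bar>B s \<omega>\<bar> * \<bar>B t \<omega>\<bar>) \<le> (B s \<omega>)\<^sup>2 + (B t \<omega>)\<^sup>2"
      using sum_squares_bound[of "\<bar>B s \<omega>\<bar>" "\<bar>B t \<omega>\<bar>"] by (simp add: mult.assoc)
    moreover have "0 \<le> \<bar>B s \<omega>\<bar> * \<bar>B t \<omega>\<bar>" by simp
    ultimately show "norm (B s \<omega> * B t \<omega>) \<le> norm ((B s \<omega>)\<^sup>2 + (B t \<omega>)\<^sup>2)"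
      unfolding real_norm_def abs_mult by linarith
  qed
qed

text \<open>Each linear combination is a single Gaussian variable of mean 0, so its second moment
  determines its characteristic function.\<close>

lemma B_gaussian_vector:
  assumes T: "finite T" "T \<subseteq> {0..}"
  shows "centered_gaussian_vector M T B (fbm_cov H)"
  unfolding centered_gaussian_vector_def
proof (intro conjI ballI allI)
  show "B t \<in> borel_measurable M" if "t \<in> T" for t using that T B_measurable by auto
  fix c :: "real \<Rightarrow> real"
  let ?Y = "\<lambda>\<omega>. \<Sum>t\<in>T. c t * B t \<omega>"
  have pos: "0 \<le> t" if "t \<in> T" for t using that T by auto
  have "expectation ?Y = (\<Sum>t\<in>T. c t * expectation (B t))"
    using pos B_integrable by (subst Bochner_Integration.integral_sum) auto
  then have mean: "expectation ?Y = 0" using pos B_mean by simp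
  have "(?Y \<omega>)\<^sup>2 = (\<Sum>s\<in>T. \<Sum>t\<in>T. c s * c t * (B s \<omega> * B t \<omega>))" for \<omega>
    unfolding power2_eq_square sum_product by (intro sum.cong refl) simp
  then have "expectation (\<lambda>\<omega>. (?Y \<omega>)\<^sup>2) = expectation (\<lambda>\<omega>. \<Sum>s\<in>T. \<Sum>t\<in>T. c s * c t * (B s \<omega> * B t \<omega>))" by simp
  also have "\<dots> = (\<Sum>s\<in>T. \<Sum>t\<in>T. c s * c t * expectation (\<lambda>\<omega>. B s \<omega> * B t \<omega>))"
    using pos B_mult_integrable by (simp add: Bochner_Integration.integral_sum)
  also have "\<dots> = (\<Sum>s\<in>T. \<Sum>t\<in>T. c s * c t * fbm_cov H s t)"
    using pos B_cov by (intro sum.cong refl) simp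
  finally show "expectation (\<lambda>\<omega>. iexp (?Y \<omega>)) = complex_of_real (exp (- (\<Sum>s\<in>T. \<Sum>t\<in>T. c s * c t * fbm_cov H s t) / 2))"
    using gaussian_rv_char[OF gaussian_sum[OF T] mean] by simp
qed

text \<open>The factor \<open>b\<close> is 1 or -1: B and -B have the same covariance, so one proof
  serves the supremum and the infimum.\<close>

lemma grid_max_expectation_le:
  assumes a: "0 < a" and b: "b\<^sup>2 = 1"
  shows "integrable M (\<lambda>\<omega>. max 0 (MAX k\<in>{1..Suc n}. b * B (grid a n k) \<omega>))"
    and "expectation (\<lambda>\<omega>. max 0 (MAX k\<in>{1..Suc n}. b * B (grid a n k) \<omega>)) \<le> a powr H * sqrt (2 / pi)"
proof -
  let ?I = "{1..Suc n}" and ?\<tau> = "grid a n"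
  \<comment> \<open>Step sizes that give the walk the variance \<open>?\<tau> k powr (2 * H)\<close>
    at time k: the squares telescope, and the last deviation is \<open>a powr H\<close>.\<close>
  define s where "s j = sqrt (?\<tau> (Suc j) powr (2 * H) - ?\<tau> j powr (2 * H))" for j
  have lt: "?\<tau> j powr (2 * H) < ?\<tau> (Suc j) powr (2 * H)" for j
    using a H_pos grid_mono[of a 0 j n] by (intro powr_less_mono2 grid_less) auto
  then have s: "0 < s j" for j unfolding s_def by simp
  have s2: "(s j)\<^sup>2 = ?\<tau> (Suc j) powr (2 * H) - ?\<tau> j powr (2 * H)" for j
    unfolding s_def using lt[of j] by simp
  have tel: "(\<Sum>j<k. (s j)\<^sup>2) = ?\<tau> k powr (2 * H)" for k
    unfolding s2 by (subst sum_lessThan_telescope) simp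
  have "inj_on ?\<tau> ?I"
    using a by (auto intro!: inj_onI simp: grid_def)
  moreover have "centered_gaussian_vector M (?\<tau> ` ?I) B (fbm_cov H)"
    using a by (intro B_gaussian_vector) (auto simp: grid_def)
  ultimately have X: "centered_gaussian_vector M ?I (\<lambda>k \<omega>. b * B (?\<tau> k) \<omega>) (\<lambda>k l. fbm_cov H (?\<tau> k) (?\<tau> l))"
    using centered_gaussian_vector_scale[OF centered_gaussian_vector_reindex, of M ?\<tau> ?I B "fbm_cov H" b] b by simp
  have pos: "0 < fbm_cov H (?\<tau> k) (?\<tau> k)" if "k \<in> ?I" for k
    using that a H_pos unfolding fbm_cov_diag[OF H_pos] by (simp add: grid_def)
  show "integrable M (\<lambda>\<omega>. max 0 (MAX k\<in>?I. b * B (?\<tau> k) \<omega>))"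
    using centered_gaussian_vector_integrable[OF X] pos by (intro integrable_max_0_Max) auto
  have "expectation (\<lambda>\<omega>. max 0 (MAX k\<in>?I. b * B (?\<tau> k) \<omega>)) \<le> 
     (\<integral>g. max 0 (MAX k\<in>?I. \<Sum>j<k. s j * g j) \<partial>std_normal_product {..<Suc n})"
  proof (rule expectation_max_mono_covariance[OF prob_space_axioms prob_space_std_normal_product _ _ X centered_gaussian_vector_random_walk])
    show "(\<Sum>j<min k l. (s j)\<^sup>2) \<le> fbm_cov H (?\<tau> k) (?\<tau> l)" if "k \<in> ?I" "l \<in> ?I" for k l
      using that a fbm_cov_ge[OF H_half, of "?\<tau> k" "?\<tau> l"] fbm_cov_ge[OF H_half, of "?\<tau> l" "?\<tau> k"]
        grid_mono[of a k l n] grid_mono[of a l k n] grid_mono[of a 0 k n] grid_mono[of a 0 l n]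
      unfolding tel fbm_cov_commute[of H "?\<tau> l" "?\<tau> k"] by (cases "k \<le> l") (auto simp: min_def)
  qed (auto simp: grid_eq_0_iff[OF a] fbm_cov_commute min.commute tel fbm_cov_diag[OF H_pos] pos[unfolded fbm_cov_diag[OF H_pos]])
  also have "\<dots> \<le> sqrt (\<Sum>j<Suc n. (s j)\<^sup>2) * sqrt (2 / pi)"
    by (rule expectation_max_random_walk_le[OF s]) simp
  also have "sqrt (\<Sum>j<Suc n. (s j)\<^sup>2) = a powr H"
    unfolding tel grid_Suc using a by (simp add: powr_half_sqrt[symmetric] powr_powr)
  finally show "expectation (\<lambda>\<omega>. max 0 (MAX k\<in>?I. b * B (?\<tau> k) \<omega>)) \<le> a powr H * sqrt (2 / pi)" .
qed

lemma running_sup_expectation_le: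
  assumes a: "0 < a" and b: "b\<^sup>2 = 1"
  shows "integrable M (running_sup (\<lambda>t \<omega>. b * B t \<omega>) a)"
    and "expectation (running_sup (\<lambda>t \<omega>. b * B t \<omega>) a) \<le> a powr H * sqrt (2 / pi)"
proof -
  note int = grid_max_expectation_le[OF a b]
  have "(\<lambda>n. max 0 (MAX k\<in>{1..Suc n}. b * B (grid a n k) \<omega>)) \<longlonglongrightarrow> running_sup (\<lambda>t \<omega>. b * B t \<omega>) a \<omega>"
    if "\<omega> \<in> space M" for \<omega>
    unfolding running_sup_def using B_continuous[OF that] B_0[OF that]
    by (intro tendsto_grid_max[OF a]) (auto intro!: continuous_intros)
  from integrable_limit_bound[OF int(1) _ int(2) this]
  show "integrable M (running_sup (\<lambda>t \<omega>. b * B t \<omega>) a)"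
    "expectation (running_sup (\<lambda>t \<omega>. b * B t \<omega>) a) \<le> a powr H * sqrt (2 / pi)" by auto
qed

lemma process_range_expectation_le:
  assumes a: "0 < a"
  shows "integrable M (process_range B a)"
    and "expectation (process_range B a) \<le> 2 * (a powr H * sqrt (2 / pi))"
proof -
  note S = running_sup_expectation_le[OF a, of 1, simplified] and I = running_sup_expectation_le[OF a, of "-1", simplified]
  have eq: "process_range B a = (\<lambda>\<omega>. running_sup B a \<omega> + running_sup (\<lambda>t \<omega>. - B t \<omega>) a \<omega>)"
    unfolding process_range_def running_inf_eq by (simp add: fun_eq_iff)
  show "integrable M (process_range B a)" unfolding eq using S I by simp
  show "expectation (process_range B a) \<le> 2 * (a powr H * sqrt (2 / pi))" unfolding eq using S I by simp
qed

section \<open>Regression of the path on its endpoint\<close>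

definition regression :: "real \<Rightarrow> real \<Rightarrow> real" where
  "regression a t = fbm_cov H a t / a powr (2 * H)"

text \<open>The part of B t left after linear prediction from B a, since
  \<open>regression a t\<close> is covariance over variance; it is uncorrelated with B a.\<close>

definition residual :: "real \<Rightarrow> real \<Rightarrow> 'a \<Rightarrow> real" where
  "residual a t \<omega> = B t \<omega> - regression a t * B a \<omega>"

text \<open>Twice the covariance difference is v^(2H) - u^(2H) plus (a - u)^(2H) - (a - v)^(2H). The
  first difference is at least (v - u)^(2H) by superadditivity, the second is nonnegative. The
  explicit gap is what later beats the oscillation of a path.\<close>

lemma regression_diff_ge:
  assumes "0 < a" "0 \<le> u" "u \<le> v" "v \<le> a"
  shows "(v - u) powr (2 * H) / (2 * a powr (2 * H)) \<le> regression a v - regression a u"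
proof -
  have "(a - v) powr (2 * H) \<le> (a - u) powr (2 * H)" using assms H_pos by (intro powr_mono2) auto
  moreover have "u powr (2 * H) + (v - u) powr (2 * H) \<le> v powr (2 * H)"
    using powr_superadditive[of u "v - u" "2 * H"] assms H_half by simp
  ultimately have "(v - u) powr (2 * H) \<le> 2 * (fbm_cov H a v - fbm_cov H a u)"
    using assms unfolding fbm_cov_def by (simp add: field_simps)
  then have "(v - u) powr (2 * H) / (2 * a powr (2 * H)) \<le> 2 * (fbm_cov H a v - fbm_cov H a u) / (2 * a powr (2 * H))"
    by (intro divide_right_mono) auto
  also have "\<dots> = regression a v - regression a u"
    unfolding regression_def by (simp add: diff_divide_distrib)
  finally show ?thesis .
qed

lemma regression_mono: "0 < a \<Longrightarrow> 0 \<le> u \<Longrightarrow> u \<le> v \<Longrightarrow> v \<le> a \<Longrightarrow> regression a u \<le> regression a v"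
  using regression_diff_ge[of a u v] by (smt (verit) divide_nonneg_nonneg powr_ge_zero)

lemma continuous_regression:
  assumes "0 < a"
  shows "continuous_on {0..a} (regression a)"
proof -
  have "continuous_on {0..a} (\<lambda>t. t powr (2 * H))" "continuous_on {0..a} (\<lambda>t. \<bar>a - t\<bar> powr (2 * H))"
    using H_pos
    by (intro continuous_on_powr' continuous_on_id continuous_on_const continuous_on_rabs continuous_on_diff; auto)+
  then show ?thesis
    unfolding regression_def fbm_cov_def using assms
    by (intro continuous_on_divide continuous_on_diff continuous_on_add continuous_on_const) auto
qed

lemma residual_measurable: "0 \<le> a \<Longrightarrow> 0 \<le> t \<Longrightarrow> residual a t \<in> borel_measurable M"
  unfolding residual_def[abs_def] using B_measurable by (intro borel_measurable_diff borel_measurable_times) auto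

text \<open>The regression coefficient cancels the mixed term, so the exponent of the joint
  characteristic function splits into \<open>Q c\<close> and a term in s. The time \<open>a\<close>
  belongs to \<open>T\<close> so that combinations involving \<open>B a\<close> are again
  combinations over \<open>T\<close>.\<close>

lemma distr_pair_residual:
  assumes a: "0 < a" and T: "finite T" "T \<subseteq> {0..}" "a \<in> T"
  shows "distr M (borel \<Otimes>\<^sub>M (\<Pi>\<^sub>M t\<in>T. borel)) (\<lambda>\<omega>. (B a \<omega>, \<lambda>t\<in>T. residual a t \<omega>)) =
    distr M borel (B a) \<Otimes>\<^sub>M distr M (\<Pi>\<^sub>M t\<in>T. borel) (\<lambda>\<omega>. \<lambda>t\<in>T. residual a t \<omega>)"
proof (rule distr_pair_PiM_if_char_mult[OF T(1)])
  show "B a \<in> borel_measurable M" using a B_measurable by simp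
  show "residual a t \<in> borel_measurable M" if "t \<in> T" for t using that T a by (intro residual_measurable) auto
  let ?V = "a powr (2 * H)"
  define Q where "Q c = (\<Sum>s\<in>T. \<Sum>t\<in>T. c s * c t * fbm_cov H s t) - (\<Sum>t\<in>T. c t * regression a t)\<^sup>2 * ?V" for c
  have char: "expectation (\<lambda>\<omega>. iexp (s * B a \<omega> + (\<Sum>t\<in>T. c t * residual a t \<omega>))) = complex_of_real (exp (- (Q c + s\<^sup>2 * ?V) / 2))" for s c
  proof -
    let ?k = "\<Sum>t\<in>T. c t * regression a t"
    \<comment> \<open>Expressed through B alone, the residuals and s * B a amount to the weights
      \<open>c\<close> with s - ?k added at time \<open>a\<close>.\<close>
    let ?c = "\<lambda>t. c t + (if t = a then s - ?k else 0)"
    have "(\<Sum>t\<in>T. ?c t * B t \<omega>) = (\<Sum>t\<in>T. c t * B t \<omega>) + (s - ?k) * B a \<omega>" for \<omega>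
      using T by (simp add: distrib_right sum.distrib if_distrib[of "\<lambda>x. x * _"] cong: if_cong)
    then have lin: "s * B a \<omega> + (\<Sum>t\<in>T. c t * residual a t \<omega>) = (\<Sum>t\<in>T. ?c t * B t \<omega>)" for \<omega>
      unfolding residual_def by (simp add: algebra_simps sum_subtractf sum_distrib_left sum_distrib_right)
    have "(\<Sum>t\<in>T. c t * fbm_cov H a t) = ?k * ?V"
      using a unfolding regression_def by (simp add: sum_distrib_right)
    then have "(\<Sum>s\<in>T. \<Sum>t\<in>T. ?c s * ?c t * fbm_cov H s t) = (\<Sum>s\<in>T. \<Sum>t\<in>T. c s * c t * fbm_cov H s t) + 2 * (s - ?k) * (?k * ?V) + (s - ?k)\<^sup>2 * ?V"
      using double_sum_add_single[OF T(1,3) fbm_cov_commute, of c "s - ?k"] by (simp add: fbm_cov_diag[OF H_pos])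
    also have "\<dots> = Q c + s\<^sup>2 * ?V"
      unfolding Q_def by (simp add: power2_eq_square algebra_simps)
    finally have quad: "(\<Sum>s\<in>T. \<Sum>t\<in>T. ?c s * ?c t * fbm_cov H s t) = Q c + s\<^sup>2 * ?V" .
    have "expectation (\<lambda>\<omega>. iexp (\<Sum>t\<in>T. ?c t * B t \<omega>)) = complex_of_real (exp (- (\<Sum>s\<in>T. \<Sum>t\<in>T. ?c s * ?c t * fbm_cov H s t) / 2))"
      using B_gaussian_vector[OF T(1,2)] unfolding centered_gaussian_vector_def by (elim conjE) (erule allE)
    then show ?thesis unfolding lin quad .
  qed
  have "Q (\<lambda>_. 0) = 0" unfolding Q_def by simp
  then have "expectation (\<lambda>\<omega>. iexp (s * B a \<omega>)) = complex_of_real (exp (- (s\<^sup>2 * ?V) / 2))" for s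
    using char[of s "\<lambda>_. 0"] by simp
  moreover have "expectation (\<lambda>\<omega>. iexp (\<Sum>t\<in>T. c t * residual a t \<omega>)) = complex_of_real (exp (- Q c / 2))" for c
    using char[of 0 c] by simp
  moreover have "exp (- (q + v) / 2) = exp (- v / 2) * exp (- q / 2)" for q v :: real
    by (simp add: exp_add[symmetric] field_simps)
  ultimately show "expectation (\<lambda>\<omega>. iexp (s * B a \<omega> + (\<Sum>t\<in>T. c t * residual a t \<omega>))) =
    expectation (\<lambda>\<omega>. iexp (s * B a \<omega>)) * expectation (\<lambda>\<omega>. iexp (\<Sum>t\<in>T. c t * residual a t \<omega>))" for s c
    unfolding char by (simp only: of_real_mult)
qed

lemma prob_residual_event:
  assumes a: "0 < a" and T: "finite T" "T \<subseteq> {0..}" "a \<in> T"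
    and E[measurable]: "E \<in> sets (\<Pi>\<^sub>M t\<in>T. borel)"
  shows "prob {\<omega> \<in> space M. K \<le> B a \<omega> \<and> (\<lambda>t\<in>T. residual a t \<omega>) \<in> E} =
    prob {\<omega> \<in> space M. K \<le> B a \<omega>} * prob {\<omega> \<in> space M. (\<lambda>t\<in>T. residual a t \<omega>) \<in> E}"
proof -
  let ?R = "\<lambda>\<omega>. \<lambda>t\<in>T. residual a t \<omega>"
  have [measurable]: "B a \<in> borel_measurable M" using a B_measurable by simp
  have [measurable]: "residual a t \<in> borel_measurable M" if "t \<in> T" for t using that T a by (intro residual_measurable) auto
  have Rm[measurable]: "?R \<in> measurable M (\<Pi>\<^sub>M t\<in>T. borel)" by measurable
  interpret X: prob_space "distr M borel (B a)" by (rule prob_space_distr) simp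
  interpret Y: prob_space "distr M (\<Pi>\<^sub>M t\<in>T. borel) ?R" by (rule prob_space_distr) fact
  have "emeasure M {\<omega> \<in> space M. K \<le> B a \<omega> \<and> ?R \<omega> \<in> E} = 
    emeasure (distr M (borel \<Otimes>\<^sub>M (\<Pi>\<^sub>M t\<in>T. borel)) (\<lambda>\<omega>. (B a \<omega>, ?R \<omega>))) ({K..} \<times> E)"
    by (subst emeasure_distr) (auto intro!: arg_cong[where f="emeasure M"])
  also have "\<dots> = emeasure (distr M borel (B a)) {K..} * emeasure (distr M (\<Pi>\<^sub>M t\<in>T. borel) ?R) E"
    unfolding distr_pair_residual[OF a T] by (rule Y.emeasure_pair_measure_Times) auto
  also have "\<dots> = emeasure M {\<omega> \<in> space M. K \<le> B a \<omega>} * emeasure M {\<omega> \<in> space M. ?R \<omega> \<in> E}"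
    by (auto simp: emeasure_distr intro!: arg_cong2[where f="(*)"] arg_cong[where f="emeasure M"])
  finally show ?thesis
    by (simp add: emeasure_eq_measure ennreal_mult[symmetric])
qed

text \<open>The normal density is positive everywhere, and \<open>{K..}\<close> contains an interval
  of length 1.\<close>

lemma prob_B_ge_pos:
  assumes a: "0 < a"
  shows "0 < prob {\<omega> \<in> space M. K \<le> B a \<omega>}"
proof -
  let ?\<sigma> = "sqrt (a powr (2 * H))"
  have V: "0 < a powr (2 * H)" using a by simp
  have Bm[measurable]: "B a \<in> borel_measurable M" using a B_measurable by simp
  have "distributed M lborel (B a) (normal_density 0 ?\<sigma>)"
    using centered_gaussian_vector_char_component[OF B_gaussian_vector[of "{a}"], of a] a
    by (intro distributed_normal_if_char[OF Bm V]) (auto simp: fbm_cov_diag[OF H_pos])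
  then have D: "distr M lborel (B a) = density lborel (normal_density 0 ?\<sigma>)"
    by (simp add: distributed_def)
  have "emeasure M {\<omega> \<in> space M. K \<le> B a \<omega>} = emeasure (distr M lborel (B a)) {K..}"
    by (subst emeasure_distr) (auto intro!: arg_cong[where f="emeasure M"])
  also have "\<dots> = (\<integral>\<^sup>+x. ennreal (normal_density 0 ?\<sigma> x) * indicator {K..} x \<partial>lborel)"
    unfolding D by (rule emeasure_density) auto
  also have "\<dots> \<noteq> 0"
  proof
    assume "(\<integral>\<^sup>+x. ennreal (normal_density 0 ?\<sigma> x) * indicator {K..} x \<partial>lborel) = 0"
    then have "AE x in lborel. ennreal (normal_density 0 ?\<sigma> x) * indicator {K..} x = 0"
      by (subst (asm) nn_integral_0_iff_AE) auto
    then have "AE x in lborel. x \<notin> {K..}"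
    proof eventually_elim
      case (elim x)
      then show ?case using normal_density_pos[of ?\<sigma> 0 x] V by (auto split: split_indicator_asm)
    qed
    then have "{K..} \<in> null_sets lborel" by (subst AE_iff_null_sets) auto
    then have "emeasure lborel {K..} = 0" by auto
    moreover have "emeasure lborel {K..K + 1} \<le> emeasure lborel {K..}" by (intro emeasure_mono) auto
    ultimately show False by simp
  qed
  finally show ?thesis by (simp add: emeasure_eq_measure zero_less_measure_iff)
qed

text \<open>Adding a large multiple of the strictly increasing regression function to any continuous path
  makes its maximum loss small: close times are handled by uniform continuity, distant ones by the drift.\<close>

lemma max_loss_drift_small:
  assumes a: "0 < a" and y: "0 < y" and \<omega>: "\<omega> \<in> space M"
  shows "\<exists>K::nat. max_loss (\<lambda>t \<omega>. residual a t \<omega> + real K * regression a t) a \<omega> \<le> y"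
proof -
  let ?f = "\<lambda>t. residual a t \<omega>"
  have f: "continuous_on {0..a} ?f"
    unfolding residual_def by (intro continuous_intros B_continuous[OF \<omega>] continuous_regression[OF a])
  have "uniformly_continuous_on {0..a} ?f" by (rule compact_uniformly_continuous[OF f]) simp
  then obtain d where d: "0 < d" "\<And>u v. u \<in> {0..a} \<Longrightarrow> v \<in> {0..a} \<Longrightarrow> dist v u < d \<Longrightarrow> dist (?f v) (?f u) < y"
    using y unfolding uniformly_continuous_on_def by metis
  obtain l h where lh: "\<forall>v\<in>{0..a}. ?f v \<le> h" "\<forall>v\<in>{0..a}. l \<le> ?f v"
    using continuous_on_bounded_image[OF f] unfolding bdd_above_def bdd_below_def ball_simps by blast
  \<comment> \<open>By \<open>regression_diff_ge\<close>, the regression function grows by at least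
    \<open>\<eta>\<close> over any time gap of length at least \<open>d\<close>. Then K is taken so
    large that K * eta covers the oscillation h - l.\<close>
  define \<eta> where "\<eta> = d powr (2 * H) / (2 * a powr (2 * H))"
  have \<eta>: "0 < \<eta>" unfolding \<eta>_def using a d by simp
  obtain K :: nat where K: "(h - l) / \<eta> \<le> real K" using real_arch_simple by blast
  have "(?f u + real K * regression a u) - (?f v + real K * regression a v) \<le> y" if uv: "0 \<le> u" "u \<le> v" "v \<le> a" for u v
  proof (cases "v - u < d")
    case True
    then have "?f u - ?f v < y" using d(2)[of u v] uv by (auto simp: dist_real_def)
    moreover have "real K * regression a u \<le> real K * regression a v"
      using regression_mono[OF a uv] by (intro mult_left_mono) auto
    ultimately show ?thesis by linarith
  next
    case False
    have "\<eta> \<le> (v - u) powr (2 * H) / (2 * a powr (2 * H))"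
      unfolding \<eta>_def using False d H_pos by (intro divide_right_mono powr_mono2) auto
    also have "\<dots> \<le> regression a v - regression a u" by (rule regression_diff_ge[OF a uv])
    finally have "real K * \<eta> \<le> real K * (regression a v - regression a u)" by (intro mult_left_mono) auto
    moreover have "h - l \<le> real K * \<eta>" using K \<eta> by (simp add: divide_le_eq)
    moreover have "?f u \<le> h" "l \<le> ?f v" using lh uv by auto
    ultimately show ?thesis using y by (simp add: right_diff_distrib)
  qed
  then have "max_loss (\<lambda>t \<omega>. residual a t \<omega> + real K * regression a t) a \<omega> \<le> y"
    using a f continuous_regression[OF a] by (subst max_loss_le_iff) (auto intro!: continuous_intros)
  then show ?thesis ..
qed

text \<open>When B a >= K, the path of B is that of \<open>X K\<close> plus the nonnegative multiple
  B a - K of the increasing regression function, and adding an increasing path does not raise the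
  loss. The loss of \<open>X K\<close> depends only on residuals, so it is independent of B a, and
  it suffices that each of the two events has positive probability.\<close>

lemma prob_small_loss_large_end_pos:
  assumes a: "0 < a" and y: "0 < y"
  shows "0 < prob {\<omega> \<in> space M. y \<le> B a \<omega> \<and> max_loss B a \<omega> \<le> y}"
proof -
  define X where "X K t \<omega> = residual a t \<omega> + real K * regression a t" for K :: nat and t \<omega>
  have Xcont: "continuous_on {0..a} (\<lambda>t. X K t \<omega>)" if "\<omega> \<in> space M" for K \<omega>
    unfolding X_def residual_def by (intro continuous_intros B_continuous[OF that] continuous_regression[OF a])
  have Xm: "X K t \<in> borel_measurable M" if "t \<in> {0..a}" for K t
    unfolding X_def[abs_def] using that a by (intro borel_measurable_add residual_measurable) auto
  have Bm[measurable]: "B a \<in> borel_measurable M" using a B_measurable by simp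
  have Lm[measurable]: "max_loss (X K) a \<in> borel_measurable M" for K
    by (rule max_loss_measurable[OF a Xm Xcont])
  have Lm'[measurable]: "max_loss B a \<in> borel_measurable M"
    by (rule max_loss_measurable[OF a B_measurable B_continuous]) auto
  \<comment> \<open>\<open>max_loss_drift_small\<close> gives each path its own slope. As slopes are
    natural numbers, not all of the countably many events can be null.\<close>
  have "\<exists>K. prob {\<omega> \<in> space M. max_loss (X K) a \<omega> \<le> y} \<noteq> 0"
  proof (rule ccontr)
    assume "\<not> ?thesis"
    then have "{\<omega> \<in> space M. max_loss (X K) a \<omega> \<le> y} \<in> null_sets M" for K
      by (auto simp: null_sets_def emeasure_eq_measure)
    then have "(\<Union>K. {\<omega> \<in> space M. max_loss (X K) a \<omega> \<le> y}) \<in> null_sets M" by (rule null_sets_UN)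
    moreover have "(\<Union>K. {\<omega> \<in> space M. max_loss (X K) a \<omega> \<le> y}) = space M"
      using max_loss_drift_small[OF a y] unfolding X_def by blast
    ultimately show False using emeasure_space_1 by (auto simp: null_sets_def)
  qed
  then obtain K where "prob {\<omega> \<in> space M. max_loss (X K) a \<omega> \<le> y} \<noteq> 0" ..
  then have PK: "0 < prob {\<omega> \<in> space M. max_loss (X K) a \<omega> \<le> y}" by (simp add: zero_less_measure_iff)
  \<comment> \<open>\<open>B a\<close> has to reach the slope, to control the loss, and
    \<open>y\<close>, as the claim demands.\<close>
  define L where "L = max (real K) y"
  \<comment> \<open>Each \<open>A N\<close> involves finitely many times, the situation in which
    independence is available; by continuity of the paths these events decrease to the loss
    event.\<close>
  define A where "A N = {\<omega> \<in> space M. \<forall>n\<in>{..N}. \<forall>j\<in>{..Suc n}. \<forall>i\<in>{..j}. X K (grid a n i) \<omega> - X K (grid a n j) \<omega> \<le> y}" for N :: nat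
  have [measurable]: "X K (grid a n i) \<in> borel_measurable M" if "i \<le> Suc n" for n i
    using that a by (intro Xm grid_in) auto
  have Am: "A N \<in> sets M" for N unfolding A_def by measurable
  have Adec: "decseq A" unfolding A_def decseq_def by (auto intro: order_trans)
  have AI: "(\<Inter>N. A N) = {\<omega> \<in> space M. max_loss (X K) a \<omega> \<le> y}"
  proof (intro set_eqI iffI)
    fix \<omega> assume "\<omega> \<in> (\<Inter>N. A N)"
    then have *: "\<omega> \<in> A N" for N by blast
    then have "\<omega> \<in> space M" unfolding A_def by blast
    moreover have "X K (grid a n i) \<omega> - X K (grid a n j) \<omega> \<le> y" if "i \<le> j" "j \<le> Suc n" for n i j
      using *[of n] that unfolding A_def by simp
    ultimately show "\<omega> \<in> {\<omega> \<in> space M. max_loss (X K) a \<omega> \<le> y}"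
      by (simp add: max_loss_le_iff_grid[OF a Xcont])
  qed (auto simp: A_def max_loss_le_iff_grid[OF a Xcont])
  let ?C = "{\<omega> \<in> space M. L \<le> B a \<omega>}"
  have Cm: "?C \<in> sets M" by measurable
  have ind: "prob (?C \<inter> A N) = prob ?C * prob (A N)" for N
  proof -
    define T where "T = (\<Union>n\<in>{..N}. grid a n ` {..Suc n})"
    have T: "finite T" "T \<subseteq> {0..}" unfolding T_def using a by (auto simp: grid_def)
    have gT: "grid a n i \<in> T" if "n \<le> N" "i \<le> Suc n" for n i unfolding T_def using that by blast
    have aT: "a \<in> T" using gT[of 0 1] by (simp add: grid_def)
    define E where "E = {g \<in> space (\<Pi>\<^sub>M t\<in>T. borel). \<forall>n\<in>{..N}. \<forall>j\<in>{..Suc n}. \<forall>i\<in>{..j}.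
       (g (grid a n i) + real K * regression a (grid a n i)) - (g (grid a n j) + real K * regression a (grid a n j)) \<le> y}"
    have [measurable]: "(\<lambda>g. g (grid a n i)) \<in> borel_measurable (\<Pi>\<^sub>M t\<in>T. borel)" if "n \<le> N" "i \<le> Suc n" for n i
      using gT[OF that] by measurable
    have Em: "E \<in> sets (\<Pi>\<^sub>M t\<in>T. borel)" unfolding E_def by measurable
    have "A N = {\<omega> \<in> space M. (\<lambda>t\<in>T. residual a t \<omega>) \<in> E}"
      unfolding A_def E_def X_def using gT by (auto simp: space_PiM)
    moreover from this have "?C \<inter> A N = {\<omega> \<in> space M. L \<le> B a \<omega> \<and> (\<lambda>t\<in>T. residual a t \<omega>) \<in> E}" by auto
    ultimately show ?thesis using prob_residual_event[OF a T aT Em, of L] by simp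
  qed
  \<comment> \<open>Continuity from above, used for \<open>A N\<close> and for its intersection with
    \<open>?C\<close>, carries the product rule over to the loss event.\<close>
  have "(\<lambda>N. prob (A N)) \<longlonglongrightarrow> prob (\<Inter>N. A N)"
    using Am Adec by (intro finite_Lim_measure_decseq) auto
  then have "(\<lambda>N. prob (?C \<inter> A N)) \<longlonglongrightarrow> prob ?C * prob (\<Inter>N. A N)"
    unfolding ind by (intro tendsto_mult tendsto_const)
  moreover have "(\<lambda>N. prob (?C \<inter> A N)) \<longlonglongrightarrow> prob (\<Inter>N. ?C \<inter> A N)"
    using Am Cm Adec by (intro finite_Lim_measure_decseq) (auto simp: decseq_def)
  ultimately have "prob (\<Inter>N. ?C \<inter> A N) = prob ?C * prob (\<Inter>N. A N)" by (rule LIMSEQ_unique[symmetric])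
  then have "0 < prob (\<Inter>N. ?C \<inter> A N)"
    using prob_B_ge_pos[OF a, of L] PK unfolding AI by simp
  also have "\<dots> \<le> prob {\<omega> \<in> space M. y \<le> B a \<omega> \<and> max_loss B a \<omega> \<le> y}"
  proof (rule finite_measure_mono)
    show "(\<Inter>N. ?C \<inter> A N) \<subseteq> {\<omega> \<in> space M. y \<le> B a \<omega> \<and> max_loss B a \<omega> \<le> y}"
    proof
      fix \<omega> assume "\<omega> \<in> (\<Inter>N. ?C \<inter> A N)"
      then have "\<omega> \<in> ?C" "\<omega> \<in> (\<Inter>N. A N)" by auto
      then have \<omega>: "\<omega> \<in> space M" and L: "L \<le> B a \<omega>" and loss: "max_loss (X K) a \<omega> \<le> y" unfolding AI by auto
      have "B u \<omega> - B v \<omega> \<le> y" if uv: "0 \<le> u" "u \<le> v" "v \<le> a" for u v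
      proof -
        have "X K u \<omega> - X K v \<omega> \<le> y"
          using loss max_loss_le_iff[of a "X K" \<omega> y] a Xcont[OF \<omega>] uv by simp
        moreover have "(B a \<omega> - real K) * (regression a u - regression a v) \<le> 0"
          using L regression_mono[OF a uv] unfolding L_def by (intro mult_nonneg_nonpos) auto
        ultimately show ?thesis unfolding X_def residual_def by (simp add: algebra_simps)
      qed
      then have "max_loss B a \<omega> \<le> y"
        using max_loss_le_iff[of a B \<omega> y] a B_continuous[OF \<omega>] by simp
      then show "\<omega> \<in> {\<omega> \<in> space M. y \<le> B a \<omega> \<and> max_loss B a \<omega> \<le> y}"
        using \<omega> L unfolding L_def by simp
    qed
    show "{\<omega> \<in> space M. y \<le> B a \<omega> \<and> max_loss B a \<omega> \<le> y} \<in> sets M" by measurable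
  qed
  finally show ?thesis .
qed

text \<open>The event \<open>?G\<close> has positive probability and is disjoint from {loss > y},
  yet both lie in {range >= y}: \<open>?G\<close> because the range is at least B a - B 0 = B a, the
  other because the range is at least the loss.\<close>

lemma max_loss_prob_less:
  assumes a: "0 < a" and y: "0 < y"
  shows "prob {\<omega> \<in> space M. max_loss B a \<omega> > y} < prob {\<omega> \<in> space M. process_range B a \<omega> \<ge> y}"
proof -
  have [measurable]: "B a \<in> borel_measurable M" using a B_measurable by simp
  have [measurable]: "max_loss B a \<in> borel_measurable M"
    by (rule max_loss_measurable[OF a B_measurable B_continuous]) auto
  have [measurable]: "process_range B a \<in> borel_measurable M" using process_range_expectation_le(1)[OF a] by auto
  let ?G = "{\<omega> \<in> space M. y \<le> B a \<omega> \<and> max_loss B a \<omega> \<le> y}"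
  let ?L = "{\<omega> \<in> space M. max_loss B a \<omega> > y}"
  have "prob ?L < prob ?L + prob ?G" using prob_small_loss_large_end_pos[OF a y] by simp
  also have "\<dots> = prob (?L \<union> ?G)" by (rule finite_measure_Union[symmetric]) auto
  also have "\<dots> \<le> prob {\<omega> \<in> space M. process_range B a \<omega> \<ge> y}"
  proof (rule finite_measure_mono)
    have "y \<le> process_range B a \<omega>" if \<omega>: "\<omega> \<in> space M" and "y < max_loss B a \<omega> \<or> y \<le> B a \<omega>" for \<omega>
      using that(2) max_loss_le_process_range[of a B \<omega>] diff_le_process_range[of a B \<omega> a 0] B_continuous[OF \<omega>] B_0[OF \<omega>] a
      by auto
    then show "?L \<union> ?G \<subseteq> {\<omega> \<in> space M. process_range B a \<omega> \<ge> y}" by auto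
  qed measurable
  finally show ?thesis .
qed

lemma process_range_tail_le:
  assumes a: "0 < a" and y: "0 < y"
  shows "prob {\<omega> \<in> space M. process_range B a \<omega> \<ge> y} \<le> 2 * (a powr H * sqrt (2 / pi)) / y"
proof -
  have nn: "0 \<le> process_range B a \<omega>" if "\<omega> \<in> space M" for \<omega>
    using diff_le_process_range[of a B \<omega> 0 0] B_continuous[OF that] a by simp
  have "prob {\<omega> \<in> space M. process_range B a \<omega> \<ge> y} \<le> expectation (process_range B a) / y"
    using process_range_expectation_le(1)[OF a] nn y by (intro integral_Markov_inequality_measure[where A="{}", simplified]) auto
  also have "\<dots> \<le> 2 * (a powr H * sqrt (2 / pi)) / y"
    using process_range_expectation_le(2)[OF a] y by (intro divide_right_mono) auto
  finally show ?thesis .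
qed

text \<open>From below, the loss dominates both 0 and B 0 - B a, hence (|B a| - B a) / 2, whose mean
  is half of E |B a|; this is the source of the factor 1 / 2.\<close>

lemma max_loss_expectation_bounds:
  assumes a: "0 < a"
  shows "a powr H * sqrt (2 / pi) / 2 \<le> expectation (max_loss B a)"
    and "expectation (max_loss B a) \<le> 2 * (a powr H * sqrt (2 / pi))"
proof -
  have Bm: "B a \<in> borel_measurable M" using a B_measurable by simp
  have Lm: "max_loss B a \<in> borel_measurable M"
    by (rule max_loss_measurable[OF a B_measurable B_continuous]) auto
  note R = process_range_expectation_le[OF a]
  have ge: "0 \<le> max_loss B a \<omega>" "- B a \<omega> \<le> max_loss B a \<omega>" "max_loss B a \<omega> \<le> process_range B a \<omega>" if \<omega>: "\<omega> \<in> space M" for \<omega>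
    using max_loss_ge[of a B \<omega> 0 0] max_loss_ge[of a B \<omega> 0 a] max_loss_le_process_range[of a B \<omega>] B_continuous[OF \<omega>] B_0[OF \<omega>] a by auto
  have int: "integrable M (max_loss B a)"
    by (rule Bochner_Integration.integrable_bound[OF R(1) Lm]) (use ge in \<open>auto intro!: AE_I2 simp: abs_of_nonneg intro: order_trans[OF _ abs_ge_self]\<close>)
  have "expectation (max_loss B a) \<le> expectation (process_range B a)"
    using int R(1) ge by (intro integral_mono) auto
  then show "expectation (max_loss B a) \<le> 2 * (a powr H * sqrt (2 / pi))" using R(2) by simp
  let ?\<sigma> = "sqrt (a powr (2 * H))"
  have V: "0 < a powr (2 * H)" using a by simp
  have D: "distributed M lborel (B a) (normal_density 0 ?\<sigma>)"
    using centered_gaussian_vector_char_component[OF B_gaussian_vector[of "{a}"], of a] a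
    by (intro distributed_normal_if_char[OF Bm V]) (auto simp: fbm_cov_diag[OF H_pos])
  have "?\<sigma> = a powr H" using a by (simp add: powr_half_sqrt[symmetric] powr_powr)
  then have "expectation (\<lambda>\<omega>. \<bar>B a \<omega>\<bar>) = a powr H * sqrt (2 / pi)"
    using distributed_integral[OF D, of "\<lambda>x. \<bar>x\<bar>"] integral_normal_moment_abs_odd[of ?\<sigma> 0 0] V by simp
  then have "a powr H * sqrt (2 / pi) / 2 = expectation (\<lambda>\<omega>. (\<bar>B a \<omega>\<bar> - B a \<omega>) / 2)"
    using a B_integrable B_mean by simp
  also have "\<dots> \<le> expectation (max_loss B a)"
  proof (rule integral_mono[OF _ int])
    show "integrable M (\<lambda>\<omega>. (\<bar>B a \<omega>\<bar> - B a \<omega>) / 2)" using a B_integrable by auto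
    show "(\<bar>B a \<omega>\<bar> - B a \<omega>) / 2 \<le> max_loss B a \<omega>" if "\<omega> \<in> space M" for \<omega>
      using ge[OF that] by (simp add: abs_if)
  qed
  finally show "a powr H * sqrt (2 / pi) / 2 \<le> expectation (max_loss B a)" .
qed

end

theorem theorem1:
  fixes M :: "'a measure" and B :: "real \<Rightarrow> 'a \<Rightarrow> real" and H a :: real
  assumes "fractional_brownian_motion M H B"
    and "1 / 2 < H" and "H < 1" and "0 < a"
  shows "sqrt 2 * a powr H / (2 * sqrt pi) \<le> prob_space.expectation M (max_loss B a) \<and>
         prob_space.expectation M (max_loss B a) \<le> 2 * sqrt 2 * a powr H / sqrt pi \<and>
         (\<forall>y>0. measure M {\<omega> \<in> space M. max_loss B a \<omega> > y}
                  < measure M {\<omega> \<in> space M. process_range B a \<omega> \<ge> y} \<and>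
                measure M {\<omega> \<in> space M. process_range B a \<omega> \<ge> y}
                  \<le> 2 * sqrt 2 * a powr H / (y * sqrt pi))"
proof -
  interpret prob_space M using assms(1) by (simp add: fractional_brownian_motion_def)
  interpret fbm M H B by unfold_locales (use assms in auto)
  show ?thesis
    using max_loss_expectation_bounds[OF assms(4)] max_loss_prob_less[OF assms(4)] process_range_tail_le[OF assms(4)]
    by (simp add: real_sqrt_divide mult_ac)
qed

end
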